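(* Let $m_0$ be a low-pass filter with associated scaling function $\varphi$, and assume: (i) $m_0$ is a continuous, even, $2\pi$-periodic function on $\mathbb R$ with $m_0(0)=1$; (ii) $\inf_{\xi\in[-\pi/3,\pi/3]}|m_0(\xi)|\neq 0$; (iii) $|m_0(\xi)|^2+|m_0(\xi+\pi)|^2=1$ for $\xi\in\mathbb R$; (iv) $\{\xi\in\mathbb R: m_0(\xi)\ne 0\}\cap[0,\pi]\subset[0,\tfrac{4\pi}{5})$. Let $\sigma>1$. If there are constants $\varepsilon,C_0,C_1,\rho_0,\rho_1>0$ such that $$C_1 f_{\rho_1,\sigma}\Big(\xi-\frac{2\pi}{3}\Big)\le |m_0(\xi)|\le C_0 f_{\rho_0,\sigma}\Big(\xi-\frac{2\pi}{3}\Big),\qquad \xi\in\Big[\frac{2\pi}{3}-\varepsilon,\frac{2\pi}{3}+\varepsilon\Big],$$ then for each $\eta>1$, with $\sigma_\eta=\dfrac{\sigma+\eta(\sigma-1)}{1+\eta(\sigma-1)}$, $$\widehat\varphi\in\mathbf\Gamma_\sigma(\mathbb R)\setminus\bigcup_{1<\sigma'<\sigma_\eta}\mathbf\Gamma_{\sigma'}(\mathbb R),$$ and consequently $$\varphi\in\mathcal E_\sigma(\mathbb R)\setminus\bigcup_{1<\sigma'<\sigma_\eta}\mathcal E_{\sigma'}(\mathbb R).$$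
   Context: $W$ is the principal branch of the Lambert function (the inverse of $z\mapsto ze^z$). For $\sigma>1$ put $\omega_\sigma(x)=x^{\frac{\sigma}{\sigma-1}}/W^{\frac1{\sigma-1}}(x)$ for $x>0$, $\omega_\sigma(0)=0$; $g_\sigma(x)=\omega_\sigma(\ln(1+|x|))$ for $x\in\mathbb R$; and for $\rho>0$, $f_{\rho,\sigma}(x)=e^{-\rho g_\sigma(1/x)}$ for $x\neq0$, $f_{\rho,\sigma}(0)=0$. A continuous function $\phi$ on $\mathbb R$ belongs to $\mathbf\Gamma_\sigma(\mathbb R)$ if there exist $\rho,C>0$ with $|\phi(x)|\le Ce^{-\rho g_\sigma(x)}$ for all $x\in\mathbb R$. Extended Gevrey classes: for $\tau>0$, $\sigma>1$ let $M_0^{\tau,\sigma}=1$ and $M_p^{\tau,\sigma}=p^{\tau p^{\sigma}}$ for $p\in\mathbb N=\{1,2,\dots\}$. A smooth function $\phi$ on $\mathbb R$ belongs to $\mathcal E_{\tau,\sigma}(\mathbb R)$ if for every compact $\mathbb K\subset\mathbb R$ there is $C>0$ such that $\sup_{x\in\mathbb K}|\phi^{(p)}(x)|\le C^{p^{\sigma}+1}M_p^{\tau,\sigma}$ for all $p\in\mathbb N_0$. Set $\mathcal E_\sigma(\mathbb R)=\bigcup_{\tau>0}\mathcal E_{\tau,\sigma}(\mathbb R)$. Low-pass filter and scaling function: $m_0$ is the low-pass filter of a multiresolution analysis of $L^2(\mathbb R)$ (giving rise to an orthonormal wavelet), and the associated scaling function $\varphi\in L^2(\mathbb R)$ is given by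 $\hat\varphi(\xi)=\prod_{j=1}^\infty m_0(2^{-j}\xi)$, $\xi\in\mathbb R$, where the Fourier transform is $\hat f(\xi)=\int_{\mathbb R}f(x)e^{-ix\xi}\,dx$. *)

theory Defs
  imports "HOL-Analysis.Analysis"
begin

text \<open>Intended for arguments \<open>x \<ge> - exp (-1)\<close>, where the branch with values in \<open>[-1, \<infinity>)\<close> is
  the principal one.\<close>

definition Lambert_W :: "real \<Rightarrow> real" where
  "Lambert_W x = (THE w. w \<ge> -1 \<and> w * exp w = x)"

definition omega :: "real \<Rightarrow> real \<Rightarrow> real" where
  "omega \<sigma> x = (if x = 0 then 0
     else x powr (\<sigma> / (\<sigma> - 1)) / Lambert_W x powr (1 / (\<sigma> - 1)))"

definition g_weight :: "real \<Rightarrow> real \<Rightarrow> real" where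
  "g_weight \<sigma> x = omega \<sigma> (ln (1 + \<bar>x\<bar>))"

definition f_flat :: "real \<Rightarrow> real \<Rightarrow> real \<Rightarrow> real" where
  "f_flat \<rho> \<sigma> x = (if x = 0 then 0 else exp (- \<rho> * g_weight \<sigma> (1 / x)))"

definition Gamma_class :: "real \<Rightarrow> (real \<Rightarrow> complex) set" where
  "Gamma_class \<sigma> = {\<phi>. continuous_on UNIV \<phi> \<and>
     (\<exists>\<rho>>0. \<exists>C>0. \<forall>x. cmod (\<phi> x) \<le> C * exp (- \<rho> * g_weight \<sigma> x))}"

definition nth_deriv :: "nat \<Rightarrow> (real \<Rightarrow> complex) \<Rightarrow> real \<Rightarrow> complex" where
  "nth_deriv p = (\<lambda>f x. vector_derivative f (at x)) ^^ p"

definition smooth :: "(real \<Rightarrow> complex) \<Rightarrow> bool" where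
  "smooth f \<longleftrightarrow> (\<forall>p x. nth_deriv p f differentiable (at x))"

definition M_seq :: "real \<Rightarrow> real \<Rightarrow> nat \<Rightarrow> real" where
  "M_seq \<tau> \<sigma> p = (if p = 0 then 1 else real p powr (\<tau> * real p powr \<sigma>))"

definition ext_gevrey_tau :: "real \<Rightarrow> real \<Rightarrow> (real \<Rightarrow> complex) set" where
  "ext_gevrey_tau \<tau> \<sigma> = {\<phi>. smooth \<phi> \<and>
     (\<forall>K. compact K \<longrightarrow> (\<exists>C>0. \<forall>p. \<forall>x\<in>K.
        cmod (nth_deriv p \<phi> x) \<le> C powr (real p powr \<sigma> + 1) * M_seq \<tau> \<sigma> p))}"

definition ext_gevrey :: "real \<Rightarrow> (real \<Rightarrow> complex) set" where
  "ext_gevrey \<sigma> = (\<Union>\<tau>\<in>{0<..}. ext_gevrey_tau \<tau> \<sigma>)"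

text \<open>Elements of \<open>L\<^sup>2(\<real>)\<close> are represented by Borel functions. Functions that agree almost
  everywhere are kept apart, but a set of functions that is closed in the sense below is saturated
  under almost everywhere equality.\<close>

definition L2 :: "(real \<Rightarrow> complex) set" where
  "L2 = {f \<in> borel_measurable lborel. integrable lborel (\<lambda>x. (cmod (f x))\<^sup>2)}"

definition L2_dist_sq :: "(real \<Rightarrow> complex) \<Rightarrow> (real \<Rightarrow> complex) \<Rightarrow> ennreal" where
  "L2_dist_sq f g = (\<integral>\<^sup>+ x. ennreal ((cmod (f x - g x))\<^sup>2) \<partial>lborel)"

definition L2_inner :: "(real \<Rightarrow> complex) \<Rightarrow> (real \<Rightarrow> complex) \<Rightarrow> complex" where
  "L2_inner f g = (\<integral>x. f x * cnj (g x) \<partial>lborel)"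

definition L2_closed_subspace :: "(real \<Rightarrow> complex) set \<Rightarrow> bool" where
  "L2_closed_subspace V \<longleftrightarrow>
     V \<subseteq> L2 \<and> (\<lambda>x. 0) \<in> V \<and>
     (\<forall>f\<in>V. \<forall>g\<in>V. (\<lambda>x. f x + g x) \<in> V) \<and>
     (\<forall>f\<in>V. \<forall>c. (\<lambda>x. c * f x) \<in> V) \<and>
     (\<forall>F. \<forall>f\<in>L2. (\<forall>n::nat. F n \<in> V) \<and> (\<lambda>n. L2_dist_sq (F n) f) \<longlonglongrightarrow> 0 \<longrightarrow> f \<in> V)"

text \<open>\<open>F\<close> is the Fourier--Plancherel transform of \<open>f\<close>, normalised as
  \<open>\<integral> f(x) exp(-i x \<xi>) dx\<close>: the truncated integrals converge to \<open>F\<close> in \<open>L\<^sup>2\<close>. It is determined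
  only up to a null set.\<close>

definition L2_fourier_transform :: "(real \<Rightarrow> complex) \<Rightarrow> (real \<Rightarrow> complex) \<Rightarrow> bool" where
  "L2_fourier_transform f F \<longleftrightarrow> f \<in> L2 \<and> F \<in> L2 \<and>
     (\<lambda>n::nat. L2_dist_sq F (\<lambda>\<xi>. \<integral>x\<in>{- real n..real n}.
        (f x * exp (- (\<i> * complex_of_real (x * \<xi>)))) \<partial>lborel)) \<longlonglongrightarrow> 0"

text \<open>The last three conjuncts say that the integer translates of \<open>\<phi>\<close> form an orthonormal basis
  of \<open>V 0\<close>.\<close>

definition multiresolution_analysis ::
  "(int \<Rightarrow> (real \<Rightarrow> complex) set) \<Rightarrow> (real \<Rightarrow> complex) \<Rightarrow> bool" where
  "multiresolution_analysis V \<phi> \<longleftrightarrow>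
     (\<forall>j. L2_closed_subspace (V j)) \<and>
     (\<forall>j. V j \<subseteq> V (j + 1)) \<and>
     (\<forall>j. \<forall>f\<in>L2. f \<in> V j \<longleftrightarrow> (\<lambda>x. f (2 * x)) \<in> V (j + 1)) \<and>
     (\<forall>f\<in>(\<Inter>j. V j). AE x in lborel. f x = 0) \<and>
     (\<forall>f\<in>L2. \<forall>e>0. \<exists>j. \<exists>h\<in>V j. L2_dist_sq f h < e) \<and>
     (\<forall>k::int. (\<lambda>x. \<phi> (x - of_int k)) \<in> V 0) \<and>
     (\<forall>k l::int. L2_inner (\<lambda>x. \<phi> (x - of_int k)) (\<lambda>x. \<phi> (x - of_int l)) =
        (if k = l then 1 else 0)) \<and>
     (\<forall>f\<in>V 0. \<forall>e>0. \<exists>(A::int set) c. finite A \<and>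
        L2_dist_sq f (\<lambda>x. \<Sum>k\<in>A. c k * \<phi> (x - of_int k)) < e)"

text \<open>The low-pass filter is the \<open>2\<pi>\<close>-periodic function of the two-scale relation
  \<open>\<phi>hat(2 \<xi>) = m(\<xi>) \<phi>hat(\<xi>)\<close>; it is unique up to a null set.\<close>

definition low_pass_filter :: "(real \<Rightarrow> complex) \<Rightarrow> (real \<Rightarrow> complex) \<Rightarrow> bool" where
  "low_pass_filter m \<phi> \<longleftrightarrow>
     m \<in> borel_measurable borel \<and> (\<forall>\<xi>. m (\<xi> + 2 * pi) = m \<xi>) \<and>
     (\<exists>V. multiresolution_analysis V \<phi>) \<and>
     (\<exists>\<phi>hat. L2_fourier_transform \<phi> \<phi>hat \<and>
        (AE \<xi> in lborel. \<phi>hat (2 * \<xi>) = m \<xi> * \<phi>hat \<xi>))"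

definition sigma_eta :: "real \<Rightarrow> real \<Rightarrow> real" where
  "sigma_eta \<sigma> \<eta> = (\<sigma> + \<eta> * (\<sigma> - 1)) / (1 + \<eta> * (\<sigma> - 1))"

end

theory Submission
  imports Defs "HOL-Probability.Probability" "HOL-Real_Asymp.Real_Asymp"
begin

text \<open>Conditions (iii) and (iv) force \<open>m0 = 1\<close> near 0, so \<open>\<phi>hat\<close> is locally a finite product. As
  \<open>\<plusminus>2\<pi>/3\<close> is a cycle of doubling modulo \<open>2\<pi>\<close>, a point \<open>\<xi> = 2 ^ J * (2 * pi / 3) + t\<close> passes through
  the offsets \<open>(-2) ^ k * t / 2 ^ J\<close> from \<open>2 * pi / 3\<close>, and \<open>\<phi>hat \<xi> = 0\<close> unless all of them stay small.
  Hence \<open>\<phi>hat\<close> lives on bounded clusters around \<open>\<plusminus>2 ^ J * (2 * pi / 3)\<close>. The first offset alone gives the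
  decay of \<open>\<Gamma>\<^sub>\<sigma>\<close>; on one side of the cluster centre the product of all \<open>J\<close> factors has constant sign and
  is at least \<open>exp (- C * J powr (1 + \<sigma> / (\<sigma> - 1)))\<close>.

  Membership in \<open>\<E>\<^sub>\<sigma>\<close> only gives bounds on compact sets, which do not control the Fourier transform of a
  function without compact support. For the negative part \<open>\<xi> ^ p * \<phi>hat \<xi>\<close> is therefore integrated against
  kernels whose inverse Fourier transforms live on \<open>[-1, 1]\<close> and which are sharply peaked inside one
  cluster. The clusters being lacunary, all other contributions are negligible, and derivative bounds
  on \<open>[-1, 1]\<close> contradict the lower bound. Since \<open>\<Gamma>\<^sub>\<sigma>\<close> is mapped into \<open>\<E>\<^sub>\<sigma>\<close> by the inverse Fourier
  transform, both negative statements follow.\<close>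

section \<open>The Lambert function and the weights\<close>

text \<open>Why the exponents meet at \<open>sigma_eta\<close>: with
  \<open>s = \<sigma> / (\<sigma> - 1)\<close>, each of \<open>J\<close> factors near
  \<open>2 ^ J\<close> is bounded below by about \<open>exp (- const * J powr s)\<close>, so the
  product loses the exponent \<open>1 + s\<close>. Membership in the class of
  \<open>\<sigma>'\<close> would force, up to logarithms, a decay of order
  \<open>\<sigma>' / (\<sigma>' - 1) = 1 + 1 / (\<sigma>' - 1)\<close>. The two conflict if
  \<open>s < 1 / (\<sigma>' - 1)\<close>, that is
  \<open>\<sigma>' < (2 * \<sigma> - 1) / \<sigma>\<close>, and this value is the limit of
  \<open>sigma_eta \<sigma> \<eta>\<close> as \<open>\<eta>\<close> falls to 1. A nonzero kernel
  with compactly supported inverse transform cannot vanish on an interval, so it cannot isolate a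
  cluster exactly. It must be small on the rest of the cluster, where the sign of the transform is
  unknown, and also on all other clusters in spite of the weight \<open>\<xi> ^ p\<close>. The first
  is achieved by a high power \<open>N\<close>, the second by decay in the distance, which
  lacunarity makes comparable with \<open>\<bar>\<xi>\<bar>\<close>.\<close>

lemma mult_exp_less:
  fixes v w :: real
  assumes "0 \<le> v" "v < w"
  shows "v * exp v < w * exp w"
  using assms by (intro mult_strict_mono) auto

lemma Lambert_W_pos:
  assumes "x > 0"
  shows "Lambert_W x > 0" and "Lambert_W x * exp (Lambert_W x) = x"
proof -
  have "\<exists>w\<ge>0. w \<le> x \<and> w * exp w = x"
  proof (rule IVT)
    show "x \<le> x * exp x" using assms by simp
  qed (use assms in \<open>auto intro!: continuous_intros\<close>)
  then obtain w where w: "w \<ge> 0" "w * exp w = x" by auto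
  \<comment> \<open>The branch condition admits values in \<open>[-1, 0]\<close>, but a positive
    product forces \<open>v > 0\<close>, where \<open>mult_exp_less\<close> gives
    injectivity.\<close>
  have uniq: "v = w" if v: "v \<ge> -1" "v * exp v = x" for v
  proof -
    have "v > 0" using v(2) assms by (metis exp_gt_zero zero_less_mult_pos2)
    then show ?thesis
      using mult_exp_less[of v w] mult_exp_less[of w v] w v by force
  qed
  have "Lambert_W x = w"
    unfolding Lambert_W_def by (rule the_equality) (use w uniq in auto)
  moreover have "w > 0" using w assms by (cases "w = 0") auto
  ultimately show "Lambert_W x > 0" "Lambert_W x * exp (Lambert_W x) = x"
    using w by auto
qed

lemma Lambert_W_ge:
  assumes "x > 0" "w * exp w \<le> x"
  shows "w \<le> Lambert_W x"
  using Lambert_W_pos[OF assms(1)] mult_exp_less[of "Lambert_W x" w] assms(2) by force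

lemma Lambert_W_mono:
  assumes "0 < x" "x \<le> y"
  shows "Lambert_W x \<le> Lambert_W y"
  by (rule Lambert_W_ge) (use assms Lambert_W_pos[OF assms(1)] in auto)

text \<open>Since \<open>x = W * exp W\<close>, the quotient \<open>x / W\<close> is
  \<open>exp W\<close>, and the two powers merge into one exponential. Monotonicity and scaling of
  \<open>omega\<close> are read off from this form.\<close>

lemma omega_eq:
  assumes "\<sigma> > 1" "x \<ge> 0"
  shows "omega \<sigma> x = x * exp (Lambert_W x / (\<sigma> - 1))"
proof (cases "x = 0")
  case False
  then have x: "x > 0" using assms by simp
  let ?w = "Lambert_W x"
  note w = Lambert_W_pos[OF x]
  have e: "\<sigma> / (\<sigma> - 1) = 1 + 1 / (\<sigma> - 1)" using assms by (simp add: field_simps)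
  have "omega \<sigma> x = x * (x powr (1 / (\<sigma> - 1)) / ?w powr (1 / (\<sigma> - 1)))"
    using x by (simp add: omega_def e powr_add)
  also have "x powr (1 / (\<sigma> - 1)) / ?w powr (1 / (\<sigma> - 1)) = (x / ?w) powr (1 / (\<sigma> - 1))"
    using x w by (simp add: powr_divide)
  also have "x / ?w = exp ?w" using w by (simp add: field_simps)
  also have "exp ?w powr (1 / (\<sigma> - 1)) = exp (?w / (\<sigma> - 1))"
    by (simp add: powr_def)
  finally show ?thesis .
qed (simp add: omega_def)

lemma omega_nonneg: "\<sigma> > 1 \<Longrightarrow> x \<ge> 0 \<Longrightarrow> omega \<sigma> x \<ge> 0"
  by (simp add: omega_eq)

lemma omega_mono:
  assumes "\<sigma> > 1" "0 \<le> x" "x \<le> y"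
  shows "omega \<sigma> x \<le> omega \<sigma> y"
proof (cases "x = 0")
  case False
  then show ?thesis
    using assms Lambert_W_mono[of x y]
    by (auto simp: omega_eq intro!: mult_mono divide_right_mono)
qed (use assms omega_nonneg in \<open>auto simp: omega_def\<close>)

text \<open>Lowering \<open>W\<close> by \<open>ln 2\<close> halves \<open>exp W\<close> and does
  not increase the other factor, so \<open>Lambert_W (x / 2)\<close> loses at most
  \<open>ln 2\<close>. The square in the comparison of weights in \<open>phat_Gamma_class\<close>
  becomes a factor 2 under \<open>ln\<close>, which this lemma removes.\<close>

lemma omega_half:
  assumes "\<sigma> > 1" "x \<ge> 0"
  shows "omega \<sigma> (x / 2) \<ge> exp (- ln 2 / (\<sigma> - 1)) / 2 * omega \<sigma> x"
proof (cases "x = 0")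
  case False
  then have x: "x > 0" using assms by simp
  note w = Lambert_W_pos[OF x]
  have "Lambert_W x - ln 2 \<le> Lambert_W (x / 2)"
  proof (rule Lambert_W_ge)
    have "(Lambert_W x - ln 2) * exp (Lambert_W x - ln 2) \<le> Lambert_W x * exp (Lambert_W x - ln 2)"
      by simp
    also have "\<dots> = x / 2" using w by (simp add: exp_diff)
    finally show "(Lambert_W x - ln 2) * exp (Lambert_W x - ln 2) \<le> x / 2" .
  qed (use x in simp)
  then have "exp ((Lambert_W x - ln 2) / (\<sigma> - 1)) \<le> exp (Lambert_W (x / 2) / (\<sigma> - 1))"
    using assms by (simp add: divide_right_mono)
  moreover have "exp ((Lambert_W x - ln 2) / (\<sigma> - 1))
      = exp (- ln 2 / (\<sigma> - 1)) * exp (Lambert_W x / (\<sigma> - 1))"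
    by (simp add: exp_add[symmetric] diff_divide_distrib)
  ultimately show ?thesis using assms x by (simp add: omega_eq mult_ac)
qed (simp add: omega_def)

lemma omega_le_powr:
  assumes "\<sigma> > 1" "x \<ge> exp 1"
  shows "omega \<sigma> x \<le> x powr (\<sigma> / (\<sigma> - 1))"
proof -
  have x: "x > 0" using assms(2) exp_gt_zero[of "1::real"] by linarith
  have "Lambert_W x \<ge> 1" by (rule Lambert_W_ge) (use x assms in auto)
  then have "Lambert_W x powr (1 / (\<sigma> - 1)) \<ge> 1" using assms by (simp add: ge_one_powr_ge_zero)
  then have "x powr (\<sigma> / (\<sigma> - 1)) / Lambert_W x powr (1 / (\<sigma> - 1)) \<le> x powr (\<sigma> / (\<sigma> - 1)) / 1"
    by (intro divide_left_mono) auto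
  then show ?thesis using x by (simp add: omega_def)
qed

text \<open>An upper bound for the Legendre conjugate of \<open>\<rho> * omega \<sigma>\<close>. If
  the difference is positive, then \<open>exp (W / (\<sigma> - 1)) < q / \<rho>\<close>, which
  bounds \<open>W\<close> and with it \<open>t = W * exp W\<close>; then the subtracted term is
  dropped. The result is of order \<open>q powr \<sigma> * ln q\<close>, the growth of
  \<open>ln (M_seq \<tau> \<sigma> q)\<close>; \<open>max 0\<close> covers small
  \<open>q\<close>.\<close>

lemma omega_legendre:
  assumes "\<sigma> > 1" "\<rho> > 0" "q > 0" "t \<ge> 0"
  shows "q * t - \<rho> * omega \<sigma> t \<le> q * ((q / \<rho>) powr (\<sigma> - 1) * ((\<sigma> - 1) * max 0 (ln (q / \<rho>))))"
proof (cases "q * t > \<rho> * omega \<sigma> t")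
  case True
  let ?w = "Lambert_W t"
  have t: "t > 0" using True assms by (cases "t = 0") (auto simp: omega_def)
  note w = Lambert_W_pos[OF t]
  have "\<rho> * (t * exp (?w / (\<sigma> - 1))) < q * t" using True omega_eq[OF assms(1,4)] by simp
  then have "exp (?w / (\<sigma> - 1)) < q / \<rho>" using t assms by (simp add: field_simps)
  then have "?w / (\<sigma> - 1) < ln (q / \<rho>)" using assms by (metis exp_less_cancel_iff exp_ln divide_pos_pos)
  then have w1: "?w < (\<sigma> - 1) * ln (q / \<rho>)" using assms by (simp add: field_simps)
  have "t = ?w * exp ?w" using w by simp
  also have "\<dots> \<le> (\<sigma> - 1) * ln (q / \<rho>) * exp ((\<sigma> - 1) * ln (q / \<rho>))"
    using w w1 by (intro mult_mono) auto
  also have "exp ((\<sigma> - 1) * ln (q / \<rho>)) = (q / \<rho>) powr (\<sigma> - 1)"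
    using assms by (simp add: powr_def)
  finally have "t \<le> (q / \<rho>) powr (\<sigma> - 1) * ((\<sigma> - 1) * ln (q / \<rho>))" by (simp add: mult_ac)
  also have "\<dots> \<le> (q / \<rho>) powr (\<sigma> - 1) * ((\<sigma> - 1) * max 0 (ln (q / \<rho>)))"
    using assms by (intro mult_left_mono) auto
  finally have "q * t \<le> q * ((q / \<rho>) powr (\<sigma> - 1) * ((\<sigma> - 1) * max 0 (ln (q / \<rho>))))"
    using assms by (intro mult_left_mono) auto
  moreover have "\<rho> * omega \<sigma> t \<ge> 0" using assms omega_nonneg by simp
  ultimately show ?thesis by linarith
next
  case False
  moreover have "0 \<le> q * ((q / \<rho>) powr (\<sigma> - 1) * ((\<sigma> - 1) * max 0 (ln (q / \<rho>))))"
    using assms by (intro mult_nonneg_nonneg) auto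
  ultimately show ?thesis by linarith
qed

section \<open>Decay and moments of functions in the weight classes\<close>

lemma
  shows integrable_inverse_1_plus_square_UNIV: "integrable lborel (\<lambda>x::real. 1 / (1 + x\<^sup>2))"
    and integral_inverse_1_plus_square_UNIV: "(\<integral>x. 1 / (1 + (x::real)\<^sup>2) \<partial>lborel) = pi"
  using integrable_inverse_1_plus_square LBINT_inverse_1_plus_square
  by (simp_all add: set_integrable_def interval_lebesgue_integral_def set_lebesgue_integral_def
      inverse_eq_divide)

lemma Gamma_class_borel: "F \<in> Gamma_class \<sigma> \<Longrightarrow> F \<in> borel_measurable borel"
  by (auto simp: Gamma_class_def intro: borel_measurable_continuous_onI)

text \<open>In terms of \<open>t = ln (1 + \<bar>\<xi>\<bar>)\<close> the product is at most a
  constant times \<open>exp (p * t - \<rho> * omega \<sigma> t)\<close>. Applying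
  \<open>omega_legendre\<close> with \<open>q = p + 2\<close> instead of \<open>p\<close> leaves
  \<open>exp (- 2 * t)\<close> over, an integrable majorant.\<close>

lemma Gamma_class_decay:
  assumes F: "F \<in> Gamma_class \<sigma>" and \<sigma>: "\<sigma> > 1"
  obtains C \<rho> where "C > 0" "\<rho> > 0"
    "\<And>p \<xi>. \<bar>\<xi>\<bar> ^ p * cmod (F \<xi>) \<le> C * exp ((real p + 2) * (((real p + 2) / \<rho>) powr (\<sigma> - 1) *
        ((\<sigma> - 1) * max 0 (ln ((real p + 2) / \<rho>))))) * (1 / (1 + \<xi>\<^sup>2))"
proof -
  obtain \<rho> C where \<rho>: "\<rho> > 0" and C: "C > 0"
    and bd: "\<And>\<xi>. cmod (F \<xi>) \<le> C * exp (- \<rho> * g_weight \<sigma> \<xi>)"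
    using F by (auto simp: Gamma_class_def)
  have "\<bar>\<xi>\<bar> ^ p * cmod (F \<xi>) \<le> C * exp ((real p + 2) * (((real p + 2) / \<rho>) powr (\<sigma> - 1) *
        ((\<sigma> - 1) * max 0 (ln ((real p + 2) / \<rho>))))) * (1 / (1 + \<xi>\<^sup>2))" for p \<xi>
  proof -
    define t where "t = ln (1 + \<bar>\<xi>\<bar>)"
    have t: "t \<ge> 0" by (simp add: t_def)
    let ?S = "(real p + 2) * (((real p + 2) / \<rho>) powr (\<sigma> - 1) * ((\<sigma> - 1) * max 0 (ln ((real p + 2) / \<rho>))))"
    have "\<bar>\<xi>\<bar> ^ p * cmod (F \<xi>) \<le> (1 + \<bar>\<xi>\<bar>) ^ p * (C * exp (- \<rho> * omega \<sigma> t))"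
      using bd[of \<xi>] by (intro mult_mono power_mono) (auto simp: g_weight_def t_def)
    also have "(1 + \<bar>\<xi>\<bar>) ^ p = exp (real p * t)"
      by (simp add: t_def exp_of_nat_mult)
    also have "exp (real p * t) * (C * exp (- \<rho> * omega \<sigma> t))
        = C * exp ((real p + 2) * t - \<rho> * omega \<sigma> t) * exp (- 2 * t)"
      by (simp add: mult_ac exp_add[symmetric] algebra_simps)
    also have "\<dots> \<le> C * exp ?S * (1 / (1 + \<xi>\<^sup>2))"
    proof (intro mult_mono)
      show "exp ((real p + 2) * t - \<rho> * omega \<sigma> t) \<le> exp ?S"
        using omega_legendre[OF \<sigma> \<rho> _ t, of "real p + 2"] by simp
      have "exp (- 2 * t) = 1 / (exp t * exp t)" by (simp add: exp_minus field_simps flip: exp_add)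
      also have "\<dots> = 1 / ((1 + \<bar>\<xi>\<bar>) * (1 + \<bar>\<xi>\<bar>))" by (simp add: t_def)
      also have "\<dots> \<le> 1 / (1 + \<xi>\<^sup>2)"
        by (intro divide_left_mono mult_pos_pos) (auto simp: algebra_simps power2_eq_square add_pos_nonneg)
      finally show "exp (- 2 * t) \<le> 1 / (1 + \<xi>\<^sup>2)" .
    qed (use C in auto)
    finally show ?thesis .
  qed
  with C \<rho> that show ?thesis by blast
qed

lemma Gamma_class_moments_integrable:
  assumes F: "F \<in> Gamma_class \<sigma>" and \<sigma>: "\<sigma> > 1"
  shows "integrable lborel (\<lambda>\<xi>. \<bar>\<xi>\<bar> ^ p * cmod (F \<xi>))"
proof -
  have [measurable]: "F \<in> borel_measurable borel" by (rule Gamma_class_borel[OF F])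
  obtain C \<rho> where "C > 0" "\<rho> > 0" and bd:
    "\<And>p \<xi>. \<bar>\<xi>\<bar> ^ p * cmod (F \<xi>) \<le> C * exp ((real p + 2) * (((real p + 2) / \<rho>) powr (\<sigma> - 1) *
        ((\<sigma> - 1) * max 0 (ln ((real p + 2) / \<rho>))))) * (1 / (1 + \<xi>\<^sup>2))"
    using Gamma_class_decay[OF assms] by blast
  define K where "K = C * exp ((real p + 2) * (((real p + 2) / \<rho>) powr (\<sigma> - 1) *
        ((\<sigma> - 1) * max 0 (ln ((real p + 2) / \<rho>)))))"
  have "integrable lborel (\<lambda>\<xi>::real. K * (1 / (1 + \<xi>\<^sup>2)))"
    by (rule integrable_mult_right[OF integrable_inverse_1_plus_square_UNIV])
  then show ?thesis
  proof (rule Bochner_Integration.integrable_bound)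
    show "AE \<xi> in lborel. norm (\<bar>\<xi>\<bar> ^ p * cmod (F \<xi>)) \<le> norm (K * (1 / (1 + \<xi>\<^sup>2)))"
    proof (intro always_eventually allI)
      fix \<xi> :: real
      have "\<bar>\<xi>\<bar> ^ p * cmod (F \<xi>) \<le> K * (1 / (1 + \<xi>\<^sup>2))" unfolding K_def by (rule bd)
      then show "norm (\<bar>\<xi>\<bar> ^ p * cmod (F \<xi>)) \<le> norm (K * (1 / (1 + \<xi>\<^sup>2)))"
        using abs_ge_self[of "K * (1 / (1 + \<xi>\<^sup>2))"] unfolding real_norm_def abs_mult abs_norm_cancel power_abs abs_abs by linarith
    qed
  qed simp
qed

text \<open>For \<open>p \<ge> 1\<close> the shift is absorbed by \<open>p + 2 \<le> 3 * p\<close>.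
  The logarithm then splits: the part \<open>ln p\<close> produces \<open>M_seq\<close>, while the
  part from \<open>ln (3 / \<rho>)\<close> is proportional to \<open>p powr \<sigma>\<close> and
  goes into the base \<open>C\<close>. The case \<open>p = 0\<close> stands apart, as
  \<open>M_seq\<close> is 1 there by definition.\<close>

lemma Gamma_class_moments:
  assumes F: "F \<in> Gamma_class \<sigma>" and \<sigma>: "\<sigma> > 1"
  obtains C \<tau> where "C > 0" "\<tau> > 0"
    "\<And>p. (\<integral>\<xi>. \<bar>\<xi>\<bar> ^ p * cmod (F \<xi>) \<partial>lborel) \<le> C powr (real p powr \<sigma> + 1) * M_seq \<tau> \<sigma> p"
proof -
  obtain C \<rho> where C: "C > 0" and \<rho>: "\<rho> > 0" and bd:
    "\<And>p \<xi>. \<bar>\<xi>\<bar> ^ p * cmod (F \<xi>) \<le> C * exp ((real p + 2) * (((real p + 2) / \<rho>) powr (\<sigma> - 1) *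
        ((\<sigma> - 1) * max 0 (ln ((real p + 2) / \<rho>))))) * (1 / (1 + \<xi>\<^sup>2))"
    using Gamma_class_decay[OF assms] by blast
  define S where "S p = (real p + 2) * (((real p + 2) / \<rho>) powr (\<sigma> - 1) *
        ((\<sigma> - 1) * max 0 (ln ((real p + 2) / \<rho>))))" for p
  have int: "(\<integral>\<xi>. \<bar>\<xi>\<bar> ^ p * cmod (F \<xi>) \<partial>lborel) \<le> C * pi * exp (S p)" for p
  proof -
    have "(\<integral>\<xi>. \<bar>\<xi>\<bar> ^ p * cmod (F \<xi>) \<partial>lborel) \<le> (\<integral>\<xi>. C * exp (S p) * (1 / (1 + \<xi>\<^sup>2)) \<partial>lborel)"
      using bd unfolding S_def
      by (intro integral_mono Gamma_class_moments_integrable[OF F \<sigma>] integrable_mult_right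
          integrable_inverse_1_plus_square_UNIV) auto
    also have "\<dots> = C * exp (S p) * pi"
      by (subst integral_mult_right_zero) (simp only: integral_inverse_1_plus_square_UNIV)
    finally show ?thesis by (simp add: mult_ac)
  qed
  define L where "L = max 0 (ln (3 / \<rho>))"
  define \<tau> where "\<tau> = 3 * (3 / \<rho>) powr (\<sigma> - 1) * (\<sigma> - 1)"
  have \<tau>: "\<tau> > 0" using \<sigma> \<rho> by (simp add: \<tau>_def)
  have S: "S p \<le> \<tau> * real p powr \<sigma> * ln (real p) + \<tau> * L * real p powr \<sigma>" if p: "p \<ge> 1" for p
  proof -
    have p3: "real p + 2 \<le> 3 * real p" using p by linarith
    have "S p \<le> (3 * real p) * ((3 * real p / \<rho>) powr (\<sigma> - 1) * ((\<sigma> - 1) * (ln (real p) + L)))"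
      unfolding S_def
    proof (intro mult_mono powr_mono2 divide_right_mono p3)
      have "ln ((real p + 2) / \<rho>) \<le> ln (real p * (3 / \<rho>))"
        using p3 \<rho> by (simp add: divide_right_mono add_pos_pos mult.commute)
      also have "\<dots> = ln (real p) + ln (3 / \<rho>)" using p \<rho> by (subst ln_mult) auto
      finally show "max 0 (ln ((real p + 2) / \<rho>)) \<le> ln (real p) + L"
        using p by (auto simp: L_def)
    qed (use \<sigma> \<rho> in auto)
    also have "(3 * real p / \<rho>) powr (\<sigma> - 1) = (3 / \<rho>) powr (\<sigma> - 1) * real p powr (\<sigma> - 1)"
      using \<rho> by (simp add: powr_mult[symmetric] mult_ac)
    also have "(3 * real p) * ((3 / \<rho>) powr (\<sigma> - 1) * real p powr (\<sigma> - 1) * ((\<sigma> - 1) * (ln (real p) + L)))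
      = \<tau> * (real p * real p powr (\<sigma> - 1)) * (ln (real p) + L)"
      by (simp add: \<tau>_def mult_ac)
    also have "real p * real p powr (\<sigma> - 1) = real p powr \<sigma>"
      using p by (simp add: powr_diff)
    finally show ?thesis by (simp add: algebra_simps)
  qed
  define D where "D = Max {1, C * pi, C * pi * exp (S 0), exp (\<tau> * L)}"
  have D: "1 \<le> D" "C * pi \<le> D" "C * pi * exp (S 0) \<le> D" "exp (\<tau> * L) \<le> D"
    by (auto simp: D_def)
  have "(\<integral>\<xi>. \<bar>\<xi>\<bar> ^ p * cmod (F \<xi>) \<partial>lborel) \<le> D powr (real p powr \<sigma> + 1) * M_seq \<tau> \<sigma> p" for p
  proof (cases "p = 0")
    case True
    then show ?thesis using int[of 0] D by (simp add: M_seq_def)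
  next
    case False
    have "(\<integral>\<xi>. \<bar>\<xi>\<bar> ^ p * cmod (F \<xi>) \<partial>lborel)
        \<le> C * pi * exp (\<tau> * real p powr \<sigma> * ln (real p) + \<tau> * L * real p powr \<sigma>)"
      using False C S[of p] by (intro order.trans[OF int]) auto
    also have "\<dots> = C * pi * exp (\<tau> * L) powr (real p powr \<sigma>) * M_seq \<tau> \<sigma> p"
      using False by (simp add: M_seq_def powr_def exp_add mult_ac)
    also have "\<dots> \<le> D * D powr (real p powr \<sigma>) * M_seq \<tau> \<sigma> p"
      using D by (intro mult_mono powr_mono2) (auto simp: M_seq_def)
    also have "D * D powr (real p powr \<sigma>) = D powr (real p powr \<sigma> + 1)"
      using D by (simp add: powr_add)
    finally show ?thesis .
  qed
  then show ?thesis using that[of D \<tau>] D \<tau> by auto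
qed

section \<open>The inverse Fourier transform of a function in \<open>\<Gamma>\<^sub>\<sigma>\<close>\<close>

definition inv_fourier :: "(real \<Rightarrow> complex) \<Rightarrow> real \<Rightarrow> complex" where
  "inv_fourier F x = (1 / (2 * complex_of_real pi)) * (\<integral>\<xi>. F \<xi> * iexp (x * \<xi>) \<partial>lborel)"

lemma cmod_iexp_minus_1: "cmod (iexp x - 1) \<le> \<bar>x\<bar>"
  using iexp_approx1[of x 0] by simp

lemma integrable_mult_iexp:
  fixes F :: "real \<Rightarrow> complex"
  assumes "integrable lborel F"
  shows "integrable lborel (\<lambda>\<xi>. F \<xi> * iexp (x * \<xi>))"
  using assms by (rule Bochner_Integration.integrable_bound)
    (use assms in \<open>auto simp: norm_mult dest!: borel_measurable_integrable\<close>)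

lemma has_vector_derivative_iff_quotient:
  "(f has_vector_derivative D) (at x) \<longleftrightarrow> ((\<lambda>y. (f y - f x) /\<^sub>R (y - x)) \<longlongrightarrow> D) (at x)"
proof -
  have eq: "norm ((f y - f x) /\<^sub>R (y - x) - D) = norm (f y - f x - (y - x) *\<^sub>R D) / norm (y - x)"
    if "y \<noteq> x" for y
  proof -
    have "(f y - f x) /\<^sub>R (y - x) - D = (f y - f x - (y - x) *\<^sub>R D) /\<^sub>R (y - x)"
      using that by (simp add: scaleR_diff_right)
    then show ?thesis by (simp add: divide_inverse)
  qed
  have "((\<lambda>y. (f y - f x) /\<^sub>R (y - x)) \<longlongrightarrow> D) (at x)
      \<longleftrightarrow> ((\<lambda>y. norm ((f y - f x) /\<^sub>R (y - x) - D)) \<longlongrightarrow> 0) (at x)"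
    by (simp add: tendsto_norm_zero_iff LIM_zero_iff)
  also have "\<dots> \<longleftrightarrow> ((\<lambda>y. norm (f y - f x - (y - x) *\<^sub>R D) / norm (y - x)) \<longlongrightarrow> 0) (at x)"
    by (rule filterlim_cong) (auto simp: eventually_at_filter eq)
  also have "\<dots> \<longleftrightarrow> (f has_vector_derivative D) (at x)"
    by (simp add: has_vector_derivative_def has_derivative_iff_norm bounded_linear_scaleR_left)
  finally show ?thesis ..
qed

text \<open>Dominated convergence along sequences: \<open>cmod_iexp_minus_1\<close> bounds the
  difference quotients of the exponential by \<open>\<bar>\<xi>\<bar>\<close> uniformly in the step,
  so \<open>\<xi> * F \<xi>\<close> provides a majorant.\<close>

lemma inv_fourier_has_vector_derivative:
  assumes F: "integrable lborel F" and F1: "integrable lborel (\<lambda>\<xi>. \<i> * of_real \<xi> * F \<xi>)"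
  shows "(inv_fourier F has_vector_derivative inv_fourier (\<lambda>\<xi>. \<i> * of_real \<xi> * F \<xi>) x) (at x)"
proof -
  have [measurable]: "F \<in> borel_measurable borel" using borel_measurable_integrable[OF F] by simp
  define I where "I x = (\<integral>\<xi>. F \<xi> * iexp (x * \<xi>) \<partial>lborel)" for x
  define I' where "I' = (\<integral>\<xi>. \<i> * of_real \<xi> * F \<xi> * iexp (x * \<xi>) \<partial>lborel)"
  have I: "(I has_vector_derivative I') (at x)"
    unfolding has_vector_derivative_iff_quotient
  proof -
    define q where "q y \<xi> = (F \<xi> * iexp (y * \<xi>) - F \<xi> * iexp (x * \<xi>)) /\<^sub>R (y - x)" for y \<xi>
    have "((\<lambda>y. (\<integral>\<xi>. q y \<xi> \<partial>lborel)) \<longlongrightarrow> I') (at x)"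
      unfolding tendsto_at_iff_sequentially comp_def
    proof safe
      fix Y :: "nat \<Rightarrow> real" assume Y: "\<forall>i. Y i \<in> UNIV - {x}" "Y \<longlonglongrightarrow> x"
      show "(\<lambda>n. (\<integral>\<xi>. q (Y n) \<xi> \<partial>lborel)) \<longlonglongrightarrow> I'"
        unfolding I'_def
      proof (rule integral_dominated_convergence)
        show "integrable lborel (\<lambda>\<xi>. norm (\<i> * of_real \<xi> * F \<xi>))"
          using F1 by (rule integrable_norm)
        show "(\<lambda>\<xi>. \<i> * of_real \<xi> * F \<xi> * iexp (x * \<xi>)) \<in> borel_measurable lborel"
          by measurable
        show "\<And>i. q (Y i) \<in> borel_measurable lborel" unfolding q_def by simp
        show "AE \<xi> in lborel. (\<lambda>n. q (Y n) \<xi>) \<longlonglongrightarrow> \<i> * of_real \<xi> * F \<xi> * iexp (x * \<xi>)"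
        proof (intro always_eventually allI)
          fix \<xi>
          have "((\<lambda>y. F \<xi> * iexp (y * \<xi>)) has_vector_derivative (\<i> * of_real \<xi> * F \<xi> * iexp (x * \<xi>))) (at x)"
            by (auto intro!: derivative_eq_intros has_vector_derivative_real_field simp: mult_ac)
          then have "((\<lambda>y. q y \<xi>) \<longlongrightarrow> \<i> * of_real \<xi> * F \<xi> * iexp (x * \<xi>)) (at x)"
            unfolding has_vector_derivative_iff_quotient q_def .
          then show "(\<lambda>n. q (Y n) \<xi>) \<longlonglongrightarrow> \<i> * of_real \<xi> * F \<xi> * iexp (x * \<xi>)"
            using Y unfolding tendsto_at_iff_sequentially comp_def by blast
        qed
        show "AE \<xi> in lborel. norm (q (Y i) \<xi>) \<le> norm (\<i> * of_real \<xi> * F \<xi>)" for i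
        proof (intro always_eventually allI)
          fix \<xi>
          have nz: "Y i - x \<noteq> 0" using Y by auto
          have "F \<xi> * iexp (Y i * \<xi>) - F \<xi> * iexp (x * \<xi>)
              = F \<xi> * iexp (x * \<xi>) * (iexp ((Y i - x) * \<xi>) - 1)"
            by (simp add: algebra_simps exp_add[symmetric])
          then have "norm (q (Y i) \<xi>) = norm (F \<xi> * iexp (x * \<xi>) * (iexp ((Y i - x) * \<xi>) - 1)) / \<bar>Y i - x\<bar>"
            unfolding q_def by (simp only: norm_scaleR) (simp add: divide_inverse)
          also have "\<dots> = cmod (F \<xi>) * cmod (iexp ((Y i - x) * \<xi>) - 1) / \<bar>Y i - x\<bar>"
            by (simp only: norm_mult norm_exp_i_times)
          also have "\<dots> \<le> cmod (F \<xi>) * \<bar>(Y i - x) * \<xi>\<bar> / \<bar>Y i - x\<bar>"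
            by (intro divide_right_mono mult_left_mono cmod_iexp_minus_1) auto
          also have "\<dots> = norm (\<i> * of_real \<xi> * F \<xi>)" using nz by (simp add: norm_mult abs_mult)
          finally show "norm (q (Y i) \<xi>) \<le> norm (\<i> * of_real \<xi> * F \<xi>)" .
        qed
      qed
    qed
    moreover have "(\<integral>\<xi>. q y \<xi> \<partial>lborel) = (I y - I x) /\<^sub>R (y - x)" for y
      unfolding q_def I_def
      by (simp only: integral_scaleR_right
          Bochner_Integration.integral_diff[OF integrable_mult_iexp[OF F] integrable_mult_iexp[OF F]])
    ultimately show "((\<lambda>y. (I y - I x) /\<^sub>R (y - x)) \<longlongrightarrow> I') (at x)" by simp
  qed
  have "((\<lambda>x. (1 / (2 * complex_of_real pi)) * I x) has_vector_derivative
      (1 / (2 * complex_of_real pi)) * I') (at x)"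
    by (rule has_vector_derivative_mult_right[OF I])
  then show ?thesis by (simp add: inv_fourier_def[abs_def] I_def I'_def)
qed

lemma cmod_inv_fourier_le:
  "cmod (inv_fourier F x) \<le> (\<integral>\<xi>. cmod (F \<xi>) \<partial>lborel)"
proof -
  have "cmod (\<integral>\<xi>. F \<xi> * iexp (x * \<xi>) \<partial>lborel) \<le> (\<integral>\<xi>. cmod (F \<xi> * iexp (x * \<xi>)) \<partial>lborel)"
    by (rule integral_norm_bound)
  also have "\<dots> = (\<integral>\<xi>. cmod (F \<xi>) \<partial>lborel)" by (simp add: norm_mult)
  finally have *: "cmod (\<integral>\<xi>. F \<xi> * iexp (x * \<xi>) \<partial>lborel) \<le> (\<integral>\<xi>. cmod (F \<xi>) \<partial>lborel)" .
  have "2 * pi \<ge> 1" using pi_gt3 by linarith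
  then have "1 / (2 * pi) * cmod (\<integral>\<xi>. F \<xi> * iexp (x * \<xi>) \<partial>lborel) \<le> 1 * (\<integral>\<xi>. cmod (F \<xi>) \<partial>lborel)"
    by (intro mult_mono *) auto
  then show ?thesis by (simp add: inv_fourier_def norm_mult norm_divide)
qed

lemma Gamma_class_integrable_power:
  assumes F: "F \<in> Gamma_class \<sigma>" and \<sigma>: "\<sigma> > 1"
  shows "integrable lborel (\<lambda>\<xi>. (\<i> * of_real \<xi>) ^ p * F \<xi>)"
proof -
  have [measurable]: "F \<in> borel_measurable borel" by (rule Gamma_class_borel[OF F])
  show ?thesis
    by (rule Bochner_Integration.integrable_bound[OF Gamma_class_moments_integrable[OF F \<sigma>, of p]])
       (auto simp: norm_mult norm_power)
qed

lemma Gamma_class_nth_deriv: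
  assumes F: "F \<in> Gamma_class \<sigma>" and \<sigma>: "\<sigma> > 1"
  shows "nth_deriv p (inv_fourier F) = inv_fourier (\<lambda>\<xi>. (\<i> * of_real \<xi>) ^ p * F \<xi>)"
    and "(nth_deriv p (inv_fourier F) has_vector_derivative nth_deriv (Suc p) (inv_fourier F) x) (at x)"
proof -
  have d: "(inv_fourier (\<lambda>\<xi>. (\<i> * of_real \<xi>) ^ p * F \<xi>) has_vector_derivative
      inv_fourier (\<lambda>\<xi>. (\<i> * of_real \<xi>) ^ Suc p * F \<xi>) x) (at x)" for p x
    using inv_fourier_has_vector_derivative[of "\<lambda>\<xi>. (\<i> * of_real \<xi>) ^ p * F \<xi>" x]
      Gamma_class_integrable_power[OF F \<sigma>, of p] Gamma_class_integrable_power[OF F \<sigma>, of "Suc p"]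
    by (simp add: mult_ac)
  have eq: "nth_deriv p (inv_fourier F) = inv_fourier (\<lambda>\<xi>. (\<i> * of_real \<xi>) ^ p * F \<xi>)" for p
  proof (induction p)
    case (Suc p)
    have "nth_deriv (Suc p) (inv_fourier F) x = vector_derivative (nth_deriv p (inv_fourier F)) (at x)" for x
      by (simp add: nth_deriv_def)
    then show ?case using Suc d by (auto simp: vector_derivative_at)
  qed (simp add: nth_deriv_def)
  show "nth_deriv p (inv_fourier F) = inv_fourier (\<lambda>\<xi>. (\<i> * of_real \<xi>) ^ p * F \<xi>)" by (rule eq)
  show "(nth_deriv p (inv_fourier F) has_vector_derivative nth_deriv (Suc p) (inv_fourier F) x) (at x)"
    unfolding eq by (rule d)
qed

text \<open>The absolute moments bound the derivatives on the whole line, so one constant serves all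
  compact sets.\<close>

lemma inv_fourier_ext_gevrey:
  assumes F: "F \<in> Gamma_class \<sigma>" and \<sigma>: "\<sigma> > 1"
  shows "inv_fourier F \<in> ext_gevrey \<sigma>"
proof -
  obtain C \<tau> where C: "C > 0" and \<tau>: "\<tau> > 0" and bd:
    "\<And>p. (\<integral>\<xi>. \<bar>\<xi>\<bar> ^ p * cmod (F \<xi>) \<partial>lborel) \<le> C powr (real p powr \<sigma> + 1) * M_seq \<tau> \<sigma> p"
    using Gamma_class_moments[OF assms] by blast
  have "smooth (inv_fourier F)"
    unfolding smooth_def using Gamma_class_nth_deriv(2)[OF F \<sigma>]
    by (auto simp: has_vector_derivative_def differentiable_def)
  moreover have "cmod (nth_deriv p (inv_fourier F) x) \<le> C powr (real p powr \<sigma> + 1) * M_seq \<tau> \<sigma> p" for p x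
  proof -
    have "cmod (nth_deriv p (inv_fourier F) x) \<le> (\<integral>\<xi>. cmod ((\<i> * of_real \<xi>) ^ p * F \<xi>) \<partial>lborel)"
      unfolding Gamma_class_nth_deriv(1)[OF F \<sigma>] by (rule cmod_inv_fourier_le)
    also have "\<dots> = (\<integral>\<xi>. \<bar>\<xi>\<bar> ^ p * cmod (F \<xi>) \<partial>lborel)" by (simp add: norm_mult norm_power)
    finally show ?thesis using bd[of p] by linarith
  qed
  ultimately have "inv_fourier F \<in> ext_gevrey_tau \<tau> \<sigma>"
    unfolding ext_gevrey_tau_def using C by blast
  then show ?thesis using \<tau> by (auto simp: ext_gevrey_def)
qed

section \<open>Fourier inversion in \<open>L\<^sup>2\<close>\<close>

text \<open>Reduction to Levy's uniqueness theorem for characteristic functions. At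
  \<open>t = 0\<close> the hypothesis says that the positive and negative parts of \<open>v\<close>
  have the same mass \<open>m\<close>; divided by \<open>m\<close> they become probability densities
  with equal characteristic functions. Mass 0 cannot be normalised and is treated first.\<close>

lemma fourier_unique_real:
  fixes v :: "real \<Rightarrow> real"
  assumes v: "integrable lborel v"
    and zero: "\<And>t. (\<integral>y. complex_of_real (v y) * iexp (t * y) \<partial>lborel) = 0"
  shows "AE y in lborel. v y = 0"
proof -
  have [measurable]: "v \<in> borel_measurable borel" using borel_measurable_integrable[OF v] by simp
  define p where "p y = max 0 (v y)" for y
  define n where "n y = max 0 (- v y)" for y
  have [measurable]: "p \<in> borel_measurable borel" "n \<in> borel_measurable borel"
    by (simp_all add: p_def[abs_def] n_def[abs_def])
  have p: "integrable lborel p" and n: "integrable lborel n"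
    using v by (auto simp: p_def[abs_def] n_def[abs_def] intro!: integrable_max)
  have pn: "p y - n y = v y" "p y \<ge> 0" "n y \<ge> 0" for y
    by (auto simp: p_def n_def)
  have eqt: "(\<integral>y. complex_of_real (p y) * iexp (t * y) \<partial>lborel) = (\<integral>y. complex_of_real (n y) * iexp (t * y) \<partial>lborel)" for t
  proof -
    have "(\<integral>y. complex_of_real (p y) * iexp (t * y) \<partial>lborel) - (\<integral>y. complex_of_real (n y) * iexp (t * y) \<partial>lborel)
      = (\<integral>y. complex_of_real (p y) * iexp (t * y) - complex_of_real (n y) * iexp (t * y) \<partial>lborel)"
      using p n by (intro Bochner_Integration.integral_diff[symmetric] integrable_mult_iexp integrable_of_real)
    also have "\<dots> = (\<integral>y. complex_of_real (v y) * iexp (t * y) \<partial>lborel)"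
      unfolding pn(1)[symmetric] by (simp add: algebra_simps)
    finally show ?thesis using zero by simp
  qed
  define m where "m = (\<integral>y. p y \<partial>lborel)"
  have mn: "m = (\<integral>y. n y \<partial>lborel)"
    using eqt[of 0] by (simp add: m_def del: of_real_eq_iff flip: of_real_eq_iff[where 'a=complex])
  have "m \<ge> 0" unfolding m_def by (intro integral_nonneg_AE) (simp add: pn)
  then consider "m = 0" | "m > 0" by linarith
  then have "AE y in lborel. p y = n y"
  proof cases
    case 1
    then have "AE y in lborel. p y = 0" "AE y in lborel. n y = 0"
      using integral_nonneg_eq_0_iff_AE[OF p] integral_nonneg_eq_0_iff_AE[OF n] mn
      by (simp_all add: m_def pn)
    then show ?thesis by eventually_elim simp
  next
    case 2
    define D where "D q = density lborel (\<lambda>y. ennreal (q y / m))" for q :: "real \<Rightarrow> real"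
    have D: "real_distribution (D q) \<and> (\<forall>t. char (D q) t = (\<integral>y. complex_of_real (q y) * iexp (t * y) \<partial>lborel) / m)"
      if q[measurable]: "q \<in> borel_measurable borel" and qi: "integrable lborel q"
        and q0: "\<And>y. q y \<ge> 0" and qm: "(\<integral>y. q y \<partial>lborel) = m" for q
    proof -
      have "emeasure (D q) (space (D q)) = (\<integral>\<^sup>+y. ennreal (q y / m) \<partial>lborel)"
        by (simp add: D_def emeasure_density)
      also have "\<dots> = ennreal (\<integral>y. q y / m \<partial>lborel)"
        using qi q0 2 by (intro nn_integral_eq_integral) auto
      also have "\<dots> = 1" using 2 qm by simp
      finally have "prob_space (D q)" by (rule prob_spaceI)
      then have "real_distribution (D q)"
        by (simp add: real_distribution_def real_distribution_axioms_def D_def)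
      moreover have "char (D q) t = (\<integral>y. complex_of_real (q y) * iexp (t * y) \<partial>lborel) / m" for t
      proof -
        have "char (D q) t = (\<integral>y. (q y / m) *\<^sub>R iexp (t * y) \<partial>lborel)"
          unfolding char_def D_def by (rule integral_density) (use q0 2 in auto)
        also have "\<dots> = (\<integral>y. complex_of_real (q y) * iexp (t * y) / m \<partial>lborel)"
          by (simp add: scaleR_conv_of_real)
        also have "\<dots> = (\<integral>y. complex_of_real (q y) * iexp (t * y) \<partial>lborel) / m"
          by (rule integral_divide_zero)
        finally show ?thesis .
      qed
      ultimately show ?thesis by blast
    qed
    have "real_distribution (D p)" "real_distribution (D n)" "char (D p) = char (D n)"
      using D[of p] D[of n] p n pn m_def mn eqt by auto
    then have "D p = D n" by (rule Levy_uniqueness)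
    then have "AE y in lborel. ennreal (p y / m) = ennreal (n y / m)"
      unfolding D_def by (subst (asm) sigma_finite_measure.density_unique_iff[OF sigma_finite_lborel]) auto
    then show ?thesis
      by eventually_elim (use 2 pn in \<open>simp add: ennreal_inj\<close>)
  qed
  then show ?thesis
    by eventually_elim (use pn(1) in \<open>metis diff_self\<close>)
qed

text \<open>Conjugation relates the transform of \<open>cnj g\<close> at \<open>t\<close> to that of
  \<open>g\<close> at \<open>-t\<close>, so the hypothesis passes to \<open>Re g\<close>. Applied to
  \<open>f\<close> and to \<open>- \<i> * f\<close> this covers both parts.\<close>

lemma fourier_unique:
  fixes f :: "real \<Rightarrow> complex"
  assumes f: "integrable lborel f"
    and zero: "\<And>t. (\<integral>y. f y * iexp (t * y) \<partial>lborel) = 0"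
  shows "AE y in lborel. f y = 0"
proof -
  have Re0: "AE y in lborel. Re (g y) = 0"
    if g: "integrable lborel g" and z: "\<And>t. (\<integral>y. g y * iexp (t * y) \<partial>lborel) = 0" for g :: "real \<Rightarrow> complex"
  proof (rule fourier_unique_real)
    show "integrable lborel (\<lambda>y. Re (g y))" using g by simp
    fix t
    have "cnj (\<integral>y. g y * iexp ((-t) * y) \<partial>lborel) = (\<integral>y. cnj (g y) * iexp (t * y) \<partial>lborel)"
      by (subst Bochner_Integration.integral_cnj[symmetric]) (simp add: exp_cnj)
    then have c: "(\<integral>y. cnj (g y) * iexp (t * y) \<partial>lborel) = 0" using z[of "-t"] by simp
    have "complex_of_real (Re (g y)) = g y * (1/2) + cnj (g y) * (1/2)" for y
      by (simp add: complex_eq_iff)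
    then have "(\<integral>y. complex_of_real (Re (g y)) * iexp (t * y) \<partial>lborel)
      = (\<integral>y. (1/2) * (g y * iexp (t * y)) + (1/2) * (cnj (g y) * iexp (t * y)) \<partial>lborel)"
      by (simp add: algebra_simps)
    also have "\<dots> = (\<integral>y. (1/2) * (g y * iexp (t * y)) \<partial>lborel) + (\<integral>y. (1/2) * (cnj (g y) * iexp (t * y)) \<partial>lborel)"
      using g by (intro Bochner_Integration.integral_add integrable_mult_right integrable_mult_iexp) auto
    also have "\<dots> = 0" by (simp only: integral_mult_right_zero c z[of t]) simp
    finally show "(\<integral>y. complex_of_real (Re (g y)) * iexp (t * y) \<partial>lborel) = 0" .
  qed
  have 1: "AE y in lborel. Re (f y) = 0" by (rule Re0[OF assms])
  have 2: "AE y in lborel. Re (- \<i> * f y) = 0"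
  proof (rule Re0)
    show "integrable lborel (\<lambda>y. - \<i> * f y)" using f by (rule integrable_mult_right)
    have "(\<integral>y. - \<i> * f y * iexp (t * y) \<partial>lborel) = (\<integral>y. - \<i> * (f y * iexp (t * y)) \<partial>lborel)" for t
      by (simp add: mult_ac)
    then show "(\<integral>y. - \<i> * f y * iexp (t * y) \<partial>lborel) = 0" for t
      using zero[of t] by (simp only: integral_mult_right_zero) simp
  qed
  show ?thesis using 1 2 by eventually_elim (simp add: complex_eq_iff)
qed

text \<open>Gaussian windows mediate between the \<open>L2\<close> definition of the transform and
  absolutely convergent integrals: their translates have explicit transforms, and their product with
  a square integrable or a bounded measurable function is integrable.\<close>

definition gauss :: "real \<Rightarrow> real" where
  "gauss x = exp (- x\<^sup>2 / 2)"

lemma gauss_borel [measurable]: "gauss \<in> borel_measurable borel"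
  by (simp add: gauss_def[abs_def])

lemma gauss_pos: "gauss x > 0" by (simp add: gauss_def)

lemma gauss_eq: "gauss x = sqrt (2 * pi) * std_normal_density x"
  by (simp add: gauss_def std_normal_density_def)

lemma integrable_gauss: "integrable lborel (\<lambda>x. gauss (x - t))"
proof -
  have "integrable lborel gauss"
    unfolding gauss_eq[abs_def] by (intro integrable_mult_right integrable_normal_density) simp
  then show ?thesis
    using lborel_integrable_real_affine[of gauss 1 "-t"] by simp
qed

lemma integrable_gauss_sq: "integrable lborel (\<lambda>x. (gauss (x - t))\<^sup>2)"
  by (rule Bochner_Integration.integrable_bound[OF integrable_gauss[of t]])
     (auto simp: gauss_def power2_eq_square exp_add[symmetric])

lemma fourier_gauss:
  "(\<integral>x. complex_of_real (gauss (x - t)) * iexp (s * x) \<partial>lborel)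
     = sqrt (2 * pi) * gauss s * iexp (s * t)"
proof -
  have "char std_normal_distribution s = (\<integral>x. std_normal_density x *\<^sub>R iexp (s * x) \<partial>lborel)"
    unfolding char_def by (rule integral_density) (auto simp: normal_density_nonneg)
  then have *: "(\<integral>x. std_normal_density x *\<^sub>R iexp (s * x) \<partial>lborel) = gauss s"
    by (simp add: char_std_normal_distribution gauss_def)
  have "(\<integral>x. complex_of_real (gauss (x - t)) * iexp (s * x) \<partial>lborel)
      = (\<integral>x. complex_of_real (gauss ((t + 1 * x) - t)) * iexp (s * (t + 1 * x)) \<partial>lborel)"
    by (subst lborel_integral_real_affine[where c = 1 and t = t]) simp_all
  also have "\<dots> = (\<integral>x. (sqrt (2 * pi) * iexp (s * t)) * (std_normal_density x *\<^sub>R iexp (s * x)) \<partial>lborel)"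
    by (rule Bochner_Integration.integral_cong)
       (simp_all add: gauss_eq scaleR_conv_of_real algebra_simps exp_add)
  also have "\<dots> = sqrt (2 * pi) * gauss s * iexp (s * t)"
    unfolding integral_mult_right_zero * by (simp add: mult_ac)
  finally show ?thesis .
qed

lemma L2_mult_integrable:
  fixes f :: "real \<Rightarrow> complex" and g :: "real \<Rightarrow> complex"
  assumes [measurable]: "f \<in> borel_measurable borel" "g \<in> borel_measurable borel"
    and f: "integrable lborel (\<lambda>x. (cmod (f x))\<^sup>2)" and g: "integrable lborel (\<lambda>x. (cmod (g x))\<^sup>2)"
  shows "integrable lborel (\<lambda>x. f x * g x)"
proof (rule Bochner_Integration.integrable_bound[OF Bochner_Integration.integrable_add[OF f g]])
  have "a * b \<le> a\<^sup>2 + b\<^sup>2" if "a \<ge> 0" "b \<ge> 0" for a b :: real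
    using sum_squares_bound[of a b] that mult_nonneg_nonneg[OF that] by linarith
  then show "AE x in lborel. norm (f x * g x) \<le> norm ((cmod (f x))\<^sup>2 + (cmod (g x))\<^sup>2)"
    by (auto simp: norm_mult intro!: always_eventually)
qed simp

text \<open>Cauchy-Schwarz in \<open>ennreal\<close>, the type of \<open>L2_dist_sq\<close>. Only
  the product is required to be integrable, because the truncated transforms have not been shown to
  lie in \<open>L2\<close> when this is applied.\<close>

lemma norm_integral_sq_le:
  fixes f g :: "real \<Rightarrow> complex"
  assumes [measurable]: "f \<in> borel_measurable borel" "g \<in> borel_measurable borel"
    and int: "integrable lborel (\<lambda>x. f x * g x)"
  shows "ennreal ((norm (\<integral>x. f x * g x \<partial>lborel))\<^sup>2)
    \<le> (\<integral>\<^sup>+x. ennreal ((cmod (f x))\<^sup>2) \<partial>lborel) * (\<integral>\<^sup>+x. ennreal ((cmod (g x))\<^sup>2) \<partial>lborel)"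
proof -
  have "ennreal (norm (\<integral>x. f x * g x \<partial>lborel)) \<le> (\<integral>\<^sup>+x. norm (f x * g x) \<partial>lborel)"
    by (rule integral_norm_bound_ennreal[OF int])
  also have "\<dots> = (\<integral>\<^sup>+x. ennreal (cmod (f x)) * ennreal (cmod (g x)) \<partial>lborel)"
    by (simp add: norm_mult ennreal_mult)
  finally have "(ennreal (norm (\<integral>x. f x * g x \<partial>lborel)))\<^sup>2
      \<le> (\<integral>\<^sup>+x. ennreal (cmod (f x)) * ennreal (cmod (g x)) \<partial>lborel)\<^sup>2"
    by (rule power_mono) simp
  also have "\<dots> \<le> (\<integral>\<^sup>+x. (ennreal (cmod (f x)))\<^sup>2 \<partial>lborel) * (\<integral>\<^sup>+x. (ennreal (cmod (g x)))\<^sup>2 \<partial>lborel)"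
    by (rule Cauchy_Schwarz_nn_integral) measurable
  finally show ?thesis by (simp add: ennreal_power)
qed

lemma L2_integrable_on_bounded:
  assumes [measurable]: "f \<in> borel_measurable borel"
    and f: "integrable lborel (\<lambda>x. (cmod (f x))\<^sup>2)"
  shows "integrable lborel (\<lambda>x::real. indicator {a..b} x * f x)"
proof (rule L2_mult_integrable[OF _ _ _ f])
  have "integrable lborel (indicator {a..b} :: real \<Rightarrow> real)"
    by (rule integrable_real_indicator) (auto simp: emeasure_lborel_Icc_eq)
  then show "integrable lborel (\<lambda>x. (cmod (indicator {a..b} x))\<^sup>2)"
    by (rule Bochner_Integration.integrable_bound) (auto simp: indicator_def)
qed simp_all

lemma Fubini_product:
  fixes f g :: "real \<Rightarrow> complex" and k :: "real \<Rightarrow> real \<Rightarrow> complex"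
  assumes f: "integrable lborel f" and g: "integrable lborel g"
    and k[measurable]: "(\<lambda>(x, y). k x y) \<in> borel_measurable (borel \<Otimes>\<^sub>M borel)"
    and bound: "\<And>x y. norm (k x y) \<le> 1"
  shows "(\<integral>y. (\<integral>x. f x * g y * k x y \<partial>lborel) \<partial>lborel) = (\<integral>x. (\<integral>y. f x * g y * k x y \<partial>lborel) \<partial>lborel)"
proof (rule lborel_pair.Fubini_integral)
  have [measurable]: "f \<in> borel_measurable borel" "g \<in> borel_measurable borel"
    using borel_measurable_integrable[OF f] borel_measurable_integrable[OF g] by simp_all
  have "integrable (lborel \<Otimes>\<^sub>M lborel) (\<lambda>(x, y). f x * g y)"
  proof (rule lborel_pair.Fubini_integrable)
    have "(\<lambda>x. \<integral>y. norm (case (x, y) of (x, y) \<Rightarrow> f x * g y) \<partial>lborel) = (\<lambda>x. (\<integral>y. norm (g y) \<partial>lborel) * norm (f x))"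
      by (simp add: norm_mult mult_ac)
    then show "integrable lborel (\<lambda>x. \<integral>y. norm (case (x, y) of (x, y) \<Rightarrow> f x * g y) \<partial>lborel)"
      using f by simp
    show "AE x in lborel. integrable lborel (\<lambda>y. case (x, y) of (x, y) \<Rightarrow> f x * g y)"
      using g by simp
  qed simp
  then show "integrable (lborel \<Otimes>\<^sub>M lborel) (\<lambda>(x, y). f x * g y * k x y)"
    by (rule Bochner_Integration.integrable_bound)
       (auto simp: norm_mult split: prod.split intro!: always_eventually mult_left_le bound)
qed

text \<open>A Parseval identity against translated Gaussians. For the truncated transforms it is
  Fubini; the left side passes to the limit by \<open>L2\<close> convergence and Cauchy-Schwarz, the
  right side by dominated convergence with a multiple of \<open>\<phi> * gauss\<close> as
  majorant.\<close>

lemma L2_fourier_gauss: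
  assumes "L2_fourier_transform \<phi> \<phi>hat"
  shows "(\<integral>\<xi>. \<phi>hat \<xi> * complex_of_real (gauss (\<xi> - t)) \<partial>lborel)
      = sqrt (2 * pi) * (\<integral>x. \<phi> x * complex_of_real (gauss x) * iexp (- t * x) \<partial>lborel)"
proof -
  have [measurable]: "\<phi> \<in> borel_measurable borel" "\<phi>hat \<in> borel_measurable borel"
    and \<phi>2: "integrable lborel (\<lambda>x. (cmod (\<phi> x))\<^sup>2)" and \<phi>hat2: "integrable lborel (\<lambda>x. (cmod (\<phi>hat x))\<^sup>2)"
    using assms by (auto simp: L2_fourier_transform_def L2_def)
  let ?g = "\<lambda>\<xi>. complex_of_real (gauss (\<xi> - t))"
  define T where "T n \<xi> = (\<integral>x. indicator {- real n..real n} x * \<phi> x * iexp (- (x * \<xi>)) \<partial>lborel)" for n :: nat and \<xi>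
  have T_eq: "(\<integral>x\<in>{- real n..real n}. (\<phi> x * exp (- (\<i> * complex_of_real (x * \<xi>)))) \<partial>lborel) = T n \<xi>" for n \<xi>
    by (auto simp: T_def set_lebesgue_integral_def indicator_def intro!: Bochner_Integration.integral_cong)
  have lim: "(\<lambda>n. L2_dist_sq \<phi>hat (T n)) \<longlonglongrightarrow> 0"
    using assms unfolding L2_fourier_transform_def T_eq by blast
  have [measurable]: "T n \<in> borel_measurable borel" for n
    unfolding T_def[abs_def] by measurable
  have I: "integrable lborel (\<lambda>x. indicator {- real n..real n} x * \<phi> x)" for n :: nat
    by (rule L2_integrable_on_bounded[OF _ \<phi>2]) simp
  have g1: "integrable lborel ?g"
    using integrable_gauss[of t] by (rule integrable_of_real)
  have g2: "integrable lborel (\<lambda>\<xi>. (cmod (?g \<xi>))\<^sup>2)"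
    using integrable_gauss_sq[of t] by simp
  have Tg: "integrable lborel (\<lambda>\<xi>. T n \<xi> * ?g \<xi>)" for n
  proof (rule Bochner_Integration.integrable_bound)
    show "integrable lborel (\<lambda>\<xi>. (\<integral>x. norm (indicator {- real n..real n} x * \<phi> x) \<partial>lborel) * gauss (\<xi> - t))"
      by (intro integrable_mult_right integrable_gauss)
    have "norm (T n \<xi>) \<le> (\<integral>x. norm (indicator {- real n..real n} x * \<phi> x) \<partial>lborel)" for \<xi>
      unfolding T_def by (rule order.trans[OF integral_norm_bound]) (simp add: norm_mult)
    then have "norm (T n \<xi> * ?g \<xi>) \<le> (\<integral>x. norm (indicator {- real n..real n} x * \<phi> x) \<partial>lborel) * gauss (\<xi> - t)" for \<xi>
      using gauss_pos[of "\<xi> - t"] by (simp add: norm_mult mult_right_mono)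
    then show "AE \<xi> in lborel. norm (T n \<xi> * ?g \<xi>) \<le> norm ((\<integral>x. norm (indicator {- real n..real n} x * \<phi> x) \<partial>lborel) * gauss (\<xi> - t))"
      unfolding real_norm_def by (intro always_eventually allI order.trans[OF _ abs_ge_self])
  qed simp
  have hg: "integrable lborel (\<lambda>\<xi>. \<phi>hat \<xi> * ?g \<xi>)"
    by (rule L2_mult_integrable[OF _ _ \<phi>hat2 g2]) simp_all
  have A: "(\<lambda>n. \<integral>\<xi>. T n \<xi> * ?g \<xi> \<partial>lborel) \<longlonglongrightarrow> (\<integral>\<xi>. \<phi>hat \<xi> * ?g \<xi> \<partial>lborel)"
  proof -
    define d where "d n = norm ((\<integral>\<xi>. \<phi>hat \<xi> * ?g \<xi> \<partial>lborel) - (\<integral>\<xi>. T n \<xi> * ?g \<xi> \<partial>lborel))" for n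
    define K where "K = (\<integral>\<^sup>+\<xi>. ennreal ((cmod (?g \<xi>))\<^sup>2) \<partial>lborel)"
    have K: "K < \<top>" unfolding K_def
      using g2 by (subst nn_integral_eq_integral) auto
    have le: "ennreal ((d n)\<^sup>2) \<le> L2_dist_sq \<phi>hat (T n) * K" for n
    proof -
      have i: "integrable lborel (\<lambda>\<xi>. (\<phi>hat \<xi> - T n \<xi>) * ?g \<xi>)"
        using Bochner_Integration.integrable_diff[OF hg Tg[of n]] by (simp add: algebra_simps)
      have "d n = norm (\<integral>\<xi>. (\<phi>hat \<xi> - T n \<xi>) * ?g \<xi> \<partial>lborel)"
        unfolding d_def Bochner_Integration.integral_diff[OF hg Tg, symmetric] by (simp add: algebra_simps)
      then show ?thesis
        using norm_integral_sq_le[OF _ _ i] by (simp add: K_def L2_dist_sq_def)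
    qed
    have z: "(\<lambda>n. L2_dist_sq \<phi>hat (T n) * K) \<longlonglongrightarrow> 0"
      using ennreal_tendsto_cmult[OF K lim] by (simp add: mult.commute)
    have "(\<lambda>n. ennreal ((d n)\<^sup>2)) \<longlonglongrightarrow> 0"
      by (rule tendsto_sandwich[OF _ _ tendsto_const z]) (use le in auto)
    then have "(\<lambda>n. (d n)\<^sup>2) \<longlonglongrightarrow> 0" by (subst (asm) ennreal_tendsto_0_iff) auto
    then have "(\<lambda>n. sqrt ((d n)\<^sup>2)) \<longlonglongrightarrow> sqrt 0" by (rule tendsto_real_sqrt)
    then have "d \<longlonglongrightarrow> 0" by (simp add: d_def[abs_def])
    then show ?thesis unfolding d_def
      by (subst tendsto_dist_iff) (simp add: dist_norm norm_minus_commute)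
  qed
  have eq: "(\<integral>\<xi>. T n \<xi> * ?g \<xi> \<partial>lborel) = (\<integral>x. indicator {- real n..real n} x *
      (sqrt (2 * pi) * (\<phi> x * complex_of_real (gauss x) * iexp (- t * x))) \<partial>lborel)" for n
  proof -
    have "(\<integral>\<xi>. T n \<xi> * ?g \<xi> \<partial>lborel)
      = (\<integral>\<xi>. (\<integral>x. (indicator {- real n..real n} x * \<phi> x) * ?g \<xi> * iexp (- (x * \<xi>)) \<partial>lborel) \<partial>lborel)"
      unfolding T_def by (subst integral_mult_left_zero[symmetric]) (simp add: mult_ac)
    also have "\<dots> = (\<integral>x. (\<integral>\<xi>. (indicator {- real n..real n} x * \<phi> x) * ?g \<xi> * iexp (- (x * \<xi>)) \<partial>lborel) \<partial>lborel)"
      by (rule Fubini_product[OF I g1]) (simp_all only: split_beta' norm_exp_i_times order_refl, measurable)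
    also have "\<dots> = (\<integral>x. (indicator {- real n..real n} x * \<phi> x) *
        (\<integral>\<xi>. ?g \<xi> * iexp ((- x) * \<xi>) \<partial>lborel) \<partial>lborel)"
      by (subst integral_mult_right_zero[symmetric]) (simp add: mult_ac)
    also have "\<dots> = (\<integral>x. (indicator {- real n..real n} x * \<phi> x) *
        (sqrt (2 * pi) * gauss (- x) * iexp (- x * t)) \<partial>lborel)"
      by (simp only: fourier_gauss)
    finally show ?thesis by (simp add: gauss_def mult_ac)
  qed
  have B: "(\<lambda>n. \<integral>\<xi>. T n \<xi> * ?g \<xi> \<partial>lborel) \<longlonglongrightarrow>
      (\<integral>x. sqrt (2 * pi) * (\<phi> x * complex_of_real (gauss x) * iexp (- t * x)) \<partial>lborel)"
    unfolding eq
  proof (rule integral_dominated_convergence)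
    have "integrable lborel (\<lambda>x. \<phi> x * complex_of_real (gauss x))"
      using integrable_gauss_sq[of 0] by (intro L2_mult_integrable[OF _ _ \<phi>2]) simp_all
    then show "integrable lborel (\<lambda>x. norm (sqrt (2 * pi) * (\<phi> x * complex_of_real (gauss x))))"
      by (intro integrable_norm integrable_mult_right)
    show "AE x in lborel. (\<lambda>n. indicator {- real n..real n} x *
        (sqrt (2 * pi) * (\<phi> x * complex_of_real (gauss x) * iexp (- t * x)))) \<longlonglongrightarrow>
        sqrt (2 * pi) * (\<phi> x * complex_of_real (gauss x) * iexp (- t * x))"
    proof (rule AE_I2, rule tendsto_eventually)
      fix x :: real
      obtain N :: nat where "\<bar>x\<bar> \<le> real N" using real_arch_simple by blast
      then show "\<forall>\<^sub>F n in sequentially. indicator {- real n..real n} x *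
        (sqrt (2 * pi) * (\<phi> x * complex_of_real (gauss x) * iexp (- t * x))) =
        sqrt (2 * pi) * (\<phi> x * complex_of_real (gauss x) * iexp (- t * x))"
        unfolding eventually_sequentially by (intro exI[of _ N]) (auto simp: indicator_def)
    qed
    show "AE x in lborel. norm (indicator {- real n..real n} x *
        (sqrt (2 * pi) * (\<phi> x * complex_of_real (gauss x) * iexp (- t * x))))
        \<le> norm (sqrt (2 * pi) * (\<phi> x * complex_of_real (gauss x)))" for n
      by (intro always_eventually allI) (auto simp: norm_mult indicator_def)
  qed measurable
  show ?thesis using LIMSEQ_unique[OF A B] by (simp only: integral_mult_right_zero)
qed

text \<open>The same pairing as in \<open>L2_fourier_gauss\<close>, with the inversion integral in
  place of \<open>\<phi>\<close>; equal left sides will identify the two windowed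
  transforms.\<close>

lemma inv_fourier_gauss:
  assumes F: "integrable lborel F"
  shows "(\<integral>\<xi>. F \<xi> * complex_of_real (gauss (\<xi> - t)) \<partial>lborel)
      = sqrt (2 * pi) * (\<integral>x. inv_fourier F x * complex_of_real (gauss x) * iexp (- t * x) \<partial>lborel)"
proof -
  have g1: "integrable lborel (\<lambda>x. complex_of_real (gauss x) * iexp (- t * x))"
    using integrable_gauss[of 0] by (intro integrable_mult_iexp integrable_of_real) simp
  have "(\<integral>x. inv_fourier F x * complex_of_real (gauss x) * iexp (- t * x) \<partial>lborel)
      = (\<integral>x. (1 / (2 * pi)) * (\<integral>\<xi>. F \<xi> * (complex_of_real (gauss x) * iexp (- t * x)) * iexp (x * \<xi>) \<partial>lborel) \<partial>lborel)"
    unfolding inv_fourier_def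
    by (subst integral_mult_left_zero[symmetric] integral_mult_right_zero[symmetric])
       (simp add: integral_mult_left_zero[symmetric] integral_mult_right_zero[symmetric] mult_ac
          del: integral_mult_left_zero integral_mult_right_zero)
  also have "\<dots> = (1 / (2 * pi)) *
      (\<integral>x. (\<integral>\<xi>. F \<xi> * (complex_of_real (gauss x) * iexp (- t * x)) * iexp (x * \<xi>) \<partial>lborel) \<partial>lborel)"
    by (rule integral_mult_right_zero)
  also have "(\<integral>x. (\<integral>\<xi>. F \<xi> * (complex_of_real (gauss x) * iexp (- t * x)) * iexp (x * \<xi>) \<partial>lborel) \<partial>lborel)
      = (\<integral>\<xi>. (\<integral>x. F \<xi> * (complex_of_real (gauss x) * iexp (- t * x)) * iexp (x * \<xi>) \<partial>lborel) \<partial>lborel)"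
    by (rule Fubini_product[OF F g1]) (simp_all only: split_beta' norm_exp_i_times order_refl, measurable)
  also have "\<dots> = (\<integral>\<xi>. F \<xi> * (\<integral>x. complex_of_real (gauss (x - 0)) * iexp ((\<xi> - t) * x) \<partial>lborel) \<partial>lborel)"
    by (subst integral_mult_right_zero[symmetric])
       (simp add: algebra_simps exp_add[symmetric])
  also have "\<dots> = (\<integral>\<xi>. sqrt (2 * pi) * (F \<xi> * complex_of_real (gauss (\<xi> - t))) \<partial>lborel)"
    unfolding fourier_gauss by (simp add: mult_ac)
  also have "\<dots> = sqrt (2 * pi) * (\<integral>\<xi>. F \<xi> * complex_of_real (gauss (\<xi> - t)) \<partial>lborel)"
    by (rule integral_mult_right_zero)
  finally have "sqrt (2 * pi) * (\<integral>x. inv_fourier F x * complex_of_real (gauss x) * iexp (- t * x) \<partial>lborel)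
     = (complex_of_real (sqrt (2 * pi)) * complex_of_real (sqrt (2 * pi)) / (2 * pi)) * (\<integral>\<xi>. F \<xi> * complex_of_real (gauss (\<xi> - t)) \<partial>lborel)"
    by simp
  also have "complex_of_real (sqrt (2 * pi)) * complex_of_real (sqrt (2 * pi)) / (2 * pi) = 1"
    unfolding of_real_mult[symmetric] of_real_divide[symmetric] by simp
  finally show ?thesis by simp
qed

lemma inv_fourier_borel:
  assumes "integrable lborel F"
  shows "inv_fourier F \<in> borel_measurable borel"
proof -
  have [measurable]: "F \<in> borel_measurable borel" using borel_measurable_integrable[OF assms] by simp
  show ?thesis unfolding inv_fourier_def[abs_def] by measurable
qed

text \<open>After multiplication by \<open>gauss\<close>, both sides are integrable and have the
  same Fourier transform, hence agree almost everywhere; \<open>gauss\<close> is positive and can be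
  divided out.\<close>

lemma L2_fourier_inversion:
  assumes ft: "L2_fourier_transform \<phi> \<phi>hat" and F: "integrable lborel \<phi>hat"
  shows "AE x in lborel. \<phi> x = inv_fourier \<phi>hat x"
proof -
  have [measurable]: "\<phi> \<in> borel_measurable borel" "inv_fourier \<phi>hat \<in> borel_measurable borel"
    and \<phi>2: "integrable lborel (\<lambda>x. (cmod (\<phi> x))\<^sup>2)"
    using ft inv_fourier_borel[OF F] by (auto simp: L2_fourier_transform_def L2_def)
  have i1: "integrable lborel (\<lambda>x. \<phi> x * complex_of_real (gauss x))"
    using integrable_gauss_sq[of 0] by (intro L2_mult_integrable[OF _ _ \<phi>2]) simp_all
  have i2: "integrable lborel (\<lambda>x. inv_fourier \<phi>hat x * complex_of_real (gauss x))"
  proof (rule Bochner_Integration.integrable_bound)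
    show "integrable lborel (\<lambda>x. (\<integral>\<xi>. cmod (\<phi>hat \<xi>) \<partial>lborel) * gauss x)"
      using integrable_gauss[of 0] by simp
    show "AE x in lborel. norm (inv_fourier \<phi>hat x * complex_of_real (gauss x))
        \<le> norm ((\<integral>\<xi>. cmod (\<phi>hat \<xi>) \<partial>lborel) * gauss x)"
    proof (intro always_eventually allI)
      fix x
      have "cmod (inv_fourier \<phi>hat x) * gauss x \<le> (\<integral>\<xi>. cmod (\<phi>hat \<xi>) \<partial>lborel) * gauss x"
        by (intro mult_right_mono cmod_inv_fourier_le less_imp_le gauss_pos)
      then show "norm (inv_fourier \<phi>hat x * complex_of_real (gauss x))
        \<le> norm ((\<integral>\<xi>. cmod (\<phi>hat \<xi>) \<partial>lborel) * gauss x)"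
        using gauss_pos[of x] abs_ge_self[of "(\<integral>\<xi>. cmod (\<phi>hat \<xi>) \<partial>lborel) * gauss x"] by (simp add: norm_mult)
    qed
  qed simp
  have "AE x in lborel. \<phi> x * complex_of_real (gauss x) - inv_fourier \<phi>hat x * complex_of_real (gauss x) = 0"
  proof (rule fourier_unique)
    show "integrable lborel (\<lambda>x. \<phi> x * complex_of_real (gauss x) - inv_fourier \<phi>hat x * complex_of_real (gauss x))"
      using i1 i2 by (rule Bochner_Integration.integrable_diff)
    fix t
    have "(\<integral>x. (\<phi> x * complex_of_real (gauss x) - inv_fourier \<phi>hat x * complex_of_real (gauss x)) * iexp (t * x) \<partial>lborel)
      = (\<integral>x. \<phi> x * complex_of_real (gauss x) * iexp (t * x) \<partial>lborel)
      - (\<integral>x. inv_fourier \<phi>hat x * complex_of_real (gauss x) * iexp (t * x) \<partial>lborel)"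
      unfolding left_diff_distrib by (intro Bochner_Integration.integral_diff integrable_mult_iexp i1 i2)
    also have "\<dots> = 0"
      using L2_fourier_gauss[OF ft, of "-t"] inv_fourier_gauss[OF F, of "-t"] by simp
    finally show "(\<integral>x. (\<phi> x * complex_of_real (gauss x) - inv_fourier \<phi>hat x * complex_of_real (gauss x)) * iexp (t * x) \<partial>lborel) = 0" .
  qed
  then show ?thesis
  proof eventually_elim
    case (elim x)
    then have "(\<phi> x - inv_fourier \<phi>hat x) * complex_of_real (gauss x) = 0" by (simp add: algebra_simps)
    then show ?case using gauss_pos[of x] by simp
  qed
qed

section \<open>Multipliers localised in space\<close>

text \<open>This holds when \<open>B\<close> is the Fourier transform of a complex measure of mass at most \<open>m\<close> supported in
  \<open>[-r, r]\<close>; only the resulting local estimate is kept.\<close>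

definition multiplier :: "real \<Rightarrow> real \<Rightarrow> (real \<Rightarrow> complex) \<Rightarrow> bool" where
  "multiplier r m B \<longleftrightarrow> 0 \<le> m \<and> B \<in> borel_measurable borel \<and> (\<exists>K. \<forall>\<xi>. cmod (B \<xi>) \<le> K) \<and>
     (\<forall>G x S. integrable lborel G \<longrightarrow>
        (\<forall>y. \<bar>y - x\<bar> \<le> r \<longrightarrow> cmod (\<integral>\<xi>. G \<xi> * iexp (y * \<xi>) \<partial>lborel) \<le> S) \<longrightarrow>
        cmod (\<integral>\<xi>. B \<xi> * G \<xi> * iexp (x * \<xi>) \<partial>lborel) \<le> m * S)"

lemma multiplierD:
  assumes "multiplier r m B" "integrable lborel G"
    and "\<And>y. \<bar>y - x\<bar> \<le> r \<Longrightarrow> cmod (\<integral>\<xi>. G \<xi> * iexp (y * \<xi>) \<partial>lborel) \<le> S"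
  shows "cmod (\<integral>\<xi>. B \<xi> * G \<xi> * iexp (x * \<xi>) \<partial>lborel) \<le> m * S"
  using assms unfolding multiplier_def by blast

lemma multiplier_integrable:
  assumes "multiplier r m B" "integrable lborel G"
  shows "integrable lborel (\<lambda>\<xi>. B \<xi> * G \<xi>)"
proof -
  have [measurable]: "B \<in> borel_measurable borel" "G \<in> borel_measurable borel"
    using assms borel_measurable_integrable[OF assms(2)] by (auto simp: multiplier_def)
  obtain K where K: "\<And>\<xi>. cmod (B \<xi>) \<le> K" using assms by (auto simp: multiplier_def)
  show ?thesis
  proof (rule Bochner_Integration.integrable_bound)
    show "integrable lborel (\<lambda>\<xi>. K *\<^sub>R G \<xi>)" using assms(2) by simp
    show "AE \<xi> in lborel. norm (B \<xi> * G \<xi>) \<le> norm (K *\<^sub>R G \<xi>)"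
      using order.trans[OF K abs_ge_self]
      by (auto intro!: always_eventually mult_right_mono simp: norm_mult)
  qed simp
qed

lemma multiplier_one: "multiplier 0 1 (\<lambda>_. 1)"
  by (auto simp: multiplier_def)

lemma multiplier_mult:
  assumes 1: "multiplier r1 m1 B1" and 2: "multiplier r2 m2 B2"
  shows "multiplier (r1 + r2) (m1 * m2) (\<lambda>\<xi>. B1 \<xi> * B2 \<xi>)"
  unfolding multiplier_def
proof (intro conjI allI impI)
  show "0 \<le> m1 * m2" "(\<lambda>\<xi>. B1 \<xi> * B2 \<xi>) \<in> borel_measurable borel"
    using assms by (auto simp: multiplier_def)
  obtain K1 K2 where "\<And>\<xi>. cmod (B1 \<xi>) \<le> K1" "\<And>\<xi>. cmod (B2 \<xi>) \<le> K2"
    using assms by (auto simp: multiplier_def)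
  then show "\<exists>K. \<forall>\<xi>. cmod (B1 \<xi> * B2 \<xi>) \<le> K"
    by (intro exI[of _ "K1 * K2"]) (auto simp: norm_mult intro!: mult_mono order.trans[OF norm_ge_zero])
next
  fix G x S
  assume G: "integrable lborel G"
    and S: "\<forall>y. \<bar>y - x\<bar> \<le> r1 + r2 \<longrightarrow> cmod (\<integral>\<xi>. G \<xi> * iexp (y * \<xi>) \<partial>lborel) \<le> S"
  have "cmod (\<integral>\<xi>. B1 \<xi> * (B2 \<xi> * G \<xi>) * iexp (x * \<xi>) \<partial>lborel) \<le> m1 * (m2 * S)"
  proof (rule multiplierD[OF 1 multiplier_integrable[OF 2 G]])
    fix y assume y: "\<bar>y - x\<bar> \<le> r1"
    show "cmod (\<integral>\<xi>. B2 \<xi> * G \<xi> * iexp (y * \<xi>) \<partial>lborel) \<le> m2 * S"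
    proof (rule multiplierD[OF 2 G])
      fix z assume "\<bar>z - y\<bar> \<le> r2"
      then show "cmod (\<integral>\<xi>. G \<xi> * iexp (z * \<xi>) \<partial>lborel) \<le> S"
        using y by (intro S[rule_format]) linarith
    qed
  qed
  then show "cmod (\<integral>\<xi>. B1 \<xi> * B2 \<xi> * G \<xi> * iexp (x * \<xi>) \<partial>lborel) \<le> m1 * m2 * S"
    by (simp add: mult_ac)
qed

lemma multiplier_power:
  assumes "multiplier r m B"
  shows "multiplier (real k * r) (m ^ k) (\<lambda>\<xi>. B \<xi> ^ k)"
proof (induction k)
  case (Suc k)
  show ?case using multiplier_mult[OF assms Suc] by (simp add: algebra_simps)
qed (use multiplier_one in simp)

lemma multiplier_scale:
  assumes "multiplier r m B"
  shows "multiplier r (cmod c * m) (\<lambda>\<xi>. c * B \<xi>)"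
  unfolding multiplier_def
proof (intro conjI allI impI)
  show "0 \<le> cmod c * m" "(\<lambda>\<xi>. c * B \<xi>) \<in> borel_measurable borel"
    using assms by (auto simp: multiplier_def)
  obtain K where "\<And>\<xi>. cmod (B \<xi>) \<le> K" using assms by (auto simp: multiplier_def)
  then show "\<exists>K. \<forall>\<xi>. cmod (c * B \<xi>) \<le> K"
    by (intro exI[of _ "cmod c * K"]) (auto simp: norm_mult intro!: mult_left_mono)
next
  fix G x S
  assume G: "integrable lborel G"
    and S: "\<forall>y. \<bar>y - x\<bar> \<le> r \<longrightarrow> cmod (\<integral>\<xi>. G \<xi> * iexp (y * \<xi>) \<partial>lborel) \<le> S"
  have "(\<integral>\<xi>. c * B \<xi> * G \<xi> * iexp (x * \<xi>) \<partial>lborel) = c * (\<integral>\<xi>. B \<xi> * G \<xi> * iexp (x * \<xi>) \<partial>lborel)"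
    by (subst integral_mult_right_zero[symmetric]) (simp add: mult_ac)
  moreover have "cmod (\<integral>\<xi>. B \<xi> * G \<xi> * iexp (x * \<xi>) \<partial>lborel) \<le> m * S"
    using multiplierD[OF assms G] S by blast
  ultimately show "cmod (\<integral>\<xi>. c * B \<xi> * G \<xi> * iexp (x * \<xi>) \<partial>lborel) \<le> cmod c * m * S"
    by (simp add: norm_mult mult_left_mono mult.assoc)
qed

lemma multiplier_add:
  assumes 1: "multiplier r m1 B1" and 2: "multiplier r m2 B2"
  shows "multiplier r (m1 + m2) (\<lambda>\<xi>. B1 \<xi> + B2 \<xi>)"
  unfolding multiplier_def
proof (intro conjI allI impI)
  show "0 \<le> m1 + m2" "(\<lambda>\<xi>. B1 \<xi> + B2 \<xi>) \<in> borel_measurable borel"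
    using assms by (auto simp: multiplier_def)
  obtain K1 K2 where "\<And>\<xi>. cmod (B1 \<xi>) \<le> K1" "\<And>\<xi>. cmod (B2 \<xi>) \<le> K2"
    using assms by (auto simp: multiplier_def)
  then show "\<exists>K. \<forall>\<xi>. cmod (B1 \<xi> + B2 \<xi>) \<le> K"
    by (intro exI[of _ "K1 + K2"]) (auto intro!: order.trans[OF norm_triangle_ineq] add_mono)
next
  fix G x S
  assume G: "integrable lborel G"
    and S: "\<forall>y. \<bar>y - x\<bar> \<le> r \<longrightarrow> cmod (\<integral>\<xi>. G \<xi> * iexp (y * \<xi>) \<partial>lborel) \<le> S"
  have "(\<integral>\<xi>. (B1 \<xi> + B2 \<xi>) * G \<xi> * iexp (x * \<xi>) \<partial>lborel) =
      (\<integral>\<xi>. B1 \<xi> * G \<xi> * iexp (x * \<xi>) \<partial>lborel) + (\<integral>\<xi>. B2 \<xi> * G \<xi> * iexp (x * \<xi>) \<partial>lborel)"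
    unfolding distrib_right
    by (intro Bochner_Integration.integral_add integrable_mult_iexp multiplier_integrable[OF 1 G]
        multiplier_integrable[OF 2 G])
  moreover have "cmod (\<integral>\<xi>. B1 \<xi> * G \<xi> * iexp (x * \<xi>) \<partial>lborel) \<le> m1 * S"
    "cmod (\<integral>\<xi>. B2 \<xi> * G \<xi> * iexp (x * \<xi>) \<partial>lborel) \<le> m2 * S"
    using multiplierD[OF 1 G] multiplierD[OF 2 G] S by blast+
  ultimately show "cmod (\<integral>\<xi>. (B1 \<xi> + B2 \<xi>) * G \<xi> * iexp (x * \<xi>) \<partial>lborel) \<le> (m1 + m2) * S"
    by (smt (verit) norm_triangle_ineq distrib_right)
qed

text \<open>A point mass: multiplication by this exponential moves the point of evaluation from
  \<open>x\<close> to \<open>x + b\<close>, up to a unimodular constant.\<close>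

lemma multiplier_iexp: "multiplier \<bar>b\<bar> 1 (\<lambda>\<xi>. iexp (b * (\<xi> - c)))"
  unfolding multiplier_def
proof (intro conjI allI impI)
  show "\<exists>K. \<forall>\<xi>. cmod (iexp (b * (\<xi> - c))) \<le> K"
    by (intro exI[of _ 1] allI) (simp only: norm_exp_i_times order_refl)
next
  fix G x S
  assume S: "\<forall>y. \<bar>y - x\<bar> \<le> \<bar>b\<bar> \<longrightarrow> cmod (\<integral>\<xi>. G \<xi> * iexp (y * \<xi>) \<partial>lborel) \<le> S"
  have "(\<integral>\<xi>. iexp (b * (\<xi> - c)) * G \<xi> * iexp (x * \<xi>) \<partial>lborel)
      = iexp (- (b * c)) * (\<integral>\<xi>. G \<xi> * iexp ((x + b) * \<xi>) \<partial>lborel)"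
    by (subst integral_mult_right_zero[symmetric]) (simp add: algebra_simps exp_add exp_diff exp_minus divide_inverse)
  then have "cmod (\<integral>\<xi>. iexp (b * (\<xi> - c)) * G \<xi> * iexp (x * \<xi>) \<partial>lborel)
      = cmod (\<integral>\<xi>. G \<xi> * iexp ((x + b) * \<xi>) \<partial>lborel)"
    by (simp only: norm_mult norm_exp_i_times mult_1)
  also have "\<dots> \<le> S" by (intro S[rule_format]) simp
  finally show "cmod (\<integral>\<xi>. iexp (b * (\<xi> - c)) * G \<xi> * iexp (x * \<xi>) \<partial>lborel) \<le> 1 * S" by simp
qed auto

lemma multiplier_cos: "multiplier \<bar>b\<bar> 1 (\<lambda>\<xi>. complex_of_real (cos (b * (\<xi> - c))))"
proof -
  have "multiplier \<bar>b\<bar> (cmod (1/2) * 1 + cmod (1/2) * 1)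
      (\<lambda>\<xi>. (1/2) * iexp (b * (\<xi> - c)) + (1/2) * iexp ((-b) * (\<xi> - c)))"
    using multiplier_iexp[of "-b" c]
    by (intro multiplier_add multiplier_scale multiplier_iexp) simp
  moreover have "(1/2) * iexp (b * (\<xi> - c)) + (1/2) * iexp ((-b) * (\<xi> - c)) = complex_of_real (cos (b * (\<xi> - c)))" for \<xi>
    unfolding cis_conv_exp[symmetric] by (simp add: complex_eq_iff)
  ultimately show ?thesis by simp
qed

lemma multiplier_sin: "multiplier \<bar>b\<bar> 1 (\<lambda>\<xi>. complex_of_real (sin (b * (\<xi> - c))))"
proof -
  have "multiplier \<bar>b\<bar> (cmod (-\<i>/2) * 1 + cmod (\<i>/2) * 1)
      (\<lambda>\<xi>. (-\<i>/2) * iexp (b * (\<xi> - c)) + (\<i>/2) * iexp ((-b) * (\<xi> - c)))"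
    using multiplier_iexp[of "-b" c]
    by (intro multiplier_add multiplier_scale multiplier_iexp) simp
  moreover have "(-\<i>/2) * iexp (b * (\<xi> - c)) + (\<i>/2) * iexp ((-b) * (\<xi> - c)) = complex_of_real (sin (b * (\<xi> - c)))" for \<xi>
    unfolding cis_conv_exp[symmetric] by (simp add: complex_eq_iff)
  ultimately show ?thesis by (simp add: norm_divide)
qed

lemma sinc_eq_integral:
  "complex_of_real (sinc u) = (\<integral>s. indicator {0..1} s * complex_of_real (cos (s * u)) \<partial>lborel)"
proof -
  have "(\<integral>s. cos (s * u) * indicator {0..1} s \<partial>lborel) = sinc u"
  proof (cases "u = 0")
    case False
    have "(\<integral>s. cos (s * u) * indicator {0..1} s \<partial>lborel) = sin (1 * u) / u - sin (0 * u) / u"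
      by (rule integral_FTC_Icc_real)
         (use False in \<open>auto intro!: derivative_eq_intros continuous_intros simp flip: has_real_derivative_iff_has_vector_derivative\<close>)
    then show ?thesis using False by simp
  qed simp
  then have "complex_of_real (sinc u) = complex_of_real (\<integral>s. cos (s * u) * indicator {0..1} s \<partial>lborel)" by simp
  also have "\<dots> = (\<integral>s. complex_of_real (cos (s * u) * indicator {0..1} s) \<partial>lborel)"
    by (rule integral_complex_of_real[symmetric])
  also have "\<dots> = (\<integral>s. indicator {0..1} s * complex_of_real (cos (s * u)) \<partial>lborel)"
    by (intro Bochner_Integration.integral_cong) (auto simp: indicator_def)
  finally show ?thesis .
qed

lemma abs_sinc_le_1: "\<bar>sinc u\<bar> \<le> 1"
  using abs_sin_x_le_abs_x[of u] by (auto simp: divide_le_eq)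

text \<open>By \<open>sinc_eq_integral\<close> this is the average over
  \<open>s \<in> {0..1}\<close> of the multipliers \<open>cos (s * a * (\<xi> - c))\<close>, each of
  mass 1 and radius at most \<open>a\<close>; Fubini carries their common bound over to the
  average.\<close>

lemma multiplier_sinc:
  assumes a: "a \<ge> 0"
  shows "multiplier a 1 (\<lambda>\<xi>. complex_of_real (sinc (a * (\<xi> - c))))"
  unfolding multiplier_def
proof (intro conjI allI impI)
  show "\<exists>K. \<forall>\<xi>. cmod (complex_of_real (sinc (a * (\<xi> - c)))) \<le> K"
    unfolding norm_of_real using abs_sinc_le_1 by (intro exI[of _ 1]) blast
  show "(\<lambda>\<xi>. complex_of_real (sinc (a * (\<xi> - c)))) \<in> borel_measurable borel"
    by measurable
next
  fix G x S
  assume G: "integrable lborel G"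
    and S: "\<forall>y. \<bar>y - x\<bar> \<le> a \<longrightarrow> cmod (\<integral>\<xi>. G \<xi> * iexp (y * \<xi>) \<partial>lborel) \<le> S"
  have I: "integrable lborel (indicator {0..1} :: real \<Rightarrow> real)"
    by (rule integrable_real_indicator) (auto simp: emeasure_lborel_Icc_eq)
  have S0: "S \<ge> 0" using S[rule_format, of x] a by (auto intro: order.trans[OF norm_ge_zero])
  have Ic: "integrable lborel (\<lambda>s::real. indicator {0..1} s :: complex)"
  proof -
    have "(\<lambda>s::real. indicator {0..1} s :: complex) = (\<lambda>s. complex_of_real (indicator {0..1} s))"
      by (auto simp: indicator_def)
    then show ?thesis using integrable_of_real[OF I, where 'a=complex] by simp
  qed
  define h where "h s = (\<integral>\<xi>. complex_of_real (cos (s * a * (\<xi> - c))) * G \<xi> * iexp (x * \<xi>) \<partial>lborel)" for s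
  have "(\<integral>\<xi>. complex_of_real (sinc (a * (\<xi> - c))) * G \<xi> * iexp (x * \<xi>) \<partial>lborel)
    = (\<integral>\<xi>. (\<integral>s. indicator {0..1} s * (G \<xi> * iexp (x * \<xi>)) * complex_of_real (cos (s * (a * (\<xi> - c)))) \<partial>lborel) \<partial>lborel)"
  proof (rule Bochner_Integration.integral_cong)
    fix \<xi>
    have "complex_of_real (sinc (a * (\<xi> - c))) * (G \<xi> * iexp (x * \<xi>))
      = (\<integral>s. indicator {0..1} s * complex_of_real (cos (s * (a * (\<xi> - c)))) * (G \<xi> * iexp (x * \<xi>)) \<partial>lborel)"
      unfolding sinc_eq_integral by (rule integral_mult_left_zero[symmetric])
    also have "\<dots> = (\<integral>s. indicator {0..1} s * (G \<xi> * iexp (x * \<xi>)) * complex_of_real (cos (s * (a * (\<xi> - c)))) \<partial>lborel)"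
      by (simp only: mult_ac)
    finally show "complex_of_real (sinc (a * (\<xi> - c))) * G \<xi> * iexp (x * \<xi>)
      = (\<integral>s. indicator {0..1} s * (G \<xi> * iexp (x * \<xi>)) * complex_of_real (cos (s * (a * (\<xi> - c)))) \<partial>lborel)"
      by (simp only: mult.assoc)
  qed simp
  also have "\<dots> = (\<integral>s. (\<integral>\<xi>. indicator {0..1} s * (G \<xi> * iexp (x * \<xi>)) * complex_of_real (cos (s * (a * (\<xi> - c)))) \<partial>lborel) \<partial>lborel)"
    by (rule Fubini_product[OF Ic integrable_mult_iexp[OF G]]) (simp_all add: split_beta')
  also have "\<dots> = (\<integral>s. indicator {0..1} s * h s \<partial>lborel)"
    unfolding h_def by (subst integral_mult_right_zero[symmetric]) (simp add: mult_ac)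
  finally have eq: "(\<integral>\<xi>. complex_of_real (sinc (a * (\<xi> - c))) * G \<xi> * iexp (x * \<xi>) \<partial>lborel)
    = (\<integral>s. indicator {0..1} s * h s \<partial>lborel)" .
  have h: "cmod (h s) \<le> S" if "s \<in> {0..1}" for s
  proof -
    have "cmod (h s) \<le> 1 * S"
      unfolding h_def
    proof (rule multiplierD[OF multiplier_cos G])
      fix y assume "\<bar>y - x\<bar> \<le> \<bar>s * a\<bar>"
      moreover have "s * a \<le> a" using that a by (auto intro: mult_left_le_one_le)
      ultimately show "cmod (\<integral>\<xi>. G \<xi> * iexp (y * \<xi>) \<partial>lborel) \<le> S"
        using that a by (intro S[rule_format]) (auto simp: abs_mult)
    qed
    then show ?thesis by simp
  qed
  have "cmod (\<integral>s. indicator {0..1} s * h s \<partial>lborel) \<le> (\<integral>s. cmod (indicator {0..1} s * h s) \<partial>lborel)"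
    by (rule integral_norm_bound)
  also have "\<dots> \<le> (\<integral>s. indicator {0..1::real} s * S \<partial>lborel)"
  proof (rule Bochner_Integration.integral_mono')
    show "integrable lborel (\<lambda>s. indicator {0..1::real} s * S)" using I by simp
  qed (use h S0 in \<open>auto simp: indicator_def\<close>)
  also have "\<dots> = 1 * S" by simp
  finally show "cmod (\<integral>\<xi>. complex_of_real (sinc (a * (\<xi> - c))) * G \<xi> * iexp (x * \<xi>) \<partial>lborel) \<le> 1 * S"
    unfolding eq .
qed simp

section \<open>Band-limited kernels peaked on a short interval\<close>

lemma cos_ge_quadratic: "cos u \<ge> 1 - u\<^sup>2 / 2" for u :: real
proof -
  have "(sin (u / 2))\<^sup>2 \<le> (u / 2)\<^sup>2"
    using abs_sin_x_le_abs_x[of "u / 2"] by (simp only: abs_le_square_iff)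
  then show ?thesis using cos_double_sin[of "u / 2"] by (simp add: power2_eq_square)
qed

lemma sinc_ge_quadratic: "sinc u \<ge> 1 - u\<^sup>2 / 2"
proof (cases "u = 0")
  case False
  have *: "sin v \<ge> v * (1 - v\<^sup>2 / 2)" if v: "v > 0" for v :: real
  proof -
    have "\<exists>z. 0 < z \<and> z < v \<and> sin v - sin 0 = (v - 0) * cos z"
      using v by (intro MVT2) (auto intro!: derivative_eq_intros)
    then obtain z where z: "0 < z" "z < v" "sin v = v * cos z" by auto
    have "z\<^sup>2 \<le> v\<^sup>2" using z by (simp add: power_mono)
    then have "1 - v\<^sup>2 / 2 \<le> cos z" using cos_ge_quadratic[of z] by linarith
    then show ?thesis using z v by (simp add: mult_left_mono)
  qed
  have "sinc \<bar>u\<bar> \<ge> 1 - \<bar>u\<bar>\<^sup>2 / 2"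
    using *[of "\<bar>u\<bar>"] False by (simp add: field_simps)
  then show ?thesis using False by (cases "u < 0") auto
qed simp

text \<open>On \<open>[-3, 3]\<close> the first factor concentrates at the origin at rate \<open>N\<close>. The powers of \<open>sinc\<close> tame
  it outside while keeping the exponential type at 1: with \<open>n = 2 N + p\<close>, the factor
  \<open>(1 - \<eta>\<^sup>2 / 9) sinc(\<eta> / n)\<^sup>2 = sinc(\<eta> / n)\<^sup>2 - (n\<^sup>2 / 9) sin(\<eta> / n)\<^sup>2\<close> is a multiplier, and \<open>p\<close> further
  factors \<open>sinc\<close> beat the weight \<open>\<xi> ^ p\<close> far away.\<close>

definition peak :: "nat \<Rightarrow> nat \<Rightarrow> real \<Rightarrow> real" where
  "peak N p \<eta> = (1 - \<eta>\<^sup>2 / 9) ^ N * sinc (\<eta> / real (2 * N + p)) ^ (2 * N + p)"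

lemma peak_multiplier:
  assumes "N > 0"
  shows "multiplier 1 ((1 + (real (2 * N + p))\<^sup>2 / 9) ^ N) (\<lambda>\<xi>. complex_of_real (peak N p (\<xi> - c)))"
proof -
  define n where "n = 2 * N + p"
  define a where "a = 1 / real n"
  have n: "n > 0" using assms by (simp add: n_def)
  have a: "a > 0" using n by (simp add: a_def)
  have s: "multiplier a 1 (\<lambda>\<xi>. complex_of_real (sinc (a * (\<xi> - c))))"
    using a by (intro multiplier_sinc) simp
  have t: "multiplier a 1 (\<lambda>\<xi>. complex_of_real (sin (a * (\<xi> - c))))"
    using multiplier_sin[of a c] a by simp
  have "multiplier (real 2 * a) (1 ^ 2 + cmod (complex_of_real (- ((real n)\<^sup>2 / 9))) * 1 ^ 2)
      (\<lambda>\<xi>. complex_of_real (sinc (a * (\<xi> - c))) ^ 2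
        + complex_of_real (- ((real n)\<^sup>2 / 9)) * complex_of_real (sin (a * (\<xi> - c))) ^ 2)" (is "multiplier _ _ ?E")
    by (intro multiplier_add multiplier_scale multiplier_power s t)
  moreover have "cmod (complex_of_real (- ((real n)\<^sup>2 / 9))) = (real n)\<^sup>2 / 9"
    unfolding norm_of_real by simp
  ultimately have E: "multiplier (real 2 * a) (1 + (real n)\<^sup>2 / 9) ?E" by simp
  have "multiplier (real N * (real 2 * a) + real p * a) ((1 + (real n)\<^sup>2 / 9) ^ N * 1 ^ p)
      (\<lambda>\<xi>. ?E \<xi> ^ N * complex_of_real (sinc (a * (\<xi> - c))) ^ p)"
    by (intro multiplier_mult multiplier_power E s)
  moreover have "real N * (real 2 * a) + real p * a = 1"
  proof -
    have "real N * (real 2 * a) + real p * a = real n * a" by (simp add: n_def algebra_simps)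
    then show ?thesis using n by (simp add: a_def)
  qed
  moreover have "?E \<xi> ^ N * complex_of_real (sinc (a * (\<xi> - c))) ^ p = complex_of_real (peak N p (\<xi> - c))" for \<xi>
  proof -
    define \<eta> where "\<eta> = \<xi> - c"
    have "sinc (a * \<eta>) ^ 2 + (- ((real n)\<^sup>2 / 9)) * sin (a * \<eta>) ^ 2 = (1 - \<eta>\<^sup>2 / 9) * sinc (a * \<eta>) ^ 2"
      using n by (auto simp: a_def field_simps power2_eq_square)
    then have e: "?E \<xi> = complex_of_real ((1 - \<eta>\<^sup>2 / 9) * sinc (a * \<eta>) ^ 2)"
      unfolding \<eta>_def[symmetric] of_real_power[symmetric] of_real_mult[symmetric] of_real_add[symmetric] by simp
    show ?thesis
      unfolding e unfolding \<eta>_def[symmetric] peak_def n_def[symmetric]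
      by (simp add: a_def n_def power_mult_distrib power_mult power_add flip: of_real_power of_real_mult)
  qed
  ultimately show ?thesis by (simp add: n_def)
qed

text \<open>Bernoulli's inequality twice: \<open>N * \<eta>\<^sup>2 \<le> 1\<close> for the
  polynomial factor and \<open>n * (\<eta> / n)\<^sup>2 \<le> 1 / 2\<close> for the power of
  \<open>sinc\<close>, where \<open>n = 2 * N + p\<close>, make each factor at least 1/2.\<close>

lemma peak_near:
  assumes N: "N > 0" and \<eta>: "\<bar>\<eta>\<bar> \<le> 1 / real N"
  shows "peak N p \<eta> \<ge> 1 / 4"
proof -
  define n where "n = 2 * N + p"
  have n: "n \<ge> 2" using N by (simp add: n_def)
  have N1: "1 / real N \<le> 1" using N by simp
  have e2: "\<eta>\<^sup>2 \<le> (1 / real N)\<^sup>2" using \<eta> by (metis abs_ge_zero power2_abs power_mono)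
  have e2': "real N * \<eta>\<^sup>2 \<le> 1"
  proof -
    have "real N * \<eta>\<^sup>2 \<le> real N * (1 / real N)\<^sup>2" using e2 by (intro mult_left_mono) auto
    also have "\<dots> = 1 / real N" using N by (simp add: power2_eq_square)
    finally show ?thesis using N1 by linarith
  qed
  have e1: "\<eta>\<^sup>2 \<le> 1"
  proof -
    have "\<bar>\<eta>\<bar> \<le> 1" using \<eta> N1 by linarith
    then show ?thesis by (simp only: abs_square_le_1)
  qed
  have A: "(1 - \<eta>\<^sup>2 / 9) ^ N \<ge> 1 / 2"
  proof -
    have "1 - real N * (\<eta>\<^sup>2 / 9) \<le> (1 - \<eta>\<^sup>2 / 9) ^ N"
      using Bernoulli_inequality[of "- (\<eta>\<^sup>2 / 9)" N] e1 by simp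
    then show ?thesis using e2' by simp
  qed
  define u where "u = \<eta> / real n"
  have u2: "u\<^sup>2 = \<eta>\<^sup>2 / (real n * real n)" by (simp add: u_def power_divide power2_eq_square)
  have "u\<^sup>2 \<le> 1 / (real n * real n)" unfolding u2 using e1 n by (intro divide_right_mono) auto
  also have "\<dots> \<le> 1 / (2 * real n)" using n by (intro divide_left_mono) auto
  finally have nu: "real n * u\<^sup>2 \<le> 1 / 2" using n by (simp add: field_simps)
  have u1: "u\<^sup>2 \<le> 1"
  proof -
    have "1 * u\<^sup>2 \<le> real n * u\<^sup>2" using n by (intro mult_right_mono) auto
    then show ?thesis using nu by linarith
  qed
  have "1 - real n * (u\<^sup>2 / 2) \<le> (1 - u\<^sup>2 / 2) ^ n"
    using Bernoulli_inequality[of "- (u\<^sup>2 / 2)" n] u1 by simp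
  also have "\<dots> \<le> sinc u ^ n"
    using sinc_ge_quadratic[of u] u1 by (intro power_mono) auto
  finally have B: "sinc u ^ n \<ge> 1 / 2" using nu by simp
  have "1 / 4 = (1 / 2) * (1 / 2 :: real)" by simp
  also have "\<dots> \<le> (1 - \<eta>\<^sup>2 / 9) ^ N * sinc u ^ n"
    using A B by (intro mult_mono) auto
  finally show ?thesis unfolding peak_def u_def n_def .
qed

text \<open>The power of \<open>sinc\<close> may be odd, so the sign is an issue. It matters on the
  part of the good interval outside the peak, where the integrand must not have the wrong
  sign.\<close>

lemma peak_nonneg:
  assumes N: "N > 0" and \<eta>: "\<bar>\<eta>\<bar> \<le> 1"
  shows "peak N p \<eta> \<ge> 0"
proof -
  define n where "n = 2 * N + p"
  have n: "n \<ge> 1" using N by (simp add: n_def)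
  have e1: "\<eta>\<^sup>2 \<le> 1" using \<eta> by (simp add: abs_square_le_1)
  have "\<bar>\<eta> / real n\<bar> \<le> 1" using \<eta> n by (simp add: divide_le_eq)
  then have "(\<eta> / real n)\<^sup>2 \<le> 1" by (simp add: abs_square_le_1)
  then have "sinc (\<eta> / real n) \<ge> 0" using sinc_ge_quadratic[of "\<eta> / real n"] by linarith
  then show ?thesis using e1 unfolding peak_def n_def by (intro mult_nonneg_nonneg zero_le_power) auto
qed

text \<open>On this range the polynomial base stays between 0 and \<open>1 - d\<^sup>2 / 9\<close>,
  and \<open>sinc\<close> is at most 1 in modulus. For \<open>d > 0\<close> this is exponential
  smallness in \<open>N\<close>, used on the rest of the cluster.\<close>

lemma peak_mid:
  assumes "d \<le> \<bar>\<eta>\<bar>" "\<bar>\<eta>\<bar> \<le> 3" "0 \<le> d"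
  shows "\<bar>peak N p \<eta>\<bar> \<le> (1 - d\<^sup>2 / 9) ^ N"
proof -
  have "d\<^sup>2 \<le> \<eta>\<^sup>2" "\<eta>\<^sup>2 \<le> 3\<^sup>2" using assms by (metis power2_abs power_mono abs_ge_zero)+
  then have "\<bar>1 - \<eta>\<^sup>2 / 9\<bar> \<le> 1 - d\<^sup>2 / 9" by (simp add: abs_le_iff)
  then have "\<bar>1 - \<eta>\<^sup>2 / 9\<bar> ^ N * \<bar>sinc (\<eta> / real (2 * N + p))\<bar> ^ (2 * N + p) \<le> (1 - d\<^sup>2 / 9) ^ N * 1"
    using abs_sinc_le_1[of "\<eta> / real (2 * N + p)"]
    by (intro mult_mono power_mono power_le_one) auto
  then show ?thesis by (simp only: peak_def abs_mult power_abs mult_1_right)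
qed

text \<open>Of the \<open>2 * N + p\<close> factors \<open>sinc\<close>, the first
  \<open>2 * N\<close> cancel the growth of the polynomial, and the others meet the weight through
  \<open>\<bar>\<xi>\<bar> \<le> 3 * \<bar>\<eta>\<bar>\<close>. What is left does not involve the
  cluster centre \<open>a\<close>, so a division by \<open>a ^ p\<close> will make it
  negligible.\<close>

lemma peak_far:
  assumes N: "N > 0" and "\<bar>\<eta>\<bar> \<ge> 3" "\<bar>\<xi>\<bar> \<le> 3 * \<bar>\<eta>\<bar>"
  shows "\<bar>\<xi>\<bar> ^ p * \<bar>peak N p \<eta>\<bar> \<le> real (2 * N + p) ^ (2 * N + p) * 3 ^ p"
proof -
  define n where "n = 2 * N + p"
  have n: "n \<ge> 1" using N by (simp add: n_def)
  have "3\<^sup>2 \<le> \<eta>\<^sup>2" using assms by (metis abs_ge_zero power2_abs power_mono zero_le_numeral)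
  then have 1: "\<bar>1 - \<eta>\<^sup>2 / 9\<bar> \<le> \<eta>\<^sup>2" by (simp add: abs_le_iff)
  have ne: "\<eta> \<noteq> 0" using assms by auto
  have 2: "\<bar>sinc (\<eta> / real n)\<bar> \<le> real n / \<bar>\<eta>\<bar>"
  proof -
    have "\<bar>sinc (\<eta> / real n)\<bar> = \<bar>sin (\<eta> / real n)\<bar> * (real n / \<bar>\<eta>\<bar>)" using ne n by (simp add: abs_mult)
    also have "\<dots> \<le> 1 * (real n / \<bar>\<eta>\<bar>)" by (intro mult_right_mono) auto
    finally show ?thesis by simp
  qed
  have "\<bar>peak N p \<eta>\<bar> = \<bar>1 - \<eta>\<^sup>2 / 9\<bar> ^ N * \<bar>sinc (\<eta> / real n)\<bar> ^ n"
    unfolding peak_def n_def by (simp only: abs_mult power_abs)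
  also have "\<dots> \<le> (\<eta>\<^sup>2) ^ N * (real n / \<bar>\<eta>\<bar>) ^ n"
    using 1 2 by (intro mult_mono power_mono) auto
  also have "\<dots> = real n ^ n / \<bar>\<eta>\<bar> ^ p"
    using ne by (simp add: n_def power_divide power_add power_mult[symmetric] power_even_abs)
  finally have "\<bar>\<xi>\<bar> ^ p * \<bar>peak N p \<eta>\<bar> \<le> (3 * \<bar>\<eta>\<bar>) ^ p * (real n ^ n / \<bar>\<eta>\<bar> ^ p)"
    using assms(3) by (intro mult_mono power_mono) auto
  also have "\<dots> = real n ^ n * 3 ^ p" using ne by (simp add: power_mult_distrib)
  finally show ?thesis by (simp add: n_def)
qed

text \<open>The weighted function \<open>\<xi> ^ p * F \<xi>\<close> is integrated against the
  kernel centred inside the interval of known sign. From above, the multiplier estimate at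
  \<open>x = 0\<close> needs the transform on \<open>[-1, 1]\<close> only. From below, an interval
  of length \<open>2 / N\<close> contributes \<open>a ^ p * L / (2 * N)\<close>, and everything else
  is charged to the total mass of \<open>\<bar>F\<bar>\<close>.\<close>

lemma peak_moment_bound:
  fixes F :: "real \<Rightarrow> real"
  assumes F: "(\<lambda>\<xi>. complex_of_real (F \<xi>)) \<in> Gamma_class \<sigma>" and \<sigma>: "\<sigma> > 1"
    and N: "N > 0" and e: "0 < e" "e \<le> 1" and Ne: "1 / real N \<le> e / 4"
    and a: "a \<ge> 10" and L: "L > 0" and s: "\<bar>s\<bar> = 1"
    and lower: "\<And>t. t \<in> {e / 2..e} \<Longrightarrow> s * F (a + t) \<ge> L"
    and supp: "\<And>\<xi>. F \<xi> \<noteq> 0 \<Longrightarrow> \<bar>\<xi> - a\<bar> < 2 \<or> \<xi> \<le> a / 2 + 2 \<or> \<xi> \<ge> 2 * a - 2"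
    and S: "\<And>x. \<bar>x\<bar> \<le> 1 \<Longrightarrow> cmod (\<integral>\<xi>. complex_of_real (\<xi> ^ p * F \<xi>) * iexp (x * \<xi>) \<partial>lborel) \<le> S"
  shows "a ^ p * L / (2 * real N) \<le>
    ((a + 2) ^ p * (1 - e\<^sup>2 / 144) ^ N + real (2 * N + p) ^ (2 * N + p) * 3 ^ p) * (\<integral>\<xi>. \<bar>F \<xi>\<bar> \<partial>lborel)
      + (1 + (real (2 * N + p))\<^sup>2 / 9) ^ N * S"
proof -
  \<comment> \<open>The midpoint of \<open>[a + e / 2, a + e]\<close>: with
    \<open>1 / N \<le> e / 4\<close> the peak interval \<open>I\<close> lies in it, and any point
    outside it has distance more than \<open>e / 4\<close> from \<open>c\<close>.\<close>
  define c where "c = a + 3 / 4 * e"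
  define K where "K = (a + 2) ^ p * (1 - e\<^sup>2 / 144) ^ N + real (2 * N + p) ^ (2 * N + p) * 3 ^ p"
  define I where "I = {c - 1 / real N..c + 1 / real N}"
  have e2: "e\<^sup>2 \<le> 1" using e by (simp add: power_le_one)
  have K0: "(a + 2) ^ p * (1 - e\<^sup>2 / 144) ^ N \<ge> 0" "real (2 * N + p) ^ (2 * N + p) * 3 ^ p \<ge> 0"
    using a e2 by auto
  have [measurable]: "F \<in> borel_measurable borel"
  proof -
    have "(\<lambda>\<xi>. Re (complex_of_real (F \<xi>))) \<in> borel_measurable borel"
      using Gamma_class_borel[OF F] by measurable
    then show ?thesis by simp
  qed
  have intp: "integrable lborel (\<lambda>\<xi>. complex_of_real (\<xi> ^ p * F \<xi>))"
    by (rule Bochner_Integration.integrable_bound[OF Gamma_class_moments_integrable[OF F \<sigma>, of p]])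
       (auto simp: abs_mult power_abs norm_mult norm_power)
  have F1: "integrable lborel (\<lambda>\<xi>. \<bar>F \<xi>\<bar>)"
    using Gamma_class_moments_integrable[OF F \<sigma>, of 0] by simp
  note M = peak_multiplier[OF N, of p c]
  have "cmod (\<integral>\<xi>. complex_of_real (peak N p (\<xi> - c)) * complex_of_real (\<xi> ^ p * F \<xi>) * iexp (0 * \<xi>) \<partial>lborel)
      \<le> (1 + (real (2 * N + p))\<^sup>2 / 9) ^ N * S"
    using S by (intro multiplierD[OF M intp]) simp
  then have up: "cmod (\<integral>\<xi>. complex_of_real (peak N p (\<xi> - c) * (\<xi> ^ p * F \<xi>)) \<partial>lborel)
      \<le> (1 + (real (2 * N + p))\<^sup>2 / 9) ^ N * S" by simp
  have intB: "integrable lborel (\<lambda>\<xi>. complex_of_real (peak N p (\<xi> - c) * (\<xi> ^ p * F \<xi>)))"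
    using multiplier_integrable[OF M intp] by simp
  then have intB': "integrable lborel (\<lambda>\<xi>. s * (peak N p (\<xi> - c) * (\<xi> ^ p * F \<xi>)))"
    by (simp del: of_real_mult add: complex_of_real_integrable_eq)
  have up': "(\<integral>\<xi>. s * (peak N p (\<xi> - c) * (\<xi> ^ p * F \<xi>)) \<partial>lborel) \<le> (1 + (real (2 * N + p))\<^sup>2 / 9) ^ N * S"
  proof -
    have "(\<integral>\<xi>. s * (peak N p (\<xi> - c) * (\<xi> ^ p * F \<xi>)) \<partial>lborel) = s * (\<integral>\<xi>. peak N p (\<xi> - c) * (\<xi> ^ p * F \<xi>) \<partial>lborel)"
      by (rule integral_mult_right_zero)
    also have "\<dots> \<le> \<bar>\<integral>\<xi>. peak N p (\<xi> - c) * (\<xi> ^ p * F \<xi>) \<partial>lborel\<bar>"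
      using s abs_ge_self[of "s * (\<integral>\<xi>. peak N p (\<xi> - c) * (\<xi> ^ p * F \<xi>) \<partial>lborel)"] by (simp add: abs_mult)
    also have "\<dots> = cmod (\<integral>\<xi>. complex_of_real (peak N p (\<xi> - c) * (\<xi> ^ p * F \<xi>)) \<partial>lborel)"
      by (simp only: integral_complex_of_real norm_of_real)
    finally show ?thesis using up by linarith
  qed
  \<comment> \<open>Pointwise form of the lower bound, with \<open>K\<close> collecting both errors.
    The cases are a zero of \<open>F\<close>, the interval of known sign, the rest of the same
    cluster, and the other clusters.\<close>
  have pt: "indicator I \<xi> * (a ^ p * L / 4) - K * \<bar>F \<xi>\<bar> \<le> s * (peak N p (\<xi> - c) * (\<xi> ^ p * F \<xi>))" for \<xi>
  proof -
    define \<eta> where "\<eta> = \<xi> - c"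
    have inI: "\<bar>\<eta>\<bar> \<le> e / 4" if "\<xi> \<in> I"
    proof -
      have "\<bar>\<eta>\<bar> \<le> 1 / real N" using that unfolding I_def \<eta>_def by (auto simp: abs_le_iff)
      then show ?thesis using Ne by linarith
    qed
    have absle: "\<bar>s * (peak N p \<eta> * (\<xi> ^ p * F \<xi>))\<bar> = (\<bar>\<xi>\<bar> ^ p * \<bar>peak N p \<eta>\<bar>) * \<bar>F \<xi>\<bar>"
      using s by (simp add: abs_mult power_abs mult_ac)
    consider "F \<xi> = 0" | "\<bar>\<eta>\<bar> \<le> e / 4" | "\<bar>\<eta>\<bar> > e / 4" "\<bar>\<xi> - a\<bar> < 2"
      | "\<bar>\<eta>\<bar> > e / 4" "F \<xi> \<noteq> 0" "\<not> \<bar>\<xi> - a\<bar> < 2" by linarith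
    then have "indicator I \<xi> * (a ^ p * L / 4) - K * \<bar>F \<xi>\<bar> \<le> s * (peak N p \<eta> * (\<xi> ^ p * F \<xi>))"
    proof cases
      case 1
      have "\<xi> \<notin> I"
      proof
        assume "\<xi> \<in> I"
        from inI[OF this] have "\<xi> - a \<in> {e / 2..e}"
          unfolding \<eta>_def c_def abs_le_iff atLeastAtMost_iff by linarith
        then show False using lower[of "\<xi> - a"] 1 L by simp
      qed
      then show ?thesis using 1 by simp
    next
      case 2
      then have "\<xi> - a \<in> {e / 2..e}"
        unfolding \<eta>_def c_def abs_le_iff atLeastAtMost_iff by linarith
      then have sF: "s * F \<xi> \<ge> L" and \<xi>a: "\<xi> \<ge> a" using lower[of "\<xi> - a"] e by auto
      have pk: "peak N p \<eta> \<ge> 0" using 2 e by (intro peak_nonneg N) linarith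
      have eq: "s * (peak N p \<eta> * (\<xi> ^ p * F \<xi>)) = peak N p \<eta> * (\<xi> ^ p * (s * F \<xi>))" by simp
      have KF: "K * \<bar>F \<xi>\<bar> \<ge> 0"
      proof -
        have "K \<ge> 0" using K0 unfolding K_def by linarith
        then show ?thesis by simp
      qed
      show ?thesis
      proof (cases "\<xi> \<in> I")
        case True
        have "\<bar>\<eta>\<bar> \<le> 1 / real N" using True unfolding I_def \<eta>_def by (auto simp: abs_le_iff)
        then have "peak N p \<eta> \<ge> 1 / 4" by (rule peak_near[OF N])
        then have "1 / 4 * (a ^ p * L) \<le> peak N p \<eta> * (\<xi> ^ p * (s * F \<xi>))"
          using sF \<xi>a a L by (intro mult_mono power_mono) auto
        moreover have "indicator I \<xi> * (a ^ p * L / 4) = 1 / 4 * (a ^ p * L)" using True by simp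
        ultimately show ?thesis using KF unfolding eq by linarith
      next
        case False
        have "0 \<le> peak N p \<eta> * (\<xi> ^ p * (s * F \<xi>))"
        proof (intro mult_nonneg_nonneg[OF pk mult_nonneg_nonneg])
          show "0 \<le> s * F \<xi>" using sF L by linarith
        qed (use \<xi>a a in simp)
        then show ?thesis using KF False unfolding eq by simp
      qed
    next
      case 3
      then have "\<xi> \<notin> I" using inI by force
      moreover have "(\<bar>\<xi>\<bar> ^ p * \<bar>peak N p \<eta>\<bar>) * \<bar>F \<xi>\<bar> \<le> K * \<bar>F \<xi>\<bar>"
      proof (rule mult_right_mono)
        \<comment> \<open>The cluster has radius 2 and \<open>c\<close> is within 3/4 of
          \<open>a\<close>. Then \<open>peak_mid\<close> applies with \<open>d = e / 4\<close>,
          whence \<open>144 = 16 * 9\<close>.\<close>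
        have "\<bar>\<eta>\<bar> \<le> 3" using 3(2) e by (auto simp: \<eta>_def c_def)
        then have "\<bar>peak N p \<eta>\<bar> \<le> (1 - (e / 4)\<^sup>2 / 9) ^ N" using 3(1) e by (intro peak_mid) auto
        also have "(1 - (e / 4)\<^sup>2 / 9) = 1 - e\<^sup>2 / 144" by (simp add: power_divide)
        finally have "\<bar>\<xi>\<bar> ^ p * \<bar>peak N p \<eta>\<bar> \<le> (a + 2) ^ p * (1 - e\<^sup>2 / 144) ^ N"
          using 3(2) a by (intro mult_mono power_mono) auto
        then show "\<bar>\<xi>\<bar> ^ p * \<bar>peak N p \<eta>\<bar> \<le> K" using K0 unfolding K_def by linarith
      qed simp
      ultimately show ?thesis using absle abs_ge_minus_self[of "s * (peak N p \<eta> * (\<xi> ^ p * F \<xi>))"] by simp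
    next
      case 4
      then have "\<xi> \<notin> I" using inI by force
      moreover have "(\<bar>\<xi>\<bar> ^ p * \<bar>peak N p \<eta>\<bar>) * \<bar>F \<xi>\<bar> \<le> K * \<bar>F \<xi>\<bar>"
      proof (rule mult_right_mono)
        \<comment> \<open>\<open>a \<ge> 10\<close> makes the gap \<open>a / 2 - 2\<close> at least
          3; it also makes the distance to \<open>c\<close> comparable with
          \<open>\<bar>\<xi>\<bar>\<close>, even at the neighbouring clusters.\<close>
        have or: "\<xi> \<le> a / 2 + 2 \<or> \<xi> \<ge> 2 * a - 2" using supp[OF 4(2)] 4(3) by blast
        then have "\<bar>\<eta>\<bar> \<ge> 3" "\<bar>\<xi>\<bar> \<le> 3 * \<bar>\<eta>\<bar>"
          using a e unfolding \<eta>_def c_def by (auto simp: abs_if split: if_splits)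
        then have "\<bar>\<xi>\<bar> ^ p * \<bar>peak N p \<eta>\<bar> \<le> real (2 * N + p) ^ (2 * N + p) * 3 ^ p" by (rule peak_far[OF N])
        then show "\<bar>\<xi>\<bar> ^ p * \<bar>peak N p \<eta>\<bar> \<le> K" using K0 unfolding K_def by linarith
      qed simp
      ultimately show ?thesis using absle abs_ge_minus_self[of "s * (peak N p \<eta> * (\<xi> ^ p * F \<xi>))"] by simp
    qed
    then show ?thesis by (simp add: \<eta>_def)
  qed
  have II: "integrable lborel (indicator I :: real \<Rightarrow> real)" unfolding I_def
    by (rule integrable_real_indicator) (auto simp: emeasure_lborel_Icc_eq)
  have "(\<integral>\<xi>. indicator I \<xi> * (a ^ p * L / 4) - K * \<bar>F \<xi>\<bar> \<partial>lborel) \<le> (\<integral>\<xi>. s * (peak N p (\<xi> - c) * (\<xi> ^ p * F \<xi>)) \<partial>lborel)"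
    using pt by (intro integral_mono intB' Bochner_Integration.integrable_diff integrable_mult_left
      integrable_mult_right II F1) auto
  also have "(\<integral>\<xi>. indicator I \<xi> * (a ^ p * L / 4) - K * \<bar>F \<xi>\<bar> \<partial>lborel)
      = (\<integral>\<xi>. indicator I \<xi> * (a ^ p * L / 4) \<partial>lborel) - (\<integral>\<xi>. K * \<bar>F \<xi>\<bar> \<partial>lborel)"
    by (intro Bochner_Integration.integral_diff integrable_mult_left integrable_mult_right II F1)
  also have "(\<integral>\<xi>. indicator I \<xi> * (a ^ p * L / 4) \<partial>lborel) = 2 / real N * (a ^ p * L / 4)"
    by (simp add: I_def)
  also have "2 / real N * (a ^ p * L / 4) = a ^ p * L / (2 * real N)" by simp
  also have "(\<integral>\<xi>. K * \<bar>F \<xi>\<bar> \<partial>lborel) = K * (\<integral>\<xi>. \<bar>F \<xi>\<bar> \<partial>lborel)" by (rule integral_mult_right_zero)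
  finally show ?thesis using up' unfolding K_def by linarith
qed

section \<open>Lacunary spectra and local derivative bounds\<close>

lemma exp_dominated_tendsto_0:
  fixes h :: "real \<Rightarrow> real"
  assumes h: "((\<lambda>X. h X / X powr \<mu>) \<longlongrightarrow> 0) at_top" and "\<mu> > 0" "l > 0"
  shows "((\<lambda>X. exp (h X - l * X powr \<mu>)) \<longlongrightarrow> 0) at_top"
proof -
  have "((\<lambda>X. h X / X powr \<mu> - l) \<longlongrightarrow> - l) at_top"
    using tendsto_diff[OF h tendsto_const[of l]] by simp
  moreover have "filterlim (\<lambda>X::real. X powr \<mu>) at_top at_top"
    using assms by real_asymp
  ultimately have "filterlim (\<lambda>X. (h X / X powr \<mu> - l) * X powr \<mu>) at_bot at_top"
    using assms by (intro filterlim_tendsto_neg_mult_at_bot[where c = "- l"]) auto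
  moreover have ev: "\<forall>\<^sub>F X in at_top. (h X / X powr \<mu> - l) * X powr \<mu> = h X - l * X powr \<mu>"
    using eventually_gt_at_top[of 0] by eventually_elim (simp add: algebra_simps)
  ultimately have "filterlim (\<lambda>X. h X - l * X powr \<mu>) at_bot at_top"
    using filterlim_cong[OF refl refl ev] by blast
  then show ?thesis by (rule filterlim_compose[OF exp_at_bot])
qed

lemma power_le_exp: "1 \<le> x \<Longrightarrow> x \<le> exp y \<Longrightarrow> real k \<le> z \<Longrightarrow> 0 \<le> y \<Longrightarrow> x ^ k \<le> exp (z * y)" for x y z :: real
proof -
  assume a: "1 \<le> x" "x \<le> exp y" "real k \<le> z" "0 \<le> y"
  have "x ^ k \<le> exp y ^ k" using a by (intro power_mono) auto
  also have "\<dots> = exp (real k * y)" by (simp add: exp_of_nat_mult)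
  also have "\<dots> \<le> exp (z * y)" using a by (simp add: mult_right_mono)
  finally show ?thesis .
qed

lemma nat_ceiling_bounds:
  assumes "1 \<le> x"
  shows "x \<le> real (nat \<lceil>x\<rceil>)" "real (nat \<lceil>x\<rceil>) \<le> 2 * x"
proof -
  show "x \<le> real (nat \<lceil>x\<rceil>)" by (rule real_nat_ceiling_ge)
  show "real (nat \<lceil>x\<rceil>) \<le> 2 * x" using assms by linarith
qed

text \<open>With \<open>a = 2 ^ J * (2 * pi / 3)\<close>, the estimate \<open>peak_moment_bound\<close> is applied to \<open>N \<approx> J powr (\<beta> + \<delta>)\<close>
  and \<open>p \<approx> J powr (\<beta> - 1 + 2 \<delta>)\<close>. The weight \<open>a ^ p\<close> is then at least \<open>exp (ln 2 * J powr (\<beta> + 2 \<delta>))\<close>,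
  which beats all the losses.\<close>

lemma inv_fourier_not_ext_gevrey:
  fixes F :: "real \<Rightarrow> real"
  assumes F: "(\<lambda>\<xi>. complex_of_real (F \<xi>)) \<in> Gamma_class \<sigma>" and \<sigma>: "\<sigma> > 1"
    and e: "0 < e" "e \<le> 1" and c: "c > 0" and \<beta>: "\<beta> > 1"
    and lower: "\<And>J. J \<ge> 1 \<Longrightarrow> \<exists>s. \<bar>s\<bar> = 1 \<and>
      (\<forall>t\<in>{e / 2..e}. s * F (2 ^ J * (2 * pi / 3) + t) \<ge> c * exp (- (C * real J powr \<beta>)))"
    and supp: "\<And>J \<xi>. F \<xi> \<noteq> 0 \<Longrightarrow> 2 ^ J * (2 * pi / 3) \<ge> 10 \<Longrightarrow> \<bar>\<xi> - 2 ^ J * (2 * pi / 3)\<bar> < 2 \<or>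
      \<xi> \<le> 2 ^ J * (2 * pi / 3) / 2 + 2 \<or> \<xi> \<ge> 2 * (2 ^ J * (2 * pi / 3)) - 2"
    and \<sigma>': "1 < \<sigma>'" "\<beta> - 1 < 1 / (\<sigma>' - 1)"
  shows "inv_fourier (\<lambda>\<xi>. complex_of_real (F \<xi>)) \<notin> ext_gevrey \<sigma>'"
proof
  let ?F = "\<lambda>\<xi>. complex_of_real (F \<xi>)"
  assume "inv_fourier ?F \<in> ext_gevrey \<sigma>'"
  then obtain \<tau> where \<tau>: "\<tau> > 0" and mem: "inv_fourier ?F \<in> ext_gevrey_tau \<tau> \<sigma>'"
    by (auto simp: ext_gevrey_def)
  from mem have "\<forall>K. compact K \<longrightarrow> (\<exists>C>0. \<forall>p. \<forall>x\<in>K.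
      cmod (nth_deriv p (inv_fourier ?F) x) \<le> C powr (real p powr \<sigma>' + 1) * M_seq \<tau> \<sigma>' p)"
    unfolding ext_gevrey_tau_def mem_Collect_eq by (rule conjunct2)
  from this[rule_format, OF compact_Icc[of "-1" 1]] obtain D0 where D0: "D0 > 0"
    "\<forall>p. \<forall>x\<in>{-1..1}. cmod (nth_deriv p (inv_fourier ?F) x) \<le> D0 powr (real p powr \<sigma>' + 1) * M_seq \<tau> \<sigma>' p"
    by (elim exE conjE)
  define D where "D = max 1 D0"
  have D: "D \<ge> 1" "D0 \<le> D" by (auto simp: D_def)
  define K where "K p = 2 * pi * (D powr (real p powr \<sigma>' + 1) * M_seq \<tau> \<sigma>' p)" for p
  have S: "cmod (\<integral>\<xi>. complex_of_real (\<xi> ^ p * F \<xi>) * iexp (x * \<xi>) \<partial>lborel) \<le> K p" if "\<bar>x\<bar> \<le> 1" for p x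
  proof -
    have "nth_deriv p (inv_fourier ?F) x = \<i> ^ p * (1 / (2 * complex_of_real pi)) *
        (\<integral>\<xi>. complex_of_real (\<xi> ^ p * F \<xi>) * iexp (x * \<xi>) \<partial>lborel)"
      unfolding Gamma_class_nth_deriv(1)[OF F \<sigma>] inv_fourier_def
      by (subst integral_mult_right_zero[symmetric] | simp add: power_mult_distrib mult_ac)+
    then have "cmod (nth_deriv p (inv_fourier ?F) x) =
        cmod (\<integral>\<xi>. complex_of_real (\<xi> ^ p * F \<xi>) * iexp (x * \<xi>) \<partial>lborel) / (2 * pi)"
      by (simp only: norm_mult norm_power norm_divide) simp
    then have "cmod (\<integral>\<xi>. complex_of_real (\<xi> ^ p * F \<xi>) * iexp (x * \<xi>) \<partial>lborel)
        = 2 * pi * cmod (nth_deriv p (inv_fourier ?F) x)" by simp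
    also have "\<dots> \<le> 2 * pi * (D0 powr (real p powr \<sigma>' + 1) * M_seq \<tau> \<sigma>' p)"
      using D0(2) that by (intro mult_left_mono) (auto simp: abs_le_iff)
    also have "\<dots> \<le> K p" unfolding K_def
      using D D0 by (intro mult_left_mono mult_right_mono powr_mono2) (auto simp: M_seq_def add_nonneg_nonneg)
    finally show ?thesis .
  qed
  define A where "A = (\<integral>\<xi>. \<bar>F \<xi>\<bar> \<partial>lborel)"
  have A: "A \<ge> 0" by (simp add: A_def)
  define y where "y = 1 / (\<sigma>' - 1)"
  \<comment> \<open>A derivative of order \<open>p \<approx> X powr b\<close> gains
    \<open>X powr (1 + b)\<close> in the exponent and costs about
    \<open>X powr (b * \<sigma>')\<close>, so \<open>b < 1 / (\<sigma>' - 1)\<close> is required; to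
    beat the lower bound, \<open>1 + b\<close> must exceed \<open>\<beta>\<close>. A
    \<open>\<delta>\<close> of at most a quarter of the gap leaves room for \<open>q\<close>
    strictly between \<open>\<beta>\<close> and \<open>1 + b\<close>;
    \<open>\<delta> \<le> 1\<close> gives \<open>b \<le> q\<close>.\<close>
  define \<delta> where "\<delta> = min 1 ((y - (\<beta> - 1)) / 4)"
  have \<delta>: "0 < \<delta>" "\<delta> \<le> 1" "\<beta> - 1 + 2 * \<delta> < 1 / (\<sigma>' - 1)"
    using \<sigma>'(2) unfolding y_def[symmetric] by (auto simp: \<delta>_def min_def field_simps)
  define b where "b = \<beta> - 1 + 2 * \<delta>"
  define q where "q = \<beta> + \<delta>"
  define \<mu> where "\<mu> = 1 + b"
  define \<gamma> where "\<gamma> = b * \<sigma>'"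
  have b: "b > 0" "b \<le> q" using \<beta> \<delta> by (auto simp: b_def q_def)
  have q: "\<beta> < q" "0 < q" "q < \<mu>" "0 < \<mu>" using \<beta> \<delta> by (auto simp: b_def q_def \<mu>_def)
  have \<gamma>: "\<gamma> < \<mu>" "0 < \<gamma>"
  proof -
    have "b * (\<sigma>' - 1) < 1" using \<delta>(3) \<sigma>' by (simp add: b_def field_simps)
    then show "\<gamma> < \<mu>" by (simp add: \<gamma>_def \<mu>_def algebra_simps)
    show "0 < \<gamma>" using b \<sigma>' by (simp add: \<gamma>_def)
  qed
  have q0: "0 < 1 - e\<^sup>2 / 144" "1 - e\<^sup>2 / 144 \<le> exp (- (e\<^sup>2 / 144))"
  proof -
    have "e\<^sup>2 \<le> 1" using e by (simp add: power_le_one)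
    then show "0 < 1 - e\<^sup>2 / 144" by simp
    show "1 - e\<^sup>2 / 144 \<le> exp (- (e\<^sup>2 / 144))" using exp_ge_add_one_self[of "- (e\<^sup>2 / 144)"] by simp
  qed
  define \<kappa> where "\<kappa> = e\<^sup>2 / 144"
  have \<kappa>: "\<kappa> > 0" using e by (simp add: \<kappa>_def)
  \<comment> \<open>Logarithms of the losses: \<open>h0\<close> stands for the lower bound and the
    length of the peak; \<open>h2\<close> and \<open>h3\<close> add to it the far clusters,
    respectively the kernel mass and the derivative bound.\<close>
  define h0 where "h0 X = ln (4 * X powr q) + C * X powr \<beta>" for X
  define h2 where "h2 X = h0 X + 6 * X powr q * ln (6 * X powr q) + 4 * X powr q" for X
  define h3 where "h3 X = h0 X + 2 * X powr q * ln (1 + 4 * (X powr q)\<^sup>2)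
      + ln D * ((2 powr \<sigma>') * X powr \<gamma> + 1) + \<tau> * (2 powr \<sigma>' * X powr \<gamma>) * ln (2 * X powr b)" for X
  \<comment> \<open>The estimate \<open>key\<close> below, divided by \<open>a ^ p\<close> and
    solved for \<open>c\<close>. The weight cancels from the same-cluster term, which must be beaten
    by \<open>exp (- \<kappa> * X powr q)\<close> alone; the other two terms keep
    \<open>a ^ p\<close> in the denominator.\<close>
  have main: "c \<le> 3 * A * exp (h0 X - \<kappa> * X powr q) + A * exp (h2 X - ln 2 * X powr \<mu>)
        + 2 * pi * exp (h3 X - ln 2 * X powr \<mu>)"
    if J: "J \<ge> 1" "X = real J" "2 ^ J \<ge> (10 :: real)" "4 / e \<le> X powr q" "4 * X powr b \<le> 2 powr X" for J X
  proof -
    define a where "a = 2 ^ J * (2 * pi / 3)"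
    have X: "X \<ge> 1" using J by simp
    define Q where "Q = X powr q"
    define P where "P = X powr b"
    have QP: "Q \<ge> 1" "P \<ge> 1" "P \<le> Q" using X q b by (auto simp: Q_def P_def ge_one_powr_ge_zero intro: powr_mono)
    define N where "N = nat \<lceil>Q\<rceil>"
    define p where "p = nat \<lceil>P\<rceil>"
    note Nb = nat_ceiling_bounds[OF QP(1), folded N_def]
    note pb = nat_ceiling_bounds[OF QP(2), folded p_def]
    define n where "n = 2 * N + p"
    have N: "N > 0" using Nb QP by (metis gr0I of_nat_0 not_one_le_zero order.trans)
    have p: "p > 0" using pb QP by (metis gr0I of_nat_0 not_one_le_zero order.trans)
    have n: "real n \<le> 6 * Q" "n > 0" using Nb pb QP N by (auto simp: n_def)
    have a2: "a \<ge> 2 ^ J"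
    proof -
      have "1 \<le> 2 * pi / 3" using pi_gt3 by simp
      then have "2 ^ J * 1 \<le> (2 ^ J * (2 * pi / 3) :: real)" by (intro mult_left_mono) auto
      then show ?thesis by (simp add: a_def)
    qed
    have a: "a \<ge> 10" using a2 J by linarith
    have Ne: "1 / real N \<le> e / 4"
    proof -
      have "4 / e \<le> real N" using J(4) Nb by (simp add: Q_def)
      then show ?thesis using e N by (simp add: field_simps)
    qed
    obtain s where s: "\<bar>s\<bar> = 1" "\<And>t. t \<in> {e / 2..e} \<Longrightarrow> s * F (a + t) \<ge> c * exp (- (C * X powr \<beta>))"
      using lower[OF J(1)] unfolding a_def J(2) by blast
    have key: "a ^ p * (c * exp (- (C * X powr \<beta>))) / (2 * real N) \<le>
      ((a + 2) ^ p * (1 - e\<^sup>2 / 144) ^ N + real (2 * N + p) ^ (2 * N + p) * 3 ^ p) * (\<integral>\<xi>. \<bar>F \<xi>\<bar> \<partial>lborel)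
      + (1 + (real (2 * N + p))\<^sup>2 / 9) ^ N * K p"
      by (rule peak_moment_bound[OF F \<sigma> N e Ne a _ s(1) s(2) _ S]) (use c supp[of _ J] a in \<open>auto simp: a_def\<close>)
    \<comment> \<open>The cluster is narrow compared with \<open>a / p\<close>: from
      \<open>2 * p \<le> 4 * P \<le> 2 ^ J \<le> a\<close> the weight grows from its centre by a
      factor of at most \<open>exp 1 \<le> 3\<close>.\<close>
    have ap: "(a + 2) ^ p \<le> 3 * a ^ p"
    proof -
      have "a + 2 \<le> a * exp (2 / a)"
      proof -
        have "a * (1 + 2 / a) \<le> a * exp (2 / a)" using a by (intro mult_left_mono exp_ge_add_one_self_aux) auto
        then show ?thesis using a by (simp add: algebra_simps)
      qed
      then have "(a + 2) ^ p \<le> (a * exp (2 / a)) ^ p" using a by (intro power_mono) auto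
      also have "\<dots> = a ^ p * exp (real p * (2 / a))" by (simp only: power_mult_distrib exp_of_nat_mult)
      also have "real p * (2 / a) \<le> 1"
      proof -
        have "real p * 2 \<le> 4 * P" using pb by simp
        also have "\<dots> \<le> 2 ^ J" using J(5) by (simp add: P_def J(2) powr_realpow)
        also have "\<dots> \<le> a" by (rule a2)
        finally show ?thesis using a by (simp add: field_simps)
      qed
      then have "a ^ p * exp (real p * (2 / a)) \<le> a ^ p * 3"
        using a exp_le by (intro mult_left_mono) (auto intro: order.trans[of _ "exp 1"])
      finally show ?thesis by simp
    qed
    have qN: "(1 - e\<^sup>2 / 144) ^ N \<le> exp (- (\<kappa> * Q))"
    proof -
      have "(1 - e\<^sup>2 / 144) ^ N \<le> exp (- (e\<^sup>2 / 144)) ^ N" using q0 by (intro power_mono) auto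
      also have "\<dots> = exp (- (\<kappa> * real N))" by (simp add: \<kappa>_def exp_of_nat_mult[symmetric] mult_ac)
      also have "\<dots> \<le> exp (- (\<kappa> * Q))" using \<kappa> Nb by (simp add: mult_left_mono)
      finally show ?thesis .
    qed
    have nn: "real n ^ n * 3 ^ p \<le> exp (6 * Q * ln (6 * Q) + 4 * Q)"
    proof -
      have 1: "real n ^ n \<le> exp (6 * Q * ln (6 * Q))"
        using n QP by (intro power_le_exp) auto
      have "3 ^ p \<le> exp (2 * P * 2)"
      proof (intro power_le_exp)
        show "3 \<le> exp (2::real)" using exp_ge_add_one_self[of "2::real"] by simp
      qed (use pb in auto)
      also have "exp (2 * P * 2) \<le> exp (4 * Q)" using QP by simp
      finally show ?thesis unfolding exp_add using 1 by (intro mult_mono) auto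
    qed
    have mass: "(1 + (real n)\<^sup>2 / 9) ^ N \<le> exp (2 * Q * ln (1 + 4 * Q\<^sup>2))"
    proof (intro power_le_exp)
      have "(real n)\<^sup>2 \<le> (6 * Q)\<^sup>2" using n by (intro power_mono) auto
      then have "1 + (real n)\<^sup>2 / 9 \<le> 1 + 4 * Q\<^sup>2" by (simp add: power_mult_distrib)
      also have "\<dots> = exp (ln (1 + 4 * Q\<^sup>2))" by (intro exp_ln[symmetric]) (simp add: add_pos_nonneg)
      finally show "1 + (real n)\<^sup>2 / 9 \<le> exp (ln (1 + 4 * Q\<^sup>2))" .
    qed (use Nb in auto)
    have Kp: "K p \<le> 2 * pi * exp (ln D * ((2 powr \<sigma>') * X powr \<gamma> + 1) + \<tau> * (2 powr \<sigma>' * X powr \<gamma>) * ln (2 * X powr b))"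
    proof -
      have ps: "real p powr \<sigma>' \<le> 2 powr \<sigma>' * X powr \<gamma>"
      proof -
        have "real p powr \<sigma>' \<le> (2 * P) powr \<sigma>'" using pb \<sigma>' by (intro powr_mono2) auto
        also have "\<dots> = 2 powr \<sigma>' * X powr \<gamma>" by (simp add: powr_mult P_def powr_powr \<gamma>_def)
        finally show ?thesis .
      qed
      have "D powr (real p powr \<sigma>' + 1) = exp (ln D * (real p powr \<sigma>' + 1))" using D by (simp add: powr_def mult_ac)
      also have "\<dots> \<le> exp (ln D * ((2 powr \<sigma>') * X powr \<gamma> + 1))" using ps D by (simp add: mult_left_mono)
      finally have 1: "D powr (real p powr \<sigma>' + 1) \<le> exp (ln D * ((2 powr \<sigma>') * X powr \<gamma> + 1))" .
      have "M_seq \<tau> \<sigma>' p = exp (\<tau> * real p powr \<sigma>' * ln (real p))" using p by (simp add: M_seq_def powr_def)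
      also have "\<dots> \<le> exp (\<tau> * (2 powr \<sigma>' * X powr \<gamma>) * ln (2 * X powr b))"
      proof (subst exp_le_cancel_iff, intro mult_mono)
        show "ln (real p) \<le> ln (2 * X powr b)" using pb p unfolding P_def by (subst ln_le_cancel_iff) auto
      qed (use ps \<tau> p in auto)
      finally have 2: "M_seq \<tau> \<sigma>' p \<le> exp (\<tau> * (2 powr \<sigma>' * X powr \<gamma>) * ln (2 * X powr b))" .
      show ?thesis unfolding K_def exp_add using 1 2 by (intro mult_left_mono mult_mono) (auto simp: M_seq_def)
    qed
    have app: "a ^ p \<ge> exp (ln 2 * X powr \<mu>)"
    proof -
      have "ln 2 * X powr \<mu> = P * (X * ln 2)" using X by (simp add: \<mu>_def P_def powr_add)
      also have "\<dots> \<le> real p * (X * ln 2)" using pb X by (intro mult_right_mono) auto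
      finally have "exp (ln 2 * X powr \<mu>) \<le> exp (real p * (X * ln 2))" by simp
      also have "\<dots> = (exp (X * ln 2)) ^ p" by (simp add: exp_of_nat_mult)
      also have "exp (X * ln 2) = 2 ^ J" by (simp add: J(2) exp_of_nat_mult)
      also have "(2 ^ J) ^ p \<le> a ^ p" using a2 by (intro power_mono) auto
      finally show ?thesis .
    qed
    define E where "E = exp (ln 2 * X powr \<mu>)"
    have E: "E > 0" "a ^ p \<ge> E" using app by (auto simp: E_def)
    define U where "U = real n ^ n * 3 ^ p * A + (1 + (real n)\<^sup>2 / 9) ^ N * K p"
    have U0: "U \<ge> 0" using A by (auto simp: U_def K_def M_seq_def)
    have "a ^ p * (c * exp (- (C * X powr \<beta>))) / (2 * real N) \<le> (a + 2) ^ p * (1 - e\<^sup>2 / 144) ^ N * A + U"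
      using key unfolding A_def[symmetric] n_def[symmetric] U_def by (simp add: algebra_simps)
    also have "\<dots> \<le> (3 * a ^ p) * exp (- (\<kappa> * Q)) * A + U * (a ^ p / E)"
    proof (rule add_mono)
      show "(a + 2) ^ p * (1 - e\<^sup>2 / 144) ^ N * A \<le> (3 * a ^ p) * exp (- (\<kappa> * Q)) * A"
        using ap qN A a q0 by (intro mult_right_mono mult_mono) auto
      have "U * 1 \<le> U * (a ^ p / E)" using U0 E by (intro mult_left_mono) auto
      then show "U \<le> U * (a ^ p / E)" by simp
    qed
    also have "\<dots> = a ^ p * (3 * A * exp (- (\<kappa> * Q)) + U / E)" by (simp add: algebra_simps)
    finally have "c * exp (- (C * X powr \<beta>)) / (2 * real N) \<le> 3 * A * exp (- (\<kappa> * Q)) + U / E"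
      using a by (simp add: times_divide_eq_right[symmetric] del: times_divide_eq_right)
    then have "c * exp (- (C * X powr \<beta>)) \<le> (3 * A * exp (- (\<kappa> * Q)) + U / E) * (2 * real N)"
      using N by (simp add: pos_divide_le_eq)
    also have "\<dots> \<le> (3 * A * exp (- (\<kappa> * Q)) + U / E) * (4 * Q)"
      using Nb A U0 E by (intro mult_left_mono) auto
    finally have fin: "c * exp (- (C * X powr \<beta>)) * exp (C * X powr \<beta>) \<le>
        (3 * A * exp (- (\<kappa> * Q)) + U / E) * (4 * Q) * exp (C * X powr \<beta>)" by (rule mult_right_mono) simp
    have e1: "exp (- (C * X powr \<beta>)) * exp (C * X powr \<beta>) = 1" by (simp add: exp_minus)
    have "c \<le> (3 * A * exp (- (\<kappa> * Q)) + U / E) * (4 * Q) * exp (C * X powr \<beta>)"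
      using fin by (simp only: mult.assoc e1 mult_1_right)
    also have "\<dots> = (3 * A * exp (- (\<kappa> * Q)) + U / E) * exp (h0 X)"
      using QP by (simp add: h0_def exp_add Q_def[symmetric])
    also have "\<dots> = 3 * A * exp (h0 X - \<kappa> * X powr q) + U * exp (h0 X - ln 2 * X powr \<mu>)"
    proof -
      have "exp (h0 X - \<kappa> * X powr q) = exp (- (\<kappa> * Q)) * exp (h0 X)"
        by (simp add: Q_def flip: exp_add)
      moreover have "exp (h0 X - ln 2 * X powr \<mu>) = exp (h0 X) / E" by (simp only: E_def exp_diff)
      ultimately show ?thesis by (simp add: distrib_left distrib_right mult_ac)
    qed
    also have "U * exp (h0 X - ln 2 * X powr \<mu>) \<le>
        (exp (6 * Q * ln (6 * Q) + 4 * Q) * A + exp (2 * Q * ln (1 + 4 * Q\<^sup>2)) *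
         (2 * pi * exp (ln D * ((2 powr \<sigma>') * X powr \<gamma> + 1) + \<tau> * (2 powr \<sigma>' * X powr \<gamma>) * ln (2 * X powr b))))
         * exp (h0 X - ln 2 * X powr \<mu>)"
      unfolding U_def using nn mass Kp A
      by (intro mult_right_mono add_mono mult_mono) (auto simp: K_def M_seq_def)
    also have "\<dots> = A * exp (h2 X - ln 2 * X powr \<mu>) + 2 * pi * exp (h3 X - ln 2 * X powr \<mu>)"
    proof -
      have "exp (h2 X - ln 2 * X powr \<mu>) = exp (6 * Q * ln (6 * Q) + 4 * Q) * exp (h0 X - ln 2 * X powr \<mu>)"
        unfolding exp_add[symmetric] by (simp add: h2_def Q_def)
      moreover have "exp (h3 X - ln 2 * X powr \<mu>) = exp (2 * Q * ln (1 + 4 * Q\<^sup>2)) *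
         exp (ln D * ((2 powr \<sigma>') * X powr \<gamma> + 1) + \<tau> * (2 powr \<sigma>' * X powr \<gamma>) * ln (2 * X powr b))
         * exp (h0 X - ln 2 * X powr \<mu>)"
        unfolding exp_add[symmetric] by (simp add: h3_def Q_def)
      ultimately show ?thesis by (simp only: distrib_left distrib_right mult_ac)
    qed
    finally show ?thesis by simp
  qed
  have t0: "((\<lambda>X. h0 X / X powr q) \<longlongrightarrow> 0) at_top"
  proof -
    have "((\<lambda>X. ln (4 * X powr q) / X powr q) \<longlongrightarrow> 0) at_top" using q by real_asymp
    moreover have "((\<lambda>X. C * X powr \<beta> / X powr q) \<longlongrightarrow> 0) at_top" using q by real_asymp
    ultimately show ?thesis unfolding h0_def add_divide_distrib by (auto intro: tendsto_add_zero)
  qed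
  have t0': "((\<lambda>X. h0 X / X powr \<mu>) \<longlongrightarrow> 0) at_top"
  proof -
    have "((\<lambda>X. ln (4 * X powr q) / X powr \<mu>) \<longlongrightarrow> 0) at_top" using q by real_asymp
    moreover have "((\<lambda>X. C * X powr \<beta> / X powr \<mu>) \<longlongrightarrow> 0) at_top" using q by real_asymp
    ultimately show ?thesis unfolding h0_def add_divide_distrib by (auto intro: tendsto_add_zero)
  qed
  have t2: "((\<lambda>X. h2 X / X powr \<mu>) \<longlongrightarrow> 0) at_top"
  proof -
    have "((\<lambda>X. 6 * X powr q * ln (6 * X powr q) / X powr \<mu>) \<longlongrightarrow> 0) at_top" using q by real_asymp
    moreover have "((\<lambda>X. 4 * X powr q / X powr \<mu>) \<longlongrightarrow> 0) at_top" using q by real_asymp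
    ultimately show ?thesis unfolding h2_def add_divide_distrib using t0' by (auto intro: tendsto_add_zero)
  qed
  have t3: "((\<lambda>X. h3 X / X powr \<mu>) \<longlongrightarrow> 0) at_top"
  proof -
    have "((\<lambda>X. 2 * X powr q * ln (1 + 4 * (X powr q)\<^sup>2) / X powr \<mu>) \<longlongrightarrow> 0) at_top" using q by real_asymp
    moreover have "((\<lambda>X. ln D * ((2 powr \<sigma>') * X powr \<gamma> + 1) / X powr \<mu>) \<longlongrightarrow> 0) at_top"
    proof -
      have "((\<lambda>X. ((2 powr \<sigma>') * X powr \<gamma> + 1) / X powr \<mu>) \<longlongrightarrow> 0) at_top" using q \<gamma> by real_asymp
      then have "((\<lambda>X. ln D * (((2 powr \<sigma>') * X powr \<gamma> + 1) / X powr \<mu>)) \<longlongrightarrow> 0) at_top"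
        by (rule tendsto_mult_right_zero)
      then show ?thesis by simp
    qed
    moreover have "((\<lambda>X. \<tau> * (2 powr \<sigma>' * X powr \<gamma>) * ln (2 * X powr b) / X powr \<mu>) \<longlongrightarrow> 0) at_top"
      using q \<gamma> b \<tau> by real_asymp
    ultimately show ?thesis unfolding h3_def add_divide_distrib using t0' by (intro tendsto_add_zero) assumption+
  qed
  \<comment> \<open>\<open>\<beta> < q\<close> makes \<open>h0\<close> negligible against
    \<open>X powr q\<close>, while \<open>q < \<mu>\<close> and \<open>\<gamma> < \<mu>\<close> make
    \<open>h2\<close> and \<open>h3\<close> negligible against \<open>X powr \<mu>\<close>.\<close>
  have "((\<lambda>X. 3 * A * exp (h0 X - \<kappa> * X powr q) + A * exp (h2 X - ln 2 * X powr \<mu>)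
        + 2 * pi * exp (h3 X - ln 2 * X powr \<mu>)) \<longlongrightarrow> 0) at_top"
    using t0 t2 t3 q \<kappa>
    by (intro tendsto_add_zero tendsto_mult_right_zero exp_dominated_tendsto_0) auto
  then have ev: "\<forall>\<^sub>F X in at_top. 3 * A * exp (h0 X - \<kappa> * X powr q) + A * exp (h2 X - ln 2 * X powr \<mu>)
        + 2 * pi * exp (h3 X - ln 2 * X powr \<mu>) < c" by (rule order_tendstoD) (rule c)
  have ev2: "\<forall>\<^sub>F X in at_top. 4 * X powr b \<le> 2 powr X" using b by real_asymp
  have "filterlim (\<lambda>X::real. X powr q) at_top at_top" using q by real_asymp
  then have ev3: "\<forall>\<^sub>F X in at_top. 4 / e \<le> X powr q" by (simp add: filterlim_at_top)
  have "\<forall>\<^sub>F J in sequentially. False"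
    using eventually_compose_filterlim[OF ev filterlim_real_sequentially]
      eventually_compose_filterlim[OF ev2 filterlim_real_sequentially]
      eventually_compose_filterlim[OF ev3 filterlim_real_sequentially] eventually_ge_at_top[of "4 :: nat"]
  proof eventually_elim
    case (elim J)
    have "(2::real) ^ 4 \<le> 2 ^ J" using elim by (intro power_increasing) auto
    then show False using main[of J "real J"] elim by auto
  qed
  then show False by simp
qed

section \<open>The cascade product\<close>

lemma constant_sign:
  fixes f :: "real \<Rightarrow> real"
  assumes cont: "continuous_on {u..v} f" and L: "L > 0" and ge: "\<And>x. x \<in> {u..v} \<Longrightarrow> \<bar>f x\<bar> \<ge> L"
  shows "\<exists>s. \<bar>s\<bar> = 1 \<and> (\<forall>x\<in>{u..v}. s * f x \<ge> L)"
proof (cases "\<exists>x\<in>{u..v}. f x > 0")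
  case True
  then obtain x where x: "x \<in> {u..v}" "f x > 0" by blast
  have conn: "connected (f ` {u..v})" by (rule connected_continuous_image[OF cont connected_Icc])
  have "f y \<ge> L" if y: "y \<in> {u..v}" for y
  proof (rule ccontr)
    assume "\<not> f y \<ge> L"
    then have "f y < 0" using ge[OF y] L by linarith
    then have "0 \<in> {f y..f x}" using x by simp
    then have "0 \<in> f ` {u..v}" using connected_contains_Icc[OF conn, of "f y" "f x"] x y by blast
    then show False using ge L by force
  qed
  then show ?thesis by (intro exI[of _ 1]) auto
next
  case False
  then have "- f y \<ge> L" if "y \<in> {u..v}" for y using ge[OF that] that by force
  then show ?thesis by (intro exI[of _ "-1"]) auto
qed

locale low_pass_setup =
  fixes m0 :: "real \<Rightarrow> real"
  assumes cont: "continuous_on UNIV m0"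
    and even: "\<And>\<xi>. m0 (- \<xi>) = m0 \<xi>"
    and periodic: "\<And>\<xi>. m0 (\<xi> + 2 * pi) = m0 \<xi>"
    and at_0: "m0 0 = 1"
    and quadrature: "\<And>\<xi>. \<bar>m0 \<xi>\<bar>\<^sup>2 + \<bar>m0 (\<xi> + pi)\<bar>\<^sup>2 = 1"
    and nonzero_set: "{\<xi>. m0 \<xi> \<noteq> 0} \<inter> {0..pi} \<subseteq> {0..<4 * pi / 5}"
begin

lemma periodic_nat: "m0 (\<xi> + real n * (2 * pi)) = m0 \<xi>"
proof (induction n)
  case (Suc n)
  have "\<xi> + real (Suc n) * (2 * pi) = (\<xi> + real n * (2 * pi)) + 2 * pi" by (simp add: algebra_simps)
  then show ?case using Suc periodic by metis
qed simp

lemma m0_eq_0: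
  assumes "4 * pi / 5 \<le> \<xi>" "\<xi> \<le> 6 * pi / 5"
  shows "m0 \<xi> = 0"
proof -
  have z: "m0 x = 0" if "4 * pi / 5 \<le> x" "x \<le> pi" for x
  proof (rule ccontr)
    assume "m0 x \<noteq> 0"
    moreover have "0 \<le> x" using that pi_gt_zero by linarith
    ultimately have "x \<in> {0..<4 * pi / 5}" using that nonzero_set by auto
    then show False using that by simp
  qed
  show ?thesis
  proof (cases "\<xi> \<le> pi")
    case False
    have "m0 \<xi> = m0 (- \<xi> + 2 * pi)" using even periodic by metis
    also have "\<dots> = 0" using False assms by (intro z) auto
    finally show ?thesis .
  qed (use assms z in auto)
qed

lemma abs_m0_le_1: "\<bar>m0 \<xi>\<bar> \<le> 1"
proof -
  have "\<bar>m0 \<xi>\<bar>\<^sup>2 \<le> 1" using quadrature[of \<xi>] zero_le_power2[of "\<bar>m0 (\<xi> + pi)\<bar>"] by linarith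
  then show ?thesis by (simp add: abs_square_le_1)
qed

text \<open>Shifted by \<open>pi\<close>, the point falls into the zero set, so the quadrature
  identity leaves modulus 1; continuity fixes the sign to that at 0.\<close>

lemma m0_eq_1:
  assumes "\<bar>\<xi>\<bar> \<le> pi / 5"
  shows "m0 \<xi> = 1"
proof -
  have one: "\<bar>m0 x\<bar> \<ge> 1" if "x \<in> {- (pi / 5)..pi / 5}" for x
  proof -
    have "m0 (x + pi) = 0" using that by (intro m0_eq_0) auto
    then have "(m0 x)\<^sup>2 = 1" using quadrature[of x] by simp
    then show ?thesis by (simp add: abs_square_eq_1)
  qed
  obtain s where s: "\<bar>s\<bar> = 1" "\<forall>x\<in>{- (pi / 5)..pi / 5}. s * m0 x \<ge> 1"
    using constant_sign[of "- (pi / 5)" "pi / 5" m0 1] one continuous_on_subset[OF cont] by auto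
  have "s * m0 0 \<ge> 1" using s(2) by simp
  then have "s = 1" using s(1) at_0 by simp
  moreover have "\<xi> \<in> {- (pi / 5)..pi / 5}"
    using assms unfolding abs_le_iff atLeastAtMost_iff by linarith
  ultimately have "m0 \<xi> \<ge> 1" using s(2) by fastforce
  then show ?thesis using abs_m0_le_1[of \<xi>] by simp
qed

definition phat :: "real \<Rightarrow> real" where
  "phat \<xi> = (\<Prod>j. m0 (\<xi> / 2 ^ Suc j))"

text \<open>All factors from index \<open>K\<close> on are exactly 1, so the infinite product is a
  finite one; vanishing factors among the others raise no question of convergence.\<close>

lemma phat_finite:
  assumes "\<bar>\<xi>\<bar> \<le> 2 ^ Suc K * (pi / 5)"
  shows "phat \<xi> = (\<Prod>j<K. m0 (\<xi> / 2 ^ Suc j))"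
  unfolding phat_def
proof (rule prodinf_finite)
  fix j assume "j \<notin> {..<K}"
  then have "(2::real) ^ Suc K \<le> 2 ^ Suc j" by (intro power_increasing) auto
  then have "2 ^ Suc K * (pi / 5) \<le> 2 ^ Suc j * (pi / 5)" by (intro mult_right_mono) auto
  then have "\<bar>\<xi>\<bar> \<le> 2 ^ Suc j * (pi / 5)" using assms by linarith
  then have "\<bar>\<xi> / 2 ^ Suc j\<bar> \<le> pi / 5"
    by (simp only: abs_divide abs_power2 power_abs abs_numeral pos_divide_le_eq zero_less_power zero_less_numeral mult.commute)
  then show "m0 (\<xi> / 2 ^ Suc j) = 1" by (rule m0_eq_1)
qed simp

lemma exists_scale: "\<exists>K\<ge>k. \<bar>\<xi>\<bar> \<le> 2 ^ Suc K * (pi / 5)"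
proof -
  obtain n where "\<bar>\<xi>\<bar> / (pi / 5) < 2 ^ n" using real_arch_pow[of 2] by auto
  also have "(2::real) ^ n \<le> 2 ^ Suc (max k n)" by (intro power_increasing) auto
  finally have "\<bar>\<xi>\<bar> \<le> 2 ^ Suc (max k n) * (pi / 5)" by (simp add: pos_divide_less_eq)
  then show ?thesis by (intro exI[of _ "max k n"]) auto
qed

lemma continuous_m0: "continuous_on S f \<Longrightarrow> continuous_on S (\<lambda>x. m0 (f x))"
  by (rule continuous_on_compose2[OF cont]) auto

lemma continuous_phat: "continuous_on UNIV phat"
proof (subst continuous_on_eq_continuous_at, simp, intro ballI)
  fix x :: real
  obtain K where K: "\<bar>\<bar>x\<bar> + 1\<bar> \<le> 2 ^ Suc K * (pi / 5)" using exists_scale by blast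
  have 1: "continuous_on (ball x 1) (\<lambda>\<xi>. \<Prod>j<K. m0 (\<xi> / 2 ^ Suc j))"
    by (intro continuous_intros continuous_m0) auto
  have 2: "phat \<xi> = (\<Prod>j<K. m0 (\<xi> / 2 ^ Suc j))" if "\<xi> \<in> ball x 1" for \<xi>
    using that K by (intro phat_finite) (auto simp: dist_real_def)
  have "continuous_on (ball x 1) phat" by (rule continuous_on_eq[OF 1]) (rule 2[symmetric])
  then show "isCont phat x" by (simp add: continuous_on_eq_continuous_at)
qed

lemma phat_le_factor: "\<bar>phat \<xi>\<bar> \<le> \<bar>m0 (\<xi> / 2 ^ Suc j)\<bar>"
proof -
  obtain K where K: "K \<ge> Suc j" "\<bar>\<xi>\<bar> \<le> 2 ^ Suc K * (pi / 5)" using exists_scale by blast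
  have "\<bar>phat \<xi>\<bar> = (\<Prod>i<K. \<bar>m0 (\<xi> / 2 ^ Suc i)\<bar>)" by (simp add: phat_finite[OF K(2)] abs_prod)
  also have "\<dots> = \<bar>m0 (\<xi> / 2 ^ Suc j)\<bar> * (\<Prod>i\<in>{..<K} - {j}. \<bar>m0 (\<xi> / 2 ^ Suc i)\<bar>)"
    using K by (intro prod.remove) auto
  also have "\<dots> \<le> \<bar>m0 (\<xi> / 2 ^ Suc j)\<bar> * 1"
    using abs_m0_le_1 by (intro mult_left_mono prod_le_1) auto
  finally show ?thesis by simp
qed

lemma abs_phat_le_1: "\<bar>phat \<xi>\<bar> \<le> 1"
  using phat_le_factor[of \<xi> 0] abs_m0_le_1[of "\<xi> / 2 ^ Suc 0"] by linarith

lemma phat_even: "phat (- \<xi>) = phat \<xi>"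
proof -
  have "m0 (- \<xi> / 2 ^ Suc j) = m0 (\<xi> / 2 ^ Suc j)" for j using even[of "\<xi> / 2 ^ Suc j"] by simp
  then show ?thesis unfolding phat_def by presburger
qed

text \<open>The points \<open>\<plusminus>2\<pi>/3\<close> form a cycle of doubling modulo \<open>2\<pi>\<close>; together with evenness,
  doubling a point near \<open>2\<pi>/3\<close> multiplies its offset by \<open>-2\<close>.\<close>

lemma m0_doubling: "m0 (2 ^ k * (2 * pi / 3 + d)) = m0 (2 * pi / 3 + (-2) ^ k * d)"
proof (induction k arbitrary: d)
  case (Suc k)
  have "m0 (2 ^ Suc k * (2 * pi / 3 + d)) = m0 (- (2 ^ k * (2 * pi / 3 + (-2) * d)) + real (2 ^ k) * (2 * pi))"
    by (simp add: algebra_simps)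
  also have "\<dots> = m0 (2 ^ k * (2 * pi / 3 + (-2) * d))" by (simp only: periodic_nat even)
  also have "\<dots> = m0 (2 * pi / 3 + (-2) ^ k * ((-2) * d))" by (rule Suc)
  finally show ?case by (simp add: mult_ac)
qed simp

text \<open>Factors are counted from index \<open>J - 1\<close> downwards: index
  \<open>J - Suc k\<close> evaluates \<open>m0\<close> at \<open>\<xi> / 2 ^ (J - k)\<close>, which
  is \<open>\<xi> / 2 ^ J\<close> after \<open>k\<close> doublings.\<close>

lemma phat_factor:
  assumes "k < J"
  shows "m0 (\<xi> / 2 ^ Suc (J - Suc k)) = m0 (2 * pi / 3 + (-2) ^ k * (\<xi> / 2 ^ J - 2 * pi / 3))"
proof -
  have "(2::real) ^ J = 2 ^ k * 2 ^ Suc (J - Suc k)"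
    unfolding power_add[symmetric] using assms by simp
  then have "\<xi> / 2 ^ Suc (J - Suc k) = 2 ^ k * (2 * pi / 3 + (\<xi> / 2 ^ J - 2 * pi / 3))"
    by simp
  then show ?thesis by (simp only: m0_doubling)
qed

text \<open>The interval is asymmetric because \<open>2 * pi / 3 + 2 * pi / 15 = 4 * pi / 5\<close>
  is where the zeros begin, and the lower end is -2 times the upper one. One more doubling of an
  offset in it stays below \<open>6 * pi / 5\<close>, so it lands either in the zero set, which
  \<open>phat \<xi> \<noteq> 0\<close> forbids, or in the interval again.\<close>

lemma phat_offset_bound:
  assumes nz: "phat \<xi> \<noteq> 0" and J: "2 ^ J * pi / 2 < \<xi>" "\<xi> \<le> 2 ^ J * pi" and k: "k < J"
  shows "(-2) ^ k * (\<xi> / 2 ^ J - 2 * pi / 3) \<in> {- (4 * pi / 15)<..<2 * pi / 15}"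
  using k
proof (induction k)
  case 0
  have "m0 (2 * pi / 3 + (-2) ^ 0 * (\<xi> / 2 ^ J - 2 * pi / 3)) \<noteq> 0"
    using nz phat_le_factor[of \<xi> "J - Suc 0"] phat_factor[OF 0, of \<xi>] by auto
  then have n: "m0 (\<xi> / 2 ^ J) \<noteq> 0" by simp
  have b: "pi / 2 < \<xi> / 2 ^ J" "\<xi> / 2 ^ J \<le> pi" using J by (auto simp: field_simps)
  have "\<not> 4 * pi / 5 \<le> \<xi> / 2 ^ J" using n b m0_eq_0[of "\<xi> / 2 ^ J"] pi_gt_zero by auto
  then have "\<xi> / 2 ^ J - 2 * pi / 3 \<in> {- (4 * pi / 15)<..<2 * pi / 15}"
    using b pi_gt_zero unfolding greaterThanLessThan_iff by linarith
  then show ?case by simp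
next
  case (Suc k)
  define x where "x = (-2) ^ k * (\<xi> / 2 ^ J - 2 * pi / 3)"
  have x: "x \<in> {- (4 * pi / 15)<..<2 * pi / 15}" unfolding x_def using Suc by simp
  have n: "m0 (2 * pi / 3 + (-2) * x) \<noteq> 0"
    using nz phat_le_factor[of \<xi> "J - Suc (Suc k)"] phat_factor[OF Suc.prems, of \<xi>] by (auto simp: x_def mult_ac)
  have "\<not> 4 * pi / 5 \<le> 2 * pi / 3 + (-2) * x"
    using n x m0_eq_0[of "2 * pi / 3 + (-2) * x"] by auto
  then have "(-2) * x \<in> {- (4 * pi / 15)<..<2 * pi / 15}" using x by auto
  then show ?case by (simp add: x_def mult_ac)
qed

text \<open>\<open>J\<close> is the first dyadic scale that reaches \<open>\<xi>\<close>. The last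
  offset, for \<open>k = J - 1\<close>, is below \<open>4 * pi / 15\<close> in modulus, and twice
  this modulus is the distance to the cluster centre, hence less than
  \<open>8 * pi / 15 < 2\<close>.\<close>

lemma phat_support:
  assumes nz: "phat \<xi> \<noteq> 0" and \<xi>: "\<xi> > pi"
  shows "\<exists>J\<ge>1. 2 ^ J * pi / 2 < \<xi> \<and> \<xi> \<le> 2 ^ J * pi \<and> \<bar>\<xi> - 2 ^ J * (2 * pi / 3)\<bar> < 2"
proof -
  define J where "J = (LEAST J. \<xi> \<le> 2 ^ J * pi)"
  obtain n where "\<xi> / pi < 2 ^ n" using real_arch_pow[of 2] by auto
  then have "\<xi> \<le> 2 ^ n * pi" by (simp add: pos_divide_less_eq)
  then have J2: "\<xi> \<le> 2 ^ J * pi" unfolding J_def by (rule LeastI)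
  have J0: "J \<noteq> 0" using J2 \<xi> by (cases J) auto
  then obtain i where i: "J = Suc i" by (cases J) auto
  have "\<not> \<xi> \<le> 2 ^ i * pi"
    unfolding J_def using i not_less_Least[of i "\<lambda>J. \<xi> \<le> 2 ^ J * pi"] by (auto simp: J_def)
  then have J1: "2 ^ J * pi / 2 < \<xi>" by (simp add: i)
  define y where "y = (-2) ^ i * (\<xi> / 2 ^ J - 2 * pi / 3)"
  have "y \<in> {- (4 * pi / 15)<..<2 * pi / 15}"
    unfolding y_def by (rule phat_offset_bound[OF nz J1 J2]) (simp add: i)
  then have "\<bar>y\<bar> < 4 * pi / 15"
    using pi_gt_zero unfolding greaterThanLessThan_iff abs_less_iff by linarith
  then have "2 ^ i * \<bar>\<xi> / 2 ^ J - 2 * pi / 3\<bar> < 4 * pi / 15"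
    by (simp add: y_def abs_mult power_abs)
  moreover have "\<bar>\<xi> - 2 ^ J * (2 * pi / 3)\<bar> = 2 * (2 ^ i * \<bar>\<xi> / 2 ^ J - 2 * pi / 3\<bar>)"
  proof -
    have "\<xi> - 2 ^ J * (2 * pi / 3) = 2 ^ J * (\<xi> / 2 ^ J - 2 * pi / 3)" by (simp add: algebra_simps)
    then show ?thesis by (simp only: abs_mult i power_Suc) simp
  qed
  moreover have "8 * pi / 15 < 2" using pi_approx by simp
  ultimately show ?thesis using J0 J1 J2 by (intro exI[of _ J] conjI) linarith+
qed

text \<open>Consecutive centres differ by the factor 2, so seen from the centre \<open>a\<close> any
  other cluster lies around a point at most \<open>a / 2\<close> or at least \<open>2 * a\<close>.
  Points \<open>\<xi> \<le> pi\<close>, in particular all negative ones, fall under the second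
  alternative.\<close>

lemma phat_support_dyadic:
  assumes nz: "phat \<xi> \<noteq> 0" and a: "2 ^ J * (2 * pi / 3) \<ge> 10"
  shows "\<bar>\<xi> - 2 ^ J * (2 * pi / 3)\<bar> < 2 \<or> \<xi> \<le> 2 ^ J * (2 * pi / 3) / 2 + 2 \<or>
    \<xi> \<ge> 2 * (2 ^ J * (2 * pi / 3)) - 2"
proof (cases "\<xi> > pi")
  case True
  then obtain i where i: "\<bar>\<xi> - 2 ^ i * (2 * pi / 3)\<bar> < 2" using phat_support[OF nz] by blast
  consider "i = J" | "Suc i \<le> J" | "Suc J \<le> i" by linarith
  then show ?thesis
  proof cases
    case 2
    then have "(2::real) ^ Suc i * (2 * pi / 3) \<le> 2 ^ J * (2 * pi / 3)"
      by (intro mult_right_mono power_increasing) auto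
    then have "2 * (2 ^ i * (2 * pi / 3)) \<le> 2 ^ J * (2 * pi / 3)" by simp
    then show ?thesis using i by linarith
  next
    case 3
    then have "(2::real) ^ Suc J * (2 * pi / 3) \<le> 2 ^ i * (2 * pi / 3)"
      by (intro mult_right_mono power_increasing) auto
    then have "2 * (2 ^ J * (2 * pi / 3)) \<le> 2 ^ i * (2 * pi / 3)" by simp
    then show ?thesis using i by linarith
  qed (use i in simp)
next
  case False
  have "pi / 2 < 2" by (rule pi_half_less_two)
  then show ?thesis using False a by linarith
qed

text \<open>The bounded cluster radius makes the first offset \<open>d\<close> of size at most
  \<open>7 / \<xi>\<close>, so \<open>1 / \<bar>d\<bar>\<close> is at least a multiple of
  \<open>\<xi>\<close>; this suffices since \<open>g_weight\<close> sees only logarithms.\<close>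

lemma phat_Gamma_class:
  assumes \<sigma>: "\<sigma> > 1" and pos: "\<epsilon> > 0" "C0 > 0" "\<rho>0 > 0"
    and upper: "\<And>x. \<bar>x\<bar> \<le> \<epsilon> \<Longrightarrow> \<bar>m0 (2 * pi / 3 + x)\<bar> \<le> C0 * f_flat \<rho>0 \<sigma> x"
  shows "(\<lambda>\<xi>. complex_of_real (phat \<xi>)) \<in> Gamma_class \<sigma>"
proof -
  define \<kappa> where "\<kappa> = exp (- ln 2 / (\<sigma> - 1)) / 2"
  define \<rho> where "\<rho> = \<rho>0 * \<kappa>"
  \<comment> \<open>Beyond 49 one has \<open>\<xi> \<le> (\<xi> / 7)\<^sup>2\<close>, and beyond
    \<open>7 / \<epsilon>\<close> the offset stays within \<open>\<epsilon>\<close>; the 7 bounds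
    \<open>2 * pi\<close>.\<close>
  define X where "X = max 49 (7 / \<epsilon>)"
  define C where "C = max C0 (exp (\<rho> * g_weight \<sigma> X))"
  have \<kappa>: "\<kappa> > 0" by (simp add: \<kappa>_def)
  have \<rho>: "\<rho> > 0" using \<kappa> pos by (simp add: \<rho>_def)
  have C: "C > 0" "C0 \<le> C" "exp (\<rho> * g_weight \<sigma> X) \<le> C" using pos by (auto simp: C_def)
  have X: "X \<ge> 49" "X \<ge> 7 / \<epsilon>" by (auto simp: X_def)
  have large: "\<bar>phat \<xi>\<bar> \<le> C * exp (- \<rho> * g_weight \<sigma> \<xi>)" if \<xi>: "\<xi> > X" for \<xi>
  proof (cases "phat \<xi> = 0")
    case False
    have "\<xi> > pi" using \<xi> X pi_less_4 by linarith
    then obtain J where J: "J \<ge> 1" "\<xi> \<le> 2 ^ J * pi" "\<bar>\<xi> - 2 ^ J * (2 * pi / 3)\<bar> < 2"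
      using phat_support[OF False] by blast
    define d where "d = \<xi> / 2 ^ J - 2 * pi / 3"
    have "\<xi> - 2 ^ J * (2 * pi / 3) = 2 ^ J * d" by (simp add: d_def algebra_simps)
    then have d2: "2 ^ J * \<bar>d\<bar> < 2" using J(3) by (simp add: abs_mult)
    have "\<xi> * \<bar>d\<bar> \<le> 2 ^ J * pi * \<bar>d\<bar>" using J(2) by (intro mult_right_mono) auto
    also have "\<dots> = pi * (2 ^ J * \<bar>d\<bar>)" by simp
    also have "\<dots> \<le> pi * 2" using d2 by (intro mult_left_mono) auto
    also have "\<dots> \<le> 7" using pi_approx by simp
    finally have \<xi>d: "\<xi> * \<bar>d\<bar> \<le> 7" .
    have "\<bar>d\<bar> \<le> \<epsilon>"
    proof -
      have "7 / \<epsilon> * \<bar>d\<bar> \<le> \<xi> * \<bar>d\<bar>" using \<xi> X by (intro mult_right_mono) auto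
      then have "7 / \<epsilon> * \<bar>d\<bar> \<le> 7" using \<xi>d by linarith
      then show ?thesis using pos by (simp add: field_simps)
    qed
    have "\<bar>phat \<xi>\<bar> \<le> \<bar>m0 (2 * pi / 3 + d)\<bar>"
      using phat_le_factor[of \<xi> "J - 1"] J(1) by (simp add: d_def)
    also have "\<dots> \<le> C0 * f_flat \<rho>0 \<sigma> d" by (rule upper) fact
    finally have le: "\<bar>phat \<xi>\<bar> \<le> C0 * f_flat \<rho>0 \<sigma> d" .
    \<comment> \<open>Here the convention that \<open>f_flat\<close> is 0 at 0 enters: it excludes
      the centre of the cluster.\<close>
    have d0: "d \<noteq> 0" using le False by (auto simp: f_flat_def)
    have key: "\<kappa> * g_weight \<sigma> \<xi> \<le> g_weight \<sigma> (1 / d)"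
    proof -
      have "\<xi> / 7 \<le> 1 / \<bar>d\<bar>" using \<xi>d d0 by (simp add: field_simps)
      then have "(\<xi> / 7)\<^sup>2 \<le> (1 / \<bar>d\<bar>)\<^sup>2" using \<xi> X by (intro power_mono) auto
      moreover have "\<xi> \<le> (\<xi> / 7)\<^sup>2"
      proof -
        have "\<xi> * 49 \<le> \<xi> * \<xi>" using \<xi> X by (intro mult_left_mono) auto
        then show ?thesis by (simp add: power2_eq_square)
      qed
      moreover have "(1 + 1 / \<bar>d\<bar>)\<^sup>2 = 1 + 2 * (1 / \<bar>d\<bar>) + (1 / \<bar>d\<bar>)\<^sup>2"
        by (simp add: power2_sum)
      moreover have "0 \<le> 1 / \<bar>d\<bar>" by simp
      ultimately have "1 + \<xi> \<le> (1 + 1 / \<bar>d\<bar>)\<^sup>2" by linarith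
      then have "ln (1 + \<xi>) \<le> ln ((1 + 1 / \<bar>d\<bar>)\<^sup>2)"
        using \<xi> X by (subst ln_le_cancel_iff) (auto intro!: add_pos_nonneg)
      also have "\<dots> = 2 * ln (1 + 1 / \<bar>d\<bar>)" by (subst ln_realpow) (auto intro!: add_pos_nonneg)
      finally have "ln (1 + \<xi>) / 2 \<le> ln (1 + 1 / \<bar>d\<bar>)" by simp
      moreover have l0: "0 \<le> ln (1 + \<xi>)" using \<xi> X by simp
      ultimately have "omega \<sigma> (ln (1 + \<xi>) / 2) \<le> omega \<sigma> (ln (1 + 1 / \<bar>d\<bar>))"
        by (intro omega_mono \<sigma>) auto
      then show ?thesis
        using omega_half[OF \<sigma> l0] \<xi> X by (simp add: g_weight_def \<kappa>_def)
    qed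
    have "\<bar>phat \<xi>\<bar> \<le> C0 * exp (- \<rho>0 * g_weight \<sigma> (1 / d))" using le d0 by (simp add: f_flat_def)
    also have "\<dots> \<le> C * exp (- \<rho> * g_weight \<sigma> \<xi>)"
    proof (intro mult_mono)
      have "\<rho>0 * (\<kappa> * g_weight \<sigma> \<xi>) \<le> \<rho>0 * g_weight \<sigma> (1 / d)"
        using key pos by (intro mult_left_mono) auto
      then show "exp (- \<rho>0 * g_weight \<sigma> (1 / d)) \<le> exp (- \<rho> * g_weight \<sigma> \<xi>)"
        by (simp add: \<rho>_def mult_ac)
    qed (use C pos in auto)
    finally show ?thesis .
  qed (use C in simp)
  have "\<bar>phat \<xi>\<bar> \<le> C * exp (- \<rho> * g_weight \<sigma> \<xi>)" for \<xi>
  proof -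
    have g: "g_weight \<sigma> (- x) = g_weight \<sigma> x" for x by (simp add: g_weight_def)
    consider "\<xi> > X" | "- \<xi> > X" | "\<bar>\<xi>\<bar> \<le> X" by linarith
    then show ?thesis
    proof cases
      case 2
      then show ?thesis using large[of "- \<xi>"] by (simp only: phat_even g)
    next
      case 3
      have "ln (1 + \<bar>\<xi>\<bar>) \<le> ln (1 + \<bar>X\<bar>)" using 3 by (subst ln_le_cancel_iff) auto
      then have "g_weight \<sigma> \<xi> \<le> g_weight \<sigma> X" unfolding g_weight_def by (intro omega_mono \<sigma>) auto
      then have "exp (\<rho> * g_weight \<sigma> \<xi>) \<le> C"
        using \<rho> by (intro order.trans[OF _ C(3)]) (simp add: mult_left_mono)
      then have "exp (\<rho> * g_weight \<sigma> \<xi>) * exp (- \<rho> * g_weight \<sigma> \<xi>) \<le> C * exp (- \<rho> * g_weight \<sigma> \<xi>)"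
        by (intro mult_right_mono) auto
      then show ?thesis using abs_phat_le_1[of \<xi>] by (simp flip: exp_add)
    qed (rule large)
  qed
  moreover have "continuous_on UNIV (\<lambda>\<xi>. complex_of_real (phat \<xi>))"
    by (intro continuous_on_of_real continuous_phat)
  ultimately show ?thesis using \<rho> C by (auto simp: Gamma_class_def)
qed

text \<open>For \<open>t\<close> in \<open>[e / 2, e]\<close> all offsets
  \<open>(-2) ^ k * (t / 2 ^ J)\<close> with \<open>k < J\<close> have modulus between
  \<open>e / 2 ^ Suc J\<close> and \<open>e\<close>. So each of these \<open>J\<close> factors is at
  least a constant times \<open>exp (- \<rho>1 * (L * J) powr s)\<close> in modulus, with
  \<open>s = \<sigma> / (\<sigma> - 1)\<close>, and their product has exponent \<open>1 + s\<close>.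
  The only other factor is close to \<open>\<bar>m0 (pi / 3)\<bar> = 1\<close>.\<close>

lemma phat_lower_bound:
  assumes \<sigma>: "\<sigma> > 1" and pos: "\<epsilon> > 0" "C1 > 0" "\<rho>1 > 0" and zero: "m0 (2 * pi / 3) = 0"
    and lower: "\<And>x. \<bar>x\<bar> \<le> \<epsilon> \<Longrightarrow> C1 * f_flat \<rho>1 \<sigma> x \<le> \<bar>m0 (2 * pi / 3 + x)\<bar>"
  obtains e C where "0 < e" "e \<le> 1"
    "\<And>J. J \<ge> 1 \<Longrightarrow> \<exists>s. \<bar>s\<bar> = 1 \<and> (\<forall>t\<in>{e / 2..e}. s * phat (2 ^ J * (2 * pi / 3) + t)
        \<ge> 1 / 2 * exp (- (C * real J powr (1 + \<sigma> / (\<sigma> - 1)))))"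
proof -
  have "\<bar>m0 (- (pi / 3))\<bar>\<^sup>2 + \<bar>m0 (- (pi / 3) + pi)\<bar>\<^sup>2 = 1" by (rule quadrature)
  moreover have "- (pi / 3) + pi = 2 * pi / 3" by simp
  ultimately have "(m0 (pi / 3))\<^sup>2 = 1" using zero even[of "pi / 3"] by simp
  then have m1: "\<bar>m0 (pi / 3)\<bar> = 1" by (simp add: abs_square_eq_1)
  have "isCont m0 (pi / 3)" using cont by (simp add: continuous_on_eq_continuous_at)
  then obtain \<delta> where \<delta>: "\<delta> > 0" "\<And>x. \<bar>x - pi / 3\<bar> < \<delta> \<Longrightarrow> \<bar>m0 x - m0 (pi / 3)\<bar> < 1 / 2"
    unfolding continuous_at_eps_delta by (metis half_gt_zero_iff zero_less_one dist_real_def)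
  define e where "e = Min {\<epsilon>, \<delta>, 1 / 2}"
  have e: "0 < e" "e \<le> \<epsilon>" "e \<le> \<delta>" "e \<le> 1 / 2" using pos \<delta> by (auto simp: e_def)
  \<comment> \<open>Chosen so that \<open>ln (1 + 1 / \<bar>x\<bar>) \<le> L * J\<close> for every
    offset \<open>x\<close>; the 3 both majorises \<open>ln 2\<close> and gives
    \<open>L * J \<ge> exp 1\<close>, as \<open>omega_le_powr\<close> requires.\<close>
  define L where "L = 3 + ln (1 + 2 / e)"
  define s where "s = \<sigma> / (\<sigma> - 1)"
  have s: "s > 0" using \<sigma> by (simp add: s_def)
  have L: "L \<ge> 3" using e by (simp add: L_def)
  \<comment> \<open>At most 1, so that \<open>ln C1'\<close> is nonpositive and
    \<open>J * ln C1'\<close> can be replaced by the smaller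
    \<open>J powr (1 + s) * ln C1'\<close>.\<close>
  define C1' where "C1' = min 1 C1"
  have C1': "0 < C1'" "C1' \<le> 1" "C1' \<le> C1" using pos by (auto simp: C1'_def)
  define C where "C = \<rho>1 * L powr s - ln C1'"
  have est: "\<bar>phat (2 ^ J * (2 * pi / 3) + t)\<bar> \<ge> 1 / 2 * exp (- (C * real J powr (1 + s)))"
    if J: "J \<ge> 1" and t: "t \<in> {e / 2..e}" for J t
  proof -
    define \<xi> where "\<xi> = 2 ^ J * (2 * pi / 3) + t"
    have t0: "t > 0" using t e by auto
    have d: "\<xi> / 2 ^ J - 2 * pi / 3 = t / 2 ^ J" by (simp add: \<xi>_def add_divide_distrib)
    have J2: "(2::real) \<le> 2 ^ J" using J power_increasing[of 1 J "2::real"] by simp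
    have tJ: "t / 2 ^ J \<le> t / 2" using J2 t0 by (intro divide_left_mono) auto
    \<comment> \<open>\<open>\<xi>\<close> is about 2/3, hence below 4/5, of
      \<open>2 ^ J * pi\<close>: only the factors with index up to \<open>J\<close> can differ from
      1.\<close>
    have sc: "\<bar>\<xi>\<bar> \<le> 2 ^ Suc (Suc J) * (pi / 5)"
    proof -
      have "2 ^ Suc (Suc J) * (pi / 5) - \<xi> = 2 ^ J * (2 * pi / 15) - t" by (simp add: \<xi>_def algebra_simps)
      moreover have "2 * (2 * pi / 15) \<le> 2 ^ J * (2 * pi / 15)" using J2 by (intro mult_right_mono) auto
      moreover have "t \<le> 2 * (2 * pi / 15)" using t e pi_gt3 by simp
      moreover have "\<xi> > 0" using t0 by (simp add: \<xi>_def add_pos_pos)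
      ultimately show ?thesis by linarith
    qed
    have "\<bar>phat \<xi>\<bar> = (\<Prod>j<J. \<bar>m0 (\<xi> / 2 ^ Suc j)\<bar>) * \<bar>m0 (\<xi> / 2 ^ Suc J)\<bar>"
      by (simp add: phat_finite[OF sc] abs_mult abs_prod)
    moreover have "\<bar>m0 (\<xi> / 2 ^ Suc J)\<bar> \<ge> 1 / 2"
    proof -
      define y where "y = t / 2 ^ J"
      have y: "\<xi> / 2 ^ Suc J - pi / 3 = y / 2" "y > 0" "y \<le> t / 2"
        using d t0 tJ by (simp_all add: y_def)
      have "\<bar>\<xi> / 2 ^ Suc J - pi / 3\<bar> < \<delta>"
        unfolding y(1) using y(2,3) t e unfolding atLeastAtMost_iff by linarith
      then have "\<bar>m0 (\<xi> / 2 ^ Suc J) - m0 (pi / 3)\<bar> < 1 / 2" by (rule \<delta>(2))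
      then show ?thesis using m1 by linarith
    qed
    moreover have "exp (- (C * real J powr (1 + s))) \<le> (\<Prod>j<J. \<bar>m0 (\<xi> / 2 ^ Suc j)\<bar>)"
    proof -
      define B where "B = C1' * exp (- (\<rho>1 * (L * real J) powr s))"
      have B: "B \<le> \<bar>m0 (\<xi> / 2 ^ Suc j)\<bar>" if j: "j < J" for j
      proof -
        define k where "k = J - Suc j"
        have k: "k < J" "J - Suc k = j" using j by (auto simp: k_def)
        define x where "x = (-2) ^ k * (t / 2 ^ J)"
        have eq: "m0 (\<xi> / 2 ^ Suc j) = m0 (2 * pi / 3 + x)"
          using phat_factor[OF k(1), of \<xi>] by (simp only: k(2) d x_def)
        have ax: "\<bar>x\<bar> = 2 ^ k * (t / 2 ^ J)" using t0 by (simp add: x_def abs_mult power_abs)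
        have "(2::real) ^ k \<le> 2 ^ J" using k by (intro power_increasing) auto
        then have "\<bar>x\<bar> \<le> 2 ^ J * (t / 2 ^ J)" unfolding ax using t0 by (intro mult_right_mono) auto
        then have x1: "\<bar>x\<bar> \<le> \<epsilon>" using t e by simp
        have x0: "x \<noteq> 0" using t0 by (simp add: x_def)
        have "(1::real) \<le> 2 ^ k" by simp
        then have "1 * (t / 2 ^ J) \<le> \<bar>x\<bar>" unfolding ax using t0 by (intro mult_right_mono) auto
        then have "1 / \<bar>x\<bar> \<le> 1 / (t / 2 ^ J)" using t0 by (intro divide_left_mono) (auto simp: x0)
        also have "\<dots> = 2 ^ J / t" by simp
        also have "\<dots> \<le> 2 ^ J / (e / 2)" using t e t0 by (intro divide_left_mono) auto
        finally have "1 + 1 / \<bar>x\<bar> \<le> 2 ^ J * (1 + 2 / e)"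
          using J2 by (simp add: algebra_simps)
        then have "ln (1 + 1 / \<bar>x\<bar>) \<le> ln (2 ^ J * (1 + 2 / e))"
          using e by (subst ln_le_cancel_iff) (auto intro!: add_pos_nonneg mult_pos_pos)
        also have "\<dots> = real J * ln 2 + ln (1 + 2 / e)"
        proof -
          have "1 + 2 / e > 0" using e by (simp add: add_pos_pos)
          then show ?thesis by (simp add: ln_mult ln_realpow)
        qed
        also have "\<dots> \<le> real J * 3 + real J * ln (1 + 2 / e)"
        proof (rule add_mono)
          show "real J * ln 2 \<le> real J * 3" using ln_le_minus_one[of "2::real"] by (intro mult_left_mono) auto
          have "1 * ln (1 + 2 / e) \<le> real J * ln (1 + 2 / e)" using J e by (intro mult_right_mono) auto
          then show "ln (1 + 2 / e) \<le> real J * ln (1 + 2 / e)" by simp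
        qed
        also have "\<dots> = L * real J" by (simp add: L_def algebra_simps)
        finally have "g_weight \<sigma> (1 / x) \<le> omega \<sigma> (L * real J)"
          unfolding g_weight_def by (intro omega_mono \<sigma>) (auto simp: abs_divide)
        also have "\<dots> \<le> (L * real J) powr s"
          unfolding s_def
        proof (rule omega_le_powr[OF \<sigma>])
          have "exp 1 \<le> (3::real)" by (rule exp_le)
          also have "3 * 1 \<le> L * real J" using L J by (intro mult_mono) auto
          finally show "exp 1 \<le> L * real J" by simp
        qed
        finally have "exp (- (\<rho>1 * (L * real J) powr s)) \<le> exp (- \<rho>1 * g_weight \<sigma> (1 / x))"
          using pos by (simp add: mult_left_mono)
        then have "B \<le> C1 * exp (- \<rho>1 * g_weight \<sigma> (1 / x))"
          unfolding B_def using C1' by (intro mult_mono) auto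
        also have "\<dots> = C1 * f_flat \<rho>1 \<sigma> x" using x0 by (simp add: f_flat_def)
        also have "\<dots> \<le> \<bar>m0 (\<xi> / 2 ^ Suc j)\<bar>" unfolding eq by (rule lower[OF x1])
        finally show ?thesis .
      qed
      have B0: "B \<ge> 0" using C1' by (simp add: B_def)
      have "exp (- (C * real J powr (1 + s))) \<le> B ^ J"
      proof -
        have "B = exp (ln C1' - \<rho>1 * (L * real J) powr s)" using C1' by (simp add: B_def exp_diff exp_minus divide_inverse)
        then have "B ^ J = exp (real J * (ln C1' - \<rho>1 * (L * real J) powr s))" by (simp add: exp_of_nat_mult)
        moreover have "- (C * real J powr (1 + s)) \<le> real J * (ln C1' - \<rho>1 * (L * real J) powr s)"
        proof -
          have f1: "real J * (\<rho>1 * (L * real J) powr s) = \<rho>1 * L powr s * real J powr (1 + s)"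
          proof -
            have "(L * real J) powr s = L powr s * real J powr s" using L by (simp add: powr_mult)
            moreover have "real J powr (1 + s) = real J * real J powr s" using J by (simp add: powr_add)
            ultimately show ?thesis by simp
          qed
          have f2: "real J powr (1 + s) * ln C1' \<le> real J * ln C1'"
          proof (rule mult_right_mono_neg)
            have "real J powr 1 \<le> real J powr (1 + s)" using J s by (intro powr_mono) auto
            then show "real J \<le> real J powr (1 + s)" using J by simp
          qed (use C1' in simp)
          have "- (C * real J powr (1 + s)) =
              real J powr (1 + s) * ln C1' - \<rho>1 * L powr s * real J powr (1 + s)"
            by (simp add: C_def algebra_simps)
          then show ?thesis unfolding right_diff_distrib f1 using f2 by linarith
        qed
        ultimately show ?thesis by simp
      qed
      also have "\<dots> = (\<Prod>j<J. B)" by simp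
      also have "\<dots> \<le> (\<Prod>j<J. \<bar>m0 (\<xi> / 2 ^ Suc j)\<bar>)" using B B0 by (intro prod_mono) auto
      finally show ?thesis .
    qed
    ultimately have "\<bar>phat \<xi>\<bar> \<ge> exp (- (C * real J powr (1 + s))) * (1 / 2)"
      by (simp only:) (intro mult_mono, auto intro: prod_nonneg)
    then show ?thesis by (simp add: \<xi>_def)
  qed
  show ?thesis
  proof (rule that)
    fix J :: nat assume J: "J \<ge> 1"
    have "continuous_on {e / 2..e} (\<lambda>t. phat (2 ^ J * (2 * pi / 3) + t))"
      by (rule continuous_on_compose2[OF continuous_phat]) (auto intro!: continuous_intros)
    then show "\<exists>s. \<bar>s\<bar> = 1 \<and> (\<forall>t\<in>{e / 2..e}. s * phat (2 ^ J * (2 * pi / 3) + t)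
        \<ge> 1 / 2 * exp (- (C * real J powr (1 + \<sigma> / (\<sigma> - 1)))))"
      using est[OF J] unfolding s_def[symmetric] by (intro constant_sign) auto
  qed (use e in auto)
qed

end

text \<open>The quantity \<open>sigma_eta \<sigma> \<eta> - 1 = (\<sigma> - 1) / (1 + \<eta> *
  (\<sigma> - 1))\<close> decreases in \<open>\<eta>\<close>, and its value at
  \<open>\<eta> = 1\<close> is \<open>(\<sigma> - 1) / \<sigma>\<close>, the reciprocal of the
  left-hand side.\<close>

lemma sigma_eta_exponent:
  assumes "\<sigma> > 1" "\<eta> > 1" "1 < \<sigma>'" "\<sigma>' < sigma_eta \<sigma> \<eta>"
  shows "\<sigma> / (\<sigma> - 1) < 1 / (\<sigma>' - 1)"
proof -
  have p: "1 + \<eta> * (\<sigma> - 1) > 0" using assms by (simp add: add_pos_pos)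
  have "sigma_eta \<sigma> \<eta> - 1 = (\<sigma> - 1) / (1 + \<eta> * (\<sigma> - 1))"
    using p by (simp add: sigma_eta_def field_simps)
  then have "\<sigma>' - 1 < (\<sigma> - 1) / (1 + \<eta> * (\<sigma> - 1))" using assms by linarith
  then have "(\<sigma>' - 1) * (1 + \<eta> * (\<sigma> - 1)) < \<sigma> - 1" using p by (simp add: pos_less_divide_eq)
  moreover have "(\<sigma>' - 1) * \<sigma> \<le> (\<sigma>' - 1) * (1 + \<eta> * (\<sigma> - 1))"
  proof (intro mult_left_mono)
    have "1 * (\<sigma> - 1) \<le> \<eta> * (\<sigma> - 1)" using assms by (intro mult_right_mono) auto
    then show "\<sigma> \<le> 1 + \<eta> * (\<sigma> - 1)" by simp
  qed (use assms in simp)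
  ultimately have "(\<sigma>' - 1) * \<sigma> < \<sigma> - 1" by linarith
  then show ?thesis using assms by (simp add: field_simps)
qed

theorem theorem3p3:
  fixes m0 :: "real \<Rightarrow> real" and \<phi> \<phi>hat :: "real \<Rightarrow> complex"
    and \<sigma> \<epsilon> C0 C1 \<rho>0 \<rho>1 :: real
  assumes low_pass: "low_pass_filter (\<lambda>\<xi>. complex_of_real (m0 \<xi>)) \<phi>"
    and fourier: "L2_fourier_transform \<phi> \<phi>hat"
    and scaling: "\<And>\<xi>. \<phi>hat \<xi> = complex_of_real (\<Prod>j. m0 (\<xi> / 2 ^ Suc j))"
    and cont: "continuous_on UNIV m0"
    and even: "\<And>\<xi>. m0 (- \<xi>) = m0 \<xi>"
    and periodic: "\<And>\<xi>. m0 (\<xi> + 2 * pi) = m0 \<xi>"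
    and at_0: "m0 0 = 1"
    and inf_nonzero: "(INF \<xi>\<in>{- pi / 3..pi / 3}. \<bar>m0 \<xi>\<bar>) \<noteq> 0"
    and quadrature: "\<And>\<xi>. \<bar>m0 \<xi>\<bar>\<^sup>2 + \<bar>m0 (\<xi> + pi)\<bar>\<^sup>2 = 1"
    and nonzero_set: "{\<xi>. m0 \<xi> \<noteq> 0} \<inter> {0..pi} \<subseteq> {0..<4 * pi / 5}"
    and sigma: "\<sigma> > 1"
    and constants: "\<epsilon> > 0" "C0 > 0" "C1 > 0" "\<rho>0 > 0" "\<rho>1 > 0"
    and bounds: "\<And>\<xi>. \<xi> \<in> {2 * pi / 3 - \<epsilon>..2 * pi / 3 + \<epsilon>} \<Longrightarrow>
        C1 * f_flat \<rho>1 \<sigma> (\<xi> - 2 * pi / 3) \<le> \<bar>m0 \<xi>\<bar> \<and>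
        \<bar>m0 \<xi>\<bar> \<le> C0 * f_flat \<rho>0 \<sigma> (\<xi> - 2 * pi / 3)"
  shows "\<forall>\<eta>>1.
      \<phi>hat \<in> Gamma_class \<sigma> - (\<Union>\<sigma>'\<in>{1<..<sigma_eta \<sigma> \<eta>}. Gamma_class \<sigma>') \<and>
      (\<exists>\<psi>. (AE x in lborel. \<phi> x = \<psi> x) \<and>
        \<psi> \<in> ext_gevrey \<sigma> - (\<Union>\<sigma>'\<in>{1<..<sigma_eta \<sigma> \<eta>}. ext_gevrey \<sigma>'))"
proof -
  interpret low_pass_setup m0
    using cont even periodic at_0 quadrature nonzero_set by unfold_locales
  have \<phi>hat: "\<phi>hat = (\<lambda>\<xi>. complex_of_real (phat \<xi>))"
    using scaling by (auto simp: phat_def)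
  have b: "C1 * f_flat \<rho>1 \<sigma> x \<le> \<bar>m0 (2 * pi / 3 + x)\<bar> \<and> \<bar>m0 (2 * pi / 3 + x)\<bar> \<le> C0 * f_flat \<rho>0 \<sigma> x"
    if "\<bar>x\<bar> \<le> \<epsilon>" for x
    using bounds[of "2 * pi / 3 + x"] that by (simp add: abs_le_iff)
  have zero: "m0 (2 * pi / 3) = 0"
    using b[of 0] constants by (simp add: f_flat_def)
  have G: "\<phi>hat \<in> Gamma_class \<sigma>"
    unfolding \<phi>hat using b by (intro phat_Gamma_class[OF sigma constants(1,2,4)]) auto
  obtain e C where e: "0 < e" "e \<le> 1" and
    lower: "\<And>J. J \<ge> 1 \<Longrightarrow> \<exists>s. \<bar>s\<bar> = 1 \<and> (\<forall>t\<in>{e / 2..e}. s * phat (2 ^ J * (2 * pi / 3) + t)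
        \<ge> 1 / 2 * exp (- (C * real J powr (1 + \<sigma> / (\<sigma> - 1)))))"
    using phat_lower_bound[OF sigma constants(1,3,5) zero] b by blast
  have not_gevrey: "inv_fourier \<phi>hat \<notin> ext_gevrey \<sigma>'"
    if "\<eta> > 1" "1 < \<sigma>'" "\<sigma>' < sigma_eta \<sigma> \<eta>" for \<eta> \<sigma>'
    unfolding \<phi>hat
  proof (rule inv_fourier_not_ext_gevrey[OF G[unfolded \<phi>hat] sigma e, where c = "1 / 2"
        and C = C and \<beta> = "1 + \<sigma> / (\<sigma> - 1)"])
    show "1 + \<sigma> / (\<sigma> - 1) - 1 < 1 / (\<sigma>' - 1)"
      using sigma_eta_exponent[OF sigma that] by simp
  qed (use sigma that lower phat_support_dyadic in auto)
  have integrable: "integrable lborel \<phi>hat"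
    using Gamma_class_integrable_power[OF G sigma, of 0] by simp
  \<comment> \<open>\<open>inv_fourier \<phi>hat\<close> is the witness \<open>\<psi>\<close>: the
    smooth representative of \<open>\<phi>\<close>, which its transform determines only up to a null
    set.\<close>
  have "AE x in lborel. \<phi> x = inv_fourier \<phi>hat x"
    by (rule L2_fourier_inversion[OF fourier integrable])
  moreover have "inv_fourier \<phi>hat \<in> ext_gevrey \<sigma>"
    by (rule inv_fourier_ext_gevrey[OF G sigma])
  moreover have "\<phi>hat \<notin> Gamma_class \<sigma>'" if "\<eta> > 1" "1 < \<sigma>'" "\<sigma>' < sigma_eta \<sigma> \<eta>" for \<eta> \<sigma>'
    using not_gevrey[OF that] inv_fourier_ext_gevrey that(2) by blast
  ultimately show ?thesis using G not_gevrey by fastforce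
qed

end
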